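(* Let $\mathbf a:\mathbb Z\times S^1\to GL(d)$, $(n,\lambda)\mapsto a_n(\lambda)$, be continuous, with $a_n(\lambda)\to a(\lambda,\pm\infty)$ as $n\to\pm\infty$ uniformly in $\lambda\in S^1$ and $a(\lambda,\pm\infty)$ hyperbolic for all $\lambda$. Let $L_\lambda=S-A_\lambda:\ell^2\to\ell^2$, where $A_\lambda\mathbf x=(a_n(\lambda)x_n)$. Then: (i) $L_\lambda$ is a Fredholm operator for every $\lambda\in S^1$, with $\operatorname{ind}L_\lambda=\dim E^s(a(\lambda,+\infty))-\dim E^s(a(\lambda,-\infty))$; (ii) $\operatorname{Ind}L=[E^s(+\infty)]-[E^s(-\infty)]\in KO(S^1)$.
   Context: $\ell^2$ is the Hilbert space of sequences $\mathbf x=(x_n)_{n\in\mathbb Z}$ in $\mathbb R^d$ with $\sum|x_n|^2<\infty$; $S\mathbf x=(x_{n+1})$. A matrix $a\in GL(d)$ is hyperbolic if it has no eigenvalue of modulus one; $E^s(a)$ (resp. $E^u(a)$) is the real part of the sum of generalized eigenspaces for eigenvalues of modulus $<1$ (resp. $>1$). $E^s(\pm\infty)$ is the vector bundle over $S^1$ with fiber $E^s(a(\lambda,\pm\infty))$ over $\lambda$. $KO(\Lambda)$ is the Grothendieck group (group completion of the semigroup of isomorphism classes) of real vector bundles over a compact space $\Lambda$; $[E]$ is the class of $E$. Index bundle: for a continuous family $L:\Lambda\to\Phi(X,Y)$ of Fredholm operators between Banach spaces over compact $\Lambda$, choose a finite-dimensional subspace $V\subset Y$ with $\operatorname{Im}L_\lambda+V=Y$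 for all $\lambda$; then $E_\lambda=L_\lambda^{-1}(V)$ are the fibers of a vector bundle $E$ over $\Lambda$, and $\operatorname{Ind}L:=[E]-[\Lambda\times V]\in KO(\Lambda)$ (independent of $V$). *)

theory Defs
  imports "HOL-Analysis.Analysis" "HOL-Library.Function_Algebras"
begin

instantiation "fun" :: (type, real_vector) real_vector
begin
definition scaleR_fun :: "real \<Rightarrow> ('a \<Rightarrow> 'b) \<Rightarrow> 'a \<Rightarrow> 'b"
  where "scaleR_fun r f = (\<lambda>x. r *\<^sub>R f x)"
instance
  by standard (auto simp: scaleR_fun_def fun_eq_iff scaleR_add_right scaleR_add_left)
end

abbreviation S1 :: "complex set" where "S1 \<equiv> sphere 0 1"

definition complexify_mat :: "real^'d^'d \<Rightarrow> complex^'d^'d" where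
  "complexify_mat M = (\<chi> i j. complex_of_real (M $ i $ j))"

definition complexify_vec :: "real^'d \<Rightarrow> complex^'d" where
  "complexify_vec x = (\<chi> i. complex_of_real (x $ i))"

definition hyperbolic :: "real^'d^'d \<Rightarrow> bool" where
  "hyperbolic M \<longleftrightarrow> invertible M \<and>
     (\<forall>z::complex. cmod z = 1 \<longrightarrow> det (complexify_mat M - mat z) \<noteq> 0)"

definition gen_eigenspace :: "real^'d^'d \<Rightarrow> complex \<Rightarrow> (complex^'d) set" where
  "gen_eigenspace M z =
     {v. ((\<lambda>w. (complexify_mat M - mat z) *v w) ^^ CARD('d)) v = 0}"

text \<open>E^s(M): real part of the sum of the generalized eigenspaces for eigenvalues
  of modulus < 1 (the sum of the complex subspaces equals the span of their union)\<close>
definition Es :: "real^'d^'d \<Rightarrow> (real^'d) set" where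
  "Es M = {x. complexify_vec x \<in> span (\<Union>z\<in>{z. cmod z < 1}. gen_eigenspace M z)}"

definition l2 :: "(int \<Rightarrow> real^'d) set" where
  "l2 = {x. (\<lambda>n. (norm (x n))\<^sup>2) summable_on UNIV}"

definition l2norm :: "(int \<Rightarrow> real^'d) \<Rightarrow> real" where
  "l2norm x = sqrt (infsum (\<lambda>n. (norm (x n))\<^sup>2) UNIV)"

definition shift :: "(int \<Rightarrow> 'a) \<Rightarrow> int \<Rightarrow> 'a" where
  "shift x = (\<lambda>n. x (n + 1))"

definition Lop :: "(int \<Rightarrow> complex \<Rightarrow> real^'d^'d) \<Rightarrow> complex \<Rightarrow> (int \<Rightarrow> real^'d) \<Rightarrow> (int \<Rightarrow> real^'d)" where
  "Lop a lam x = shift x - (\<lambda>n. a n lam *v x n)"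

definition range_l2 :: "((int \<Rightarrow> real^'d) \<Rightarrow> (int \<Rightarrow> real^'d)) \<Rightarrow> (int \<Rightarrow> real^'d) set" where
  "range_l2 T = T ` l2"

definition kernel_l2 :: "((int \<Rightarrow> real^'d) \<Rightarrow> (int \<Rightarrow> real^'d)) \<Rightarrow> (int \<Rightarrow> real^'d) set" where
  "kernel_l2 T = {x \<in> l2. T x = 0}"

definition bounded_linear_l2 :: "((int \<Rightarrow> real^'d) \<Rightarrow> (int \<Rightarrow> real^'d)) \<Rightarrow> bool" where
  "bounded_linear_l2 T \<longleftrightarrow> (\<forall>x\<in>l2. T x \<in> l2) \<and>
     (\<forall>x\<in>l2. \<forall>y\<in>l2. \<forall>c::real. T (x + y) = T x + T y \<and> T (c *\<^sub>R x) = c *\<^sub>R T x) \<and>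
     (\<exists>C. \<forall>x\<in>l2. l2norm (T x) \<le> C * l2norm x)"

definition closed_l2 :: "(int \<Rightarrow> real^'d) set \<Rightarrow> bool" where
  "closed_l2 Y \<longleftrightarrow> (\<forall>y k. (\<forall>j. k j \<in> Y) \<and> y \<in> l2 \<and> (\<lambda>j. l2norm (k j - y)) \<longlonglongrightarrow> 0 \<longrightarrow> y \<in> Y)"

definition finite_dim :: "'a::real_vector set \<Rightarrow> bool" where
  "finite_dim V \<longleftrightarrow> (\<exists>B. finite B \<and> V \<subseteq> span B)"

definition fin_supplement :: "(int \<Rightarrow> real^'d) set \<Rightarrow> (int \<Rightarrow> real^'d) set \<Rightarrow> bool" where
  "fin_supplement Y V \<longleftrightarrow> subspace V \<and> V \<subseteq> l2 \<and> finite_dim V \<and>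
     {y + v | y v. y \<in> Y \<and> v \<in> V} = l2"

definition codim_l2 :: "(int \<Rightarrow> real^'d) set \<Rightarrow> nat" where
  "codim_l2 Y = (LEAST k. \<exists>V. fin_supplement Y V \<and> dim V = k)"

definition fredholm_l2 :: "((int \<Rightarrow> real^'d) \<Rightarrow> (int \<Rightarrow> real^'d)) \<Rightarrow> bool" where
  "fredholm_l2 T \<longleftrightarrow> bounded_linear_l2 T \<and> finite_dim (kernel_l2 T) \<and>
     closed_l2 (range_l2 T) \<and> (\<exists>V. fin_supplement (range_l2 T) V)"

definition fred_index :: "((int \<Rightarrow> real^'d) \<Rightarrow> (int \<Rightarrow> real^'d)) \<Rightarrow> int" where
  "fred_index T = int (dim (kernel_l2 T)) - int (codim_l2 (range_l2 T))"

definition cont_nm :: "('x::ab_group_add \<Rightarrow> real) \<Rightarrow> complex set \<Rightarrow> (complex \<Rightarrow> 'x) \<Rightarrow> bool" where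
  "cont_nm nm U s \<longleftrightarrow> (\<forall>l\<in>U. \<forall>e>0. \<exists>d>0. \<forall>m\<in>U. dist m l < d \<longrightarrow> nm (s m - s l) < e)"

definition is_bundle :: "'x::real_vector set \<Rightarrow> ('x \<Rightarrow> real) \<Rightarrow> complex set \<Rightarrow> (complex \<Rightarrow> 'x set) \<Rightarrow> bool" where
  "is_bundle C nm Lam E \<longleftrightarrow>
     (\<forall>l\<in>Lam. subspace (E l) \<and> E l \<subseteq> C) \<and>
     (\<forall>l0\<in>Lam. \<exists>U (k::nat) s. openin (top_of_set Lam) U \<and> l0 \<in> U \<and>
        (\<forall>i<k. cont_nm nm U (s i)) \<and>
        (\<forall>l\<in>U. inj_on (\<lambda>i. s i l) {..<k} \<and> independent ((\<lambda>i. s i l) ` {..<k}) \<and>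
                 span ((\<lambda>i. s i l) ` {..<k}) = E l))"

text \<open>isomorphism of bundles: fibrewise linear bijections, continuous in both
  directions (they map continuous local sections to continuous local sections)\<close>
definition bundle_iso :: "('x::real_vector \<Rightarrow> real) \<Rightarrow> ('y::real_vector \<Rightarrow> real) \<Rightarrow> complex set \<Rightarrow>
    (complex \<Rightarrow> 'x set) \<Rightarrow> (complex \<Rightarrow> 'y set) \<Rightarrow> bool" where
  "bundle_iso nm1 nm2 Lam E F \<longleftrightarrow> (\<exists>\<phi> \<psi>.
     (\<forall>l\<in>Lam. (\<forall>x\<in>E l. \<forall>y\<in>E l. \<forall>c::real. \<phi> l (x + y) = \<phi> l x + \<phi> l y \<and> \<phi> l (c *\<^sub>R x) = c *\<^sub>R \<phi> l x) \<and>
        \<phi> l ` E l \<subseteq> F l \<and> \<psi> l ` F l \<subseteq> E l \<and>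
        (\<forall>x\<in>E l. \<psi> l (\<phi> l x) = x) \<and> (\<forall>y\<in>F l. \<phi> l (\<psi> l y) = y)) \<and>
     (\<forall>U s. openin (top_of_set Lam) U \<and> (\<forall>l\<in>U. s l \<in> E l) \<and> cont_nm nm1 U s
        \<longrightarrow> cont_nm nm2 U (\<lambda>l. \<phi> l (s l))) \<and>
     (\<forall>U s. openin (top_of_set Lam) U \<and> (\<forall>l\<in>U. s l \<in> F l) \<and> cont_nm nm2 U s
        \<longrightarrow> cont_nm nm1 U (\<lambda>l. \<psi> l (s l))))"

definition dsum :: "(complex \<Rightarrow> 'x set) \<Rightarrow> (complex \<Rightarrow> 'y set) \<Rightarrow> complex \<Rightarrow> ('x \<times> 'y) set" where
  "dsum E F = (\<lambda>l. E l \<times> F l)"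

definition prod_nm :: "('x \<Rightarrow> real) \<Rightarrow> ('y \<Rightarrow> real) \<Rightarrow> 'x \<times> 'y \<Rightarrow> real" where
  "prod_nm nm1 nm2 = (\<lambda>(x, y). nm1 x + nm2 y)"

text \<open>Equality [E1] - [E2] = [F1] - [F2] in KO(Lam) (Grothendieck group), for bundles
  E1, E2 with fibres in l^2 and F1, F2 with fibres in R^d: by definition of the group
  completion this means that E1 + F2 + G and F1 + E2 + G are isomorphic for some
  vector bundle G (every bundle over a compact space is realisable inside l^2).\<close>
definition KO_diff_eq :: "complex set \<Rightarrow> (complex \<Rightarrow> (int \<Rightarrow> real^'d) set) \<Rightarrow> (complex \<Rightarrow> (int \<Rightarrow> real^'d) set)
    \<Rightarrow> (complex \<Rightarrow> (real^'d) set) \<Rightarrow> (complex \<Rightarrow> (real^'d) set) \<Rightarrow> bool" where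
  "KO_diff_eq Lam E1 E2 F1 F2 \<longleftrightarrow> (\<exists>G :: complex \<Rightarrow> (int \<Rightarrow> real^'d) set. is_bundle l2 l2norm Lam G \<and>
     bundle_iso (prod_nm (prod_nm l2norm norm) l2norm) (prod_nm (prod_nm norm l2norm) l2norm) Lam
       (dsum (dsum E1 F2) G) (dsum (dsum F1 E2) G))"

definition preimage_bundle :: "(complex \<Rightarrow> (int \<Rightarrow> real^'d) \<Rightarrow> (int \<Rightarrow> real^'d)) \<Rightarrow> (int \<Rightarrow> real^'d) set
    \<Rightarrow> complex \<Rightarrow> (int \<Rightarrow> real^'d) set" where
  "preimage_bundle L V l = {x \<in> l2. L l x \<in> V}"

definition fin_supplement_all :: "(int \<Rightarrow> complex \<Rightarrow> real^'d^'d) \<Rightarrow> (int \<Rightarrow> real^'d) set \<Rightarrow> bool" where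
  "fin_supplement_all a V \<longleftrightarrow> (\<forall>lam\<in>S1. fin_supplement (range_l2 (Lop a lam)) V)"


end

(* Idea: for a hyperbolic matrix M the operator S - M is invertible on l^2: a product of linear
   factors M - z with |z| <> 1 annihilates the complexification of M, and each S - z is invertible
   by a Neumann series.  The inverse depends continuously on M, evaluates to the projection onto
   E^s(M), and cut to half-lines it is a Green's function there.  Far out on both sides the
   coefficients a_n are small perturbations of the limits, so a Neumann series solves the equation
   off a bounded interval of indices, and a finite recursion solves it off a single index m.  The
   solutions of L x = v off m are x = N e + R v with e in E^s(+oo) + E^u(-oo), so L x = v becomes one
   equation D(e, v) = 0 in R^d.  Hence ind L = dim E^s(+oo) + dim E^u(-oo) - d, and for a
   supplement V the bundle L^{-1}(V) is the kernel of the surjective family D on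
   E^s(+oo) + E^u(-oo) + V.  A continuous right inverse of D gives
   L^{-1}(V) + E^s(-oo) + E^u(-oo) = L^{-1}(V) + R^d = E^s(+oo) + E^u(-oo) + V. *)

theory Submission
  imports Defs "HOL-Computational_Algebra.Fundamental_Theorem_Algebra"
begin

text \<open>The spaces E^s, E^u and L^{-1}(V) move with lambda, so no operator is defined on a
  moving domain: each such space is carried as the range or kernel of a projection on a fixed space
  or as the image of one, and continuity becomes norm continuity of families of bounded operators,
  which inverses inherit. The spectral definition of E^s is met only once, when it is translated
  into initial values of square summable forward orbits; that is what the inverse of S - M sees.
  E^u(-oo) appears as the kernel of the projection onto E^s(-oo). The obstacle is that a Neumann
  series needs small perturbations, while between the far ends the a_n are arbitrary. So the
  equations on a middle block are dropped; the bound on the Green's operators does not depend on the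
  block, which can therefore be chosen after it. The dropped equations are put back one by one from
  the left, each giving the next value from the previous one. Only the last, at m, cannot be
  absorbed, since x (m + 1) is already given from the right.\<close>

section \<open>The Banach space of square summable two-sided sequences\<close>

text \<open>The statement uses a set \<open>l2\<close> of functions with a norm
  \<open>l2norm\<close>. As a type, the same space becomes an instance of \<open>banach\<close>, so
  operators on it form a normed space. The entries are of a general type because complex vectors are
  needed for the spectral part.\<close>

typedef (overloaded) 'a ell2 =
  "{x :: int \<Rightarrow> 'a::real_normed_vector. (\<lambda>n. (norm (x n))\<^sup>2) summable_on UNIV}"
  morphisms seq Ell2
  by (rule exI[of _ "\<lambda>_. 0"]) simp

setup_lifting type_definition_ell2

lemma seq_inject_ext: "(\<And>n. seq x n = seq y n) \<Longrightarrow> x = y"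
  by (metis ext seq_inject)

text \<open>Bounds on finite index sets are the form in which the finite Minkowski inequality
  applies and in which operators on sequences are estimated entrywise.\<close>

lemma square_summable_iff_L2_set:
  fixes x :: "int \<Rightarrow> 'a::real_normed_vector"
  shows "(\<lambda>n. (norm (x n))\<^sup>2) summable_on UNIV \<longleftrightarrow>
    (\<exists>K. \<forall>F. finite F \<longrightarrow> L2_set (\<lambda>n. norm (x n)) F \<le> K)"
proof
  assume s: "(\<lambda>n. (norm (x n))\<^sup>2) summable_on UNIV"
  have "L2_set (\<lambda>n. norm (x n)) F \<le> sqrt (infsum (\<lambda>n. (norm (x n))\<^sup>2) UNIV)" if "finite F" for F
    unfolding L2_set_def using finite_sum_le_infsum[OF s that] by simp
  then show "\<exists>K. \<forall>F. finite F \<longrightarrow> L2_set (\<lambda>n. norm (x n)) F \<le> K" by blast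
next
  assume "\<exists>K. \<forall>F. finite F \<longrightarrow> L2_set (\<lambda>n. norm (x n)) F \<le> K"
  then obtain K where K: "\<And>F. finite F \<Longrightarrow> L2_set (\<lambda>n. norm (x n)) F \<le> K" by blast
  have "(\<Sum>n\<in>F. (norm (x n))\<^sup>2) \<le> K\<^sup>2" if "finite F" for F
  proof -
    have "(\<Sum>n\<in>F. (norm (x n))\<^sup>2) = (L2_set (\<lambda>n. norm (x n)) F)\<^sup>2"
      unfolding L2_set_def by (simp add: sum_nonneg)
    also have "\<dots> \<le> K\<^sup>2" using K[OF that] by (intro power_mono) auto
    finally show ?thesis .
  qed
  then show "(\<lambda>n. (norm (x n))\<^sup>2) summable_on UNIV"
    by (intro nonneg_bdd_above_summable_on bdd_aboveI2[where M = "K\<^sup>2"]) auto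
qed

lemma seq_summable: "(\<lambda>n. (norm (seq x n))\<^sup>2) summable_on UNIV"
  using seq[of x] by simp

lemma seq_Ell2:
  assumes "\<And>F. finite F \<Longrightarrow> L2_set (\<lambda>n. norm (f n)) F \<le> K"
  shows "seq (Ell2 f) = f"
  using assms by (intro Ell2_inverse) (auto simp: square_summable_iff_L2_set)

lemma L2_set_triangle_norm:
  fixes x y :: "int \<Rightarrow> 'a::real_normed_vector"
  shows "L2_set (\<lambda>n. norm (x n + y n)) F \<le> L2_set (\<lambda>n. norm (x n)) F + L2_set (\<lambda>n. norm (y n)) F"
proof -
  have "L2_set (\<lambda>n. norm (x n + y n)) F \<le> L2_set (\<lambda>n. norm (x n) + norm (y n)) F"
    by (intro L2_set_mono norm_triangle_ineq) auto
  also have "\<dots> \<le> L2_set (\<lambda>n. norm (x n)) F + L2_set (\<lambda>n. norm (y n)) F"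
    by (rule L2_set_triangle_ineq)
  finally show ?thesis .
qed

lemma square_summable_add:
  fixes x y :: "int \<Rightarrow> 'a::real_normed_vector"
  assumes "(\<lambda>n. (norm (x n))\<^sup>2) summable_on UNIV" "(\<lambda>n. (norm (y n))\<^sup>2) summable_on UNIV"
  shows "(\<lambda>n. (norm (x n + y n))\<^sup>2) summable_on UNIV"
proof -
  obtain K L where "\<And>F. finite F \<Longrightarrow> L2_set (\<lambda>n. norm (x n)) F \<le> K"
      "\<And>F. finite F \<Longrightarrow> L2_set (\<lambda>n. norm (y n)) F \<le> L"
    using assms unfolding square_summable_iff_L2_set by blast
  then have "\<And>F. finite F \<Longrightarrow> L2_set (\<lambda>n. norm (x n + y n)) F \<le> K + L"
    by (rule order_trans[OF L2_set_triangle_norm add_mono])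
  then show ?thesis unfolding square_summable_iff_L2_set by blast
qed

lemma square_summable_scaleR:
  fixes x :: "int \<Rightarrow> 'a::real_normed_vector"
  assumes "(\<lambda>n. (norm (x n))\<^sup>2) summable_on UNIV"
  shows "(\<lambda>n. (norm (r *\<^sub>R x n))\<^sup>2) summable_on UNIV"
  using summable_on_cmult_right[OF assms, of "r\<^sup>2"] by (simp add: power_mult_distrib)

instantiation ell2 :: (real_normed_vector) real_vector
begin
lift_definition zero_ell2 :: "'a ell2" is "\<lambda>_. 0" by simp
lift_definition plus_ell2 :: "'a ell2 \<Rightarrow> 'a ell2 \<Rightarrow> 'a ell2" is "\<lambda>x y n. x n + y n"
  by (rule square_summable_add)
lift_definition uminus_ell2 :: "'a ell2 \<Rightarrow> 'a ell2" is "\<lambda>x n. - x n" by simp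
lift_definition minus_ell2 :: "'a ell2 \<Rightarrow> 'a ell2 \<Rightarrow> 'a ell2" is "\<lambda>x y n. x n - y n"
  using square_summable_add[of _ "\<lambda>n. - y n" for y] by fastforce
lift_definition scaleR_ell2 :: "real \<Rightarrow> 'a ell2 \<Rightarrow> 'a ell2" is "\<lambda>r x n. r *\<^sub>R x n"
  by (rule square_summable_scaleR)
instance
  by standard (transfer; simp add: algebra_simps)+
end

lemma seq_zero [simp]: "seq 0 n = 0"
  and seq_add [simp]: "seq (x + y) n = seq x n + seq y n"
  and seq_uminus [simp]: "seq (- x) n = - seq x n"
  and seq_diff [simp]: "seq (x - y) n = seq x n - seq y n"
  and seq_scaleR [simp]: "seq (r *\<^sub>R x) n = r *\<^sub>R seq x n"
  by (transfer; simp)+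

instantiation ell2 :: (real_normed_vector) real_normed_vector
begin
definition norm_ell2 :: "'a ell2 \<Rightarrow> real"
  where "norm_ell2 x = sqrt (infsum (\<lambda>n. (norm (seq x n))\<^sup>2) UNIV)"
definition dist_ell2 :: "'a ell2 \<Rightarrow> 'a ell2 \<Rightarrow> real"
  where "dist_ell2 x y = norm (x - y)"
definition uniformity_ell2 :: "('a ell2 \<times> 'a ell2) filter"
  where "uniformity_ell2 = (INF e\<in>{0 <..}. principal {(x, y). dist x y < e})"
definition sgn_ell2 :: "'a ell2 \<Rightarrow> 'a ell2"
  where "sgn_ell2 x = x /\<^sub>R norm x"
definition open_ell2 :: "'a ell2 set \<Rightarrow> bool"
  where "open_ell2 S = (\<forall>x\<in>S. \<forall>\<^sub>F (x', y) in uniformity. x' = x \<longrightarrow> y \<in> S)"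

lemma L2_set_le_norm: "finite F \<Longrightarrow> L2_set (\<lambda>n. norm (seq x n)) F \<le> norm x"
  unfolding L2_set_def norm_ell2_def using finite_sum_le_infsum[OF seq_summable] by simp

lemma norm_ell2_le:
  fixes x :: "'a ell2"
  assumes "\<And>F. finite F \<Longrightarrow> L2_set (\<lambda>n. norm (seq x n)) F \<le> K"
  shows "norm x \<le> K"
proof -
  have K0: "0 \<le> K" using assms[of "{}"] by simp
  have "(\<Sum>n\<in>F. (norm (seq x n))\<^sup>2) \<le> K\<^sup>2" if "finite F" for F
  proof -
    have "(\<Sum>n\<in>F. (norm (seq x n))\<^sup>2) = (L2_set (\<lambda>n. norm (seq x n)) F)\<^sup>2"
      unfolding L2_set_def by (simp add: sum_nonneg)
    also have "\<dots> \<le> K\<^sup>2" using assms[OF that] by (intro power_mono) auto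
    finally show ?thesis .
  qed
  then have "infsum (\<lambda>n. (norm (seq x n))\<^sup>2) UNIV \<le> K\<^sup>2"
    by (intro infsum_le_finite_sums seq_summable)
  then show ?thesis unfolding norm_ell2_def using K0 real_le_lsqrt by auto
qed

instance
proof
  fix x y :: "'a ell2" and r :: real
  show "dist x y = norm (x - y)" by (rule dist_ell2_def)
  show "sgn x = x /\<^sub>R norm x" by (rule sgn_ell2_def)
  show "uniformity = (INF e\<in>{0 <..}. principal {(x, y :: 'a ell2). dist x y < e})"
    by (rule uniformity_ell2_def)
  show "open S = (\<forall>x\<in>S. \<forall>\<^sub>F (x', y) in uniformity. x' = x \<longrightarrow> y \<in> S)" for S :: "'a ell2 set"
    by (rule open_ell2_def)
  show "(norm x = 0) = (x = 0)"
  proof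
    assume z: "norm x = 0"
    have "norm (seq x n) \<le> 0" for n
      using L2_set_le_norm[of "{n}" x] z by simp
    then show "x = 0" by (intro seq_inject_ext) auto
  qed (simp add: norm_ell2_def)
  show "norm (x + y) \<le> norm x + norm y"
    using order_trans[OF L2_set_triangle_norm add_mono[OF L2_set_le_norm L2_set_le_norm]]
    by (intro norm_ell2_le) auto
  show "norm (r *\<^sub>R x) = \<bar>r\<bar> * norm x"
    unfolding norm_ell2_def
    by (simp add: power_mult_distrib infsum_cmult_right' real_sqrt_mult)
qed
end

lemma norm_seq_le: "norm (seq x n) \<le> norm x"
  using L2_set_le_norm[of "{n}" x] by simp

instance ell2 :: (banach) banach
proof
  fix X :: "nat \<Rightarrow> 'a ell2"
  assume X: "Cauchy X"
  have "Cauchy (\<lambda>k. seq (X k) n)" for n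
    unfolding Cauchy_def dist_norm
  proof safe
    fix e :: real assume "0 < e"
    then obtain M where "\<And>m k. M \<le> m \<Longrightarrow> M \<le> k \<Longrightarrow> norm (X m - X k) < e"
      using X unfolding Cauchy_def dist_norm by blast
    then show "\<exists>M. \<forall>m\<ge>M. \<forall>k\<ge>M. norm (seq (X m) n - seq (X k) n) < e"
      by (metis norm_seq_le order_le_less_trans seq_diff)
  qed
  then have "\<exists>l. (\<lambda>k. seq (X k) n) \<longlonglongrightarrow> l" for n
    using Cauchy_convergent convergent_def by blast
  then obtain f where f: "\<And>n. (\<lambda>k. seq (X k) n) \<longlonglongrightarrow> f n" by metis
  \<comment> \<open>The Cauchy bound passes to the limit in k on every finite index set. It serves
    twice: to see that f is square summable, and to get convergence in norm.\<close>
  have est: "L2_set (\<lambda>n. norm (seq (X m) n - f n)) F \<le> e"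
    if "finite F" "\<And>k. M \<le> k \<Longrightarrow> norm (X m - X k) \<le> e" for F m M e
  proof (rule tendsto_upperbound)
    show "(\<lambda>k. L2_set (\<lambda>n. norm (seq (X m) n - seq (X k) n)) F)
        \<longlonglongrightarrow> L2_set (\<lambda>n. norm (seq (X m) n - f n)) F"
      unfolding L2_set_def by (intro tendsto_intros f)
    show "\<forall>\<^sub>F k in sequentially. L2_set (\<lambda>n. norm (seq (X m) n - seq (X k) n)) F \<le> e"
      unfolding eventually_sequentially
    proof (intro exI allI impI)
      fix k assume "M \<le> k"
      then show "L2_set (\<lambda>n. norm (seq (X m) n - seq (X k) n)) F \<le> e"
        using L2_set_le_norm[OF that(1), of "X m - X k"] that(2)[of k] by simp
    qed
  qed simp
  have cau: "\<exists>M. \<forall>m\<ge>M. \<forall>k\<ge>M. norm (X m - X k) \<le> e" if "e > 0" for e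
    using X that unfolding Cauchy_def dist_norm by (meson less_imp_le)
  obtain M where M: "\<And>m k. M \<le> m \<Longrightarrow> M \<le> k \<Longrightarrow> norm (X m - X k) \<le> 1"
    using cau[of 1] by auto
  have "L2_set (\<lambda>n. norm (f n)) F \<le> norm (X M) + 1" if "finite F" for F
  proof -
    have "L2_set (\<lambda>n. norm (f n)) F = L2_set (\<lambda>n. norm (seq (X M) n + (- (seq (X M) n - f n)))) F"
      by simp
    also have "\<dots> \<le> L2_set (\<lambda>n. norm (seq (X M) n)) F + L2_set (\<lambda>n. norm (- (seq (X M) n - f n))) F"
      by (rule L2_set_triangle_norm)
    also have "\<dots> \<le> norm (X M) + 1"
      unfolding norm_minus_cancel
      by (intro add_mono L2_set_le_norm[OF that] est[OF that, of M] M) auto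
    finally show ?thesis .
  qed
  then have s: "seq (Ell2 f) = f" by (rule seq_Ell2)
  have "X \<longlonglongrightarrow> Ell2 f"
    unfolding LIMSEQ_def dist_norm
  proof safe
    fix e :: real assume "0 < e"
    then obtain M where M: "\<And>m k. M \<le> m \<Longrightarrow> M \<le> k \<Longrightarrow> norm (X m - X k) \<le> e/2"
      using cau[of "e/2"] by auto
    have "norm (X m - Ell2 f) \<le> e/2" if "m \<ge> M" for m
      using est[of _ M m "e/2"] M that by (intro norm_ell2_le) (auto simp: s)
    then show "\<exists>M. \<forall>m\<ge>M. norm (X m - Ell2 f) < e"
      using \<open>0 < e\<close> by (intro exI[of _ M]) fastforce
  qed
  then show "convergent X" unfolding convergent_def by blast
qed

section \<open>Operators on square summable sequences\<close>

lift_definition ev :: "int \<Rightarrow> 'a::real_normed_vector ell2 \<Rightarrow>\<^sub>L 'a" is "\<lambda>n x. seq x n"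
  by (rule bounded_linear_intro[where K = 1]) (auto simp: norm_seq_le)

declare ev.rep_eq [simp]

lemma L2_set_delta_le:
  fixes v :: "'a::real_normed_vector"
  assumes "finite F"
  shows "L2_set (\<lambda>k. norm (if k = n then v else 0)) F \<le> norm v"
proof -
  have "L2_set (\<lambda>k. norm (if k = n then v else 0)) F \<le> (\<Sum>k\<in>F. if k = n then norm v else 0)"
    by (rule order_trans[OF L2_set_le_sum_abs]) (auto intro!: sum_mono)
  also have "\<dots> \<le> norm v" using assms by simp
  finally show ?thesis .
qed

lemma seq_Ell2_delta: "seq (Ell2 (\<lambda>k. if k = n then v else 0)) = (\<lambda>k. if k = n then v else 0)"
  using L2_set_delta_le by (rule seq_Ell2)

lift_definition delta :: "int \<Rightarrow> 'a::real_normed_vector \<Rightarrow>\<^sub>L 'a ell2"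
  is "\<lambda>n v. Ell2 (\<lambda>k. if k = n then v else 0)"
proof (rule bounded_linear_intro[where K = 1])
  fix n :: int and v w :: 'a and r :: real
  show "Ell2 (\<lambda>k. if k = n then v + w else 0) =
      Ell2 (\<lambda>k. if k = n then v else 0) + Ell2 (\<lambda>k. if k = n then w else 0)"
    by (rule seq_inject_ext) (simp add: seq_Ell2_delta)
  show "Ell2 (\<lambda>k. if k = n then r *\<^sub>R v else 0) = r *\<^sub>R Ell2 (\<lambda>k. if k = n then v else 0)"
    by (rule seq_inject_ext) (simp add: seq_Ell2_delta)
  show "norm (Ell2 (\<lambda>k. if k = n then v else 0)) \<le> norm v * 1"
    using L2_set_delta_le[of _ n v] by (intro norm_ell2_le) (simp add: seq_Ell2_delta)
qed

lemma seq_delta [simp]: "seq (delta n v) k = (if k = n then v else 0)"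
  by (simp add: delta.rep_eq seq_Ell2_delta)

lemma seq_Ell2_translate: "seq (Ell2 (\<lambda>n. seq x (n + k))) = (\<lambda>n. seq x (n + k))"
  and norm_translate_le: "norm (Ell2 (\<lambda>n. seq x (n + k))) \<le> norm x"
proof -
  have *: "L2_set (\<lambda>n. norm (seq x (n + k))) F \<le> norm x" if "finite F" for F
  proof -
    have "L2_set (\<lambda>n. norm (seq x (n + k))) F = L2_set (\<lambda>n. norm (seq x n)) ((\<lambda>n. n + k) ` F)"
      unfolding L2_set_def by (subst sum.reindex) (auto simp: o_def)
    also have "\<dots> \<le> norm x" using that by (intro L2_set_le_norm) auto
    finally show ?thesis .
  qed
  show s: "seq (Ell2 (\<lambda>n. seq x (n + k))) = (\<lambda>n. seq x (n + k))"
    using * by (rule seq_Ell2)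
  show "norm (Ell2 (\<lambda>n. seq x (n + k))) \<le> norm x"
    using * by (intro norm_ell2_le) (simp add: s)
qed

lift_definition translate :: "int \<Rightarrow> 'a::real_normed_vector ell2 \<Rightarrow>\<^sub>L 'a ell2"
  is "\<lambda>k x. Ell2 (\<lambda>n. seq x (n + k))"
proof (rule bounded_linear_intro[where K = 1])
  fix k :: int and x y :: "'a ell2" and r :: real
  show "Ell2 (\<lambda>n. seq (x + y) (n + k)) = Ell2 (\<lambda>n. seq x (n + k)) + Ell2 (\<lambda>n. seq y (n + k))"
    by (rule seq_inject_ext) (subst seq_Ell2_translate, simp add: seq_Ell2_translate)
  show "Ell2 (\<lambda>n. seq (r *\<^sub>R x) (n + k)) = r *\<^sub>R Ell2 (\<lambda>n. seq x (n + k))"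
    by (rule seq_inject_ext) (subst seq_Ell2_translate, simp add: seq_Ell2_translate)
  show "norm (Ell2 (\<lambda>n. seq x (n + k))) \<le> norm x * 1"
    using norm_translate_le by simp
qed

lemma seq_translate [simp]: "seq (translate k x) n = seq x (n + k)"
  by (simp add: translate.rep_eq seq_Ell2_translate)

lemma norm_translate: "norm (translate k) \<le> 1"
  by (rule norm_blinfun_bound) (auto simp: translate.rep_eq norm_translate_le)

text \<open>Both \<open>Ell2\<close> and \<open>Blinfun\<close> are meaningful here only for bounded
  coefficients, so the facts below carry a bound \<open>K\<close>.\<close>

definition mulop :: "(int \<Rightarrow> ('a::real_normed_vector \<Rightarrow>\<^sub>L 'b::real_normed_vector)) \<Rightarrow> 'a ell2 \<Rightarrow>\<^sub>L 'b ell2"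
  where "mulop c = Blinfun (\<lambda>x. Ell2 (\<lambda>n. c n (seq x n)))"

context
  fixes c :: "int \<Rightarrow> ('a::real_normed_vector \<Rightarrow>\<^sub>L 'b::real_normed_vector)" and K :: real
  assumes bdd: "\<And>n. norm (c n) \<le> K"
begin

lemma L2_set_mulop_le:
  assumes "finite F"
  shows "L2_set (\<lambda>n. norm (c n (seq x n))) F \<le> K * norm x"
proof -
  have K0: "0 \<le> K" using bdd[of 0] norm_ge_zero order_trans by blast
  have "L2_set (\<lambda>n. norm (c n (seq x n))) F \<le> L2_set (\<lambda>n. K * norm (seq x n)) F"
    by (intro L2_set_mono order_trans[OF norm_blinfun] mult_right_mono bdd) auto
  also have "\<dots> = K * L2_set (\<lambda>n. norm (seq x n)) F"
    using K0 by (simp add: L2_set_right_distrib)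
  also have "\<dots> \<le> K * norm x"
    using K0 by (intro mult_left_mono L2_set_le_norm assms)
  finally show ?thesis .
qed

lemma seq_Ell2_mulop: "seq (Ell2 (\<lambda>n. c n (seq x n))) = (\<lambda>n. c n (seq x n))"
  using L2_set_mulop_le by (rule seq_Ell2)

lemma norm_Ell2_mulop: "norm (Ell2 (\<lambda>n. c n (seq x n))) \<le> K * norm x"
  using L2_set_mulop_le by (intro norm_ell2_le) (simp add: seq_Ell2_mulop)

lemma blinfun_apply_mulop: "blinfun_apply (mulop c) x = Ell2 (\<lambda>n. c n (seq x n))"
proof -
  have "bounded_linear (\<lambda>x. Ell2 (\<lambda>n. c n (seq x n)))"
  proof (rule bounded_linear_intro[where K = K])
    fix x y :: "'a ell2" and r :: real
    show "Ell2 (\<lambda>n. c n (seq (x + y) n)) = Ell2 (\<lambda>n. c n (seq x n)) + Ell2 (\<lambda>n. c n (seq y n))"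
      by (rule seq_inject_ext) (subst seq_Ell2_mulop, simp add: seq_Ell2_mulop blinfun.add_right)
    show "Ell2 (\<lambda>n. c n (seq (r *\<^sub>R x) n)) = r *\<^sub>R Ell2 (\<lambda>n. c n (seq x n))"
      by (rule seq_inject_ext) (subst seq_Ell2_mulop, simp add: seq_Ell2_mulop blinfun.scaleR_right)
    show "norm (Ell2 (\<lambda>n. c n (seq x n))) \<le> norm x * K"
      using norm_Ell2_mulop[of x] by (simp add: mult.commute)
  qed
  then show ?thesis unfolding mulop_def by (simp add: bounded_linear_Blinfun_apply)
qed

lemma seq_mulop: "seq (mulop c x) n = c n (seq x n)"
  by (simp add: blinfun_apply_mulop seq_Ell2_mulop)

lemma norm_mulop: "norm (mulop c) \<le> K"
  using bdd[of 0] norm_ge_zero[of "c 0"]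
  by (intro norm_blinfun_bound) (auto simp: blinfun_apply_mulop norm_Ell2_mulop simp del: norm_ge_zero)

end

lemma seq_mulop_const [simp]: "seq (mulop (\<lambda>_. c) x) n = c (seq x n)"
  by (rule seq_mulop[where K = "norm c"]) simp

definition cutoff :: "int set \<Rightarrow> 'a::real_normed_vector ell2 \<Rightarrow>\<^sub>L 'a ell2"
  where "cutoff A = mulop (\<lambda>n. if n \<in> A then id_blinfun else 0)"

lemma seq_cutoff [simp]: "seq (cutoff A x) n = (if n \<in> A then seq x n else 0)"
  unfolding cutoff_def by (subst seq_mulop[where K = 1]) (auto simp: norm_blinfun_id_le)

lemma norm_cutoff: "norm (cutoff A) \<le> 1"
  unfolding cutoff_def by (rule norm_mulop) (auto simp: norm_blinfun_id_le)

lemma mulop_diff: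
  assumes "\<And>n. norm (c n) \<le> K" "\<And>n. norm (d n) \<le> K'"
  shows "mulop c - mulop d = mulop (\<lambda>n. c n - d n)"
proof (intro blinfun_eqI seq_inject_ext)
  fix x n
  have "norm (c n - d n) \<le> K + K'" for n
    using norm_triangle_ineq4 assms add_mono order_trans by metis
  then show "seq ((mulop c - mulop d) x) n = seq (mulop (\<lambda>n. c n - d n) x) n"
    by (simp add: blinfun.diff_left seq_mulop[OF assms(1)] seq_mulop[OF assms(2)]
        seq_mulop[where K = "K + K'"])
qed

text \<open>The norm of a multiplication operator is controlled by the supremum over all indices, so
  one modulus of continuity has to serve every n.\<close>

lemma continuous_on_mulop:
  fixes c :: "int \<Rightarrow> 'p::metric_space \<Rightarrow> ('a::real_normed_vector \<Rightarrow>\<^sub>L 'b::real_normed_vector)"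
  assumes bdd: "\<And>l. l \<in> U \<Longrightarrow> \<exists>K. \<forall>n. norm (c n l) \<le> K"
    and equi: "\<And>l e. l \<in> U \<Longrightarrow> 0 < e \<Longrightarrow> \<exists>d>0. \<forall>m\<in>U. dist m l < d \<longrightarrow> (\<forall>n. norm (c n m - c n l) \<le> e)"
  shows "continuous_on U (\<lambda>l. mulop (\<lambda>n. c n l))"
  unfolding continuous_on_iff
proof safe
  fix l and e :: real assume l: "l \<in> U" and e: "0 < e"
  obtain d where d: "d > 0" "\<And>m. m \<in> U \<Longrightarrow> dist m l < d \<Longrightarrow> (\<forall>n. norm (c n m - c n l) \<le> e/2)"
    using equi[OF l, of "e/2"] e by auto
  have "dist (mulop (\<lambda>n. c n m)) (mulop (\<lambda>n. c n l)) < e" if m: "m \<in> U" "dist m l < d" for m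
  proof -
    obtain K K' where "\<And>n. norm (c n m) \<le> K" "\<And>n. norm (c n l) \<le> K'"
      using bdd[OF l] bdd[OF m(1)] by auto
    then have "dist (mulop (\<lambda>n. c n m)) (mulop (\<lambda>n. c n l)) = norm (mulop (\<lambda>n. c n m - c n l))"
      unfolding dist_norm by (subst mulop_diff) auto
    also have "\<dots> \<le> e/2" using d(2)[OF m] by (intro norm_mulop) auto
    finally show ?thesis using e by simp
  qed
  then show "\<exists>d>0. \<forall>x'\<in>U. dist x' l < d \<longrightarrow> dist (mulop (\<lambda>n. c n x')) (mulop (\<lambda>n. c n l)) < e"
    using d(1) by blast
qed

section \<open>Inverting bounded operators\<close>

text \<open>The fixed point of the contraction x to y + T x is the inverse of 1 - T applied to y.
  Its uniqueness gives linearity and the left inverse property; the lower bound \<open>lb\<close>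
  gives boundedness.\<close>

lemma neumann_bij:
  fixes T :: "'a::banach \<Rightarrow>\<^sub>L 'a"
  assumes T: "norm T < 1"
  shows "\<exists>G. G o\<^sub>L (id_blinfun - T) = id_blinfun \<and> (id_blinfun - T) o\<^sub>L G = id_blinfun"
proof -
  have ex: "\<exists>!x. y + T x = x" for y
  proof (rule banach_fix_type[of "norm T"])
    show "\<forall>x x'. dist (y + T x) (y + T x') \<le> norm T * dist x x'"
      by (auto simp: dist_norm blinfun.diff_right[symmetric] norm_blinfun)
  qed (use T in auto)
  define g where "g y = (THE x. y + T x = x)" for y
  have g: "y + T (g y) = g y" for y unfolding g_def by (rule theI') (rule ex)
  have gu: "x = g y" if "y + T x = x" for x y using ex g that by blast
  have lb: "(1 - norm T) * norm x \<le> norm (x - T x)" for x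
    using norm_triangle_ineq2[of x "T x"] norm_blinfun[of T x] by (simp add: algebra_simps)
  have bl: "bounded_linear g"
  proof (rule bounded_linear_intro[where K = "1 / (1 - norm T)"])
    show "g (x + y) = g x + g y" for x y
      by (rule gu[symmetric]) (metis (no_types, lifting) g blinfun.add_right add.assoc add.left_commute)
    show "g (r *\<^sub>R x) = r *\<^sub>R g x" for r x
      by (rule gu[symmetric]) (metis g blinfun.scaleR_right scaleR_add_right)
    show "norm (g x) \<le> norm x * (1 / (1 - norm T))" for x
    proof -
      have "g x - T (g x) = x" using g[of x] by (metis add_diff_cancel_right')
      then have "(1 - norm T) * norm (g x) \<le> norm x" using lb[of "g x"] by simp
      then show ?thesis using T by (simp add: field_simps)
    qed
  qed
  have a: "g (x - T x) = x" for x by (rule gu[symmetric]) simp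
  have b: "g x - T (g x) = x" for x using g[of x] by (metis add_diff_cancel_right')
  show ?thesis
    by (intro exI[of _ "Blinfun g"])
       (auto intro!: blinfun_eqI simp: bounded_linear_Blinfun_apply[OF bl] blinfun.diff_left a b)
qed

text \<open>The identity g m - g l = g m (f l - f m) g l controls the difference as soon as g m is
  bounded near l, and the same identity yields that bound by absorption.\<close>

lemma continuous_on_blinfun_inverse:
  fixes f :: "'p::metric_space \<Rightarrow> ('a::real_normed_vector \<Rightarrow>\<^sub>L 'a)"
  assumes f: "continuous_on U f"
    and gf: "\<And>l. l \<in> U \<Longrightarrow> g l o\<^sub>L f l = id_blinfun"
    and fg: "\<And>l. l \<in> U \<Longrightarrow> f l o\<^sub>L g l = id_blinfun"
  shows "continuous_on U g"
proof -
  have gfx: "g l (f l x) = x" if "l \<in> U" for l x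
    using gf[OF that] by (metis blinfun_apply_blinfun_compose blinfun_apply_id_blinfun id_apply)
  have fgx: "f l (g l x) = x" if "l \<in> U" for l x
    using fg[OF that] by (metis blinfun_apply_blinfun_compose blinfun_apply_id_blinfun id_apply)
  have eq: "g m - g l = g m o\<^sub>L ((f l - f m) o\<^sub>L g l)" if "l \<in> U" "m \<in> U" for l m
    by (rule blinfun_eqI) (simp add: blinfun.diff_left blinfun.diff_right gfx fgx that)
  have nm: "norm (g m - g l) \<le> norm (g m) * (norm (f m - f l) * norm (g l))"
    if "l \<in> U" "m \<in> U" for l m
  proof -
    have "norm (g m - g l) \<le> norm (g m) * norm ((f l - f m) o\<^sub>L g l)"
      unfolding eq[OF that] by (rule norm_blinfun_compose)
    also have "\<dots> \<le> norm (g m) * (norm (f l - f m) * norm (g l))"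
      by (intro mult_left_mono norm_blinfun_compose) auto
    finally show ?thesis by (simp add: norm_minus_commute)
  qed
  show ?thesis
    unfolding continuous_on_iff
  proof safe
    fix l and e :: real assume l: "l \<in> U" and e: "0 < e"
    define B where "B = norm (g l) + 1"
    have B: "B > 0" "norm (g l) \<le> B" unfolding B_def by (auto intro: add_nonneg_pos)
    \<comment> \<open>The first entry gives \<eta> B \<le> 1/2, which allows norm (g m) to be
      absorbed and bounded by 2 B; the second then makes 2 B \<eta> B at most e/2.\<close>
    define \<eta> where "\<eta> = min (1 / (2 * B)) (e / (4 * B * B))"
    have "\<eta> > 0" unfolding \<eta>_def using B e by auto
    then obtain d where d: "d > 0" "\<And>m. m \<in> U \<Longrightarrow> dist m l < d \<Longrightarrow> norm (f m - f l) < \<eta>"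
      using f l unfolding continuous_on_iff dist_norm by metis
    have "dist (g m) (g l) < e" if m: "m \<in> U" "dist m l < d" for m
    proof -
      have small: "norm (f m - f l) * norm (g l) \<le> \<eta> * B"
        using d(2)[OF m] B \<open>\<eta> > 0\<close> by (intro mult_mono) auto
      have half: "\<eta> * B \<le> 1/2"
      proof -
        have "\<eta> * B \<le> (1 / (2 * B)) * B" unfolding \<eta>_def using B by (intro mult_right_mono) auto
        then show ?thesis using B by simp
      qed
      have "norm (g m) \<le> norm (g l) + norm (g m - g l)"
        using norm_triangle_sub[of "g m" "g l"] by simp
      also have "\<dots> \<le> B + norm (g m) * (1/2)"
        using nm[OF l m(1)] mult_left_mono[OF order_trans[OF small half] norm_ge_zero[of "g m"]] B
        by linarith
      finally have gm: "norm (g m) \<le> 2 * B" by simp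
      have "norm (g m - g l) \<le> 2 * B * (\<eta> * B)"
        using nm[OF l m(1)] mult_mono[OF gm small] B by (smt (verit) mult_nonneg_nonneg norm_ge_zero)
      also have "\<dots> \<le> 2 * B * (e / (4 * B * B) * B)"
        unfolding \<eta>_def using B by (intro mult_left_mono mult_right_mono) auto
      also have "\<dots> = e / 2" using B by (simp add: field_simps)
      finally show ?thesis unfolding dist_norm using e by simp
    qed
    then show "\<exists>d>0. \<forall>x'\<in>U. dist x' l < d \<longrightarrow> dist (g x') (g l) < e"
      using d(1) by blast
  qed
qed

section \<open>Linear algebra over the complex numbers\<close>

text \<open>On the orthogonal complement of the kernel inside S the map f is injective, and it takes
  the same values there as on S.\<close>

lemma dim_image_plus_dim_kernel:
  fixes f :: "'a::euclidean_space \<Rightarrow> 'b::euclidean_space"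
  assumes f: "linear f" and S: "subspace S"
  shows "dim (f ` S) + dim {x \<in> S. f x = 0} = dim S"
proof -
  interpret linear f by fact
  let ?K = "{x \<in> S. f x = 0}"
  let ?O = "{y \<in> S. \<forall>x\<in>?K. orthogonal x y}"
  have K: "subspace ?K"
    using S by (auto simp: subspace_def add scale)
  have O: "subspace ?O"
    using S by (auto simp: subspace_def orthogonal_def inner_add_right)
  have d: "dim ?O + dim ?K = dim S"
    using dim_subspace_orthogonal_to_vectors[OF K S] by auto
  have "inj_on f ?O"
  proof (rule inj_onI)
    fix x y assume xy: "x \<in> ?O" "y \<in> ?O" "f x = f y"
    then have m: "x - y \<in> ?O" using subspace_diff[OF O] by blast
    then have "x - y \<in> ?K" using xy by (simp add: diff)
    then have "orthogonal (x - y) (x - y)" using m by blast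
    then show "x = y" by (simp add: orthogonal_def)
  qed
  then have "dim (f ` ?O) = dim ?O"
    using O by (intro dim_image_eq f) (simp add: span_eq_iff[THEN iffD2])
  moreover have "f ` ?O = f ` S"
  proof
    show "f ` S \<subseteq> f ` ?O"
    proof safe
      fix x assume x: "x \<in> S"
      obtain y z where yz: "y \<in> span ?K" "\<And>w. w \<in> span ?K \<Longrightarrow> orthogonal z w" "x = y + z"
        using orthogonal_subspace_decomp_exists by blast
      have y: "y \<in> ?K" using yz(1) K by (simp add: span_eq_iff[THEN iffD2])
      have "z \<in> ?O" using yz subspace_diff[OF S x, of y] y
        by (auto simp: orthogonal_commute intro: span_base)
      moreover have "f x = f z" using yz(3) y by (simp add: add)
      ultimately show "f x \<in> f ` ?O" by blast
    qed
  qed auto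
  ultimately show ?thesis using d by simp
qed

lemma dim_image_less:
  fixes f :: "'a::euclidean_space \<Rightarrow> 'b::euclidean_space"
  assumes "linear f" "subspace S" "w \<in> S" "w \<noteq> 0" "f w = 0"
  shows "dim (f ` S) < dim S"
proof -
  have "dim {x \<in> S. f x = 0} \<noteq> 0"
    using assms by (auto simp: dim_eq_0)
  then show ?thesis using dim_image_plus_dim_kernel[OF assms(1,2)] by linarith
qed

text \<open>Two scalar multiplications live on \<open>complex^'n\<close>: \<open>*\<^sub>R\<close>
  underlies \<open>span\<close>, \<open>subspace\<close> and \<open>dim\<close>, and
  \<open>*s\<close> underlies their \<open>vec\<close> versions. This is the bridge between
  them.\<close>

lemma scaleR_eq_vector_scalar: "r *\<^sub>R (v :: complex^'n) = complex_of_real r *s v"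
  unfolding vec_eq_iff by (simp add: complex_eq_iff)

lemma vec_subspace_imp_subspace: "vec.subspace U \<Longrightarrow> subspace (U :: (complex^'n) set)"
  by (auto simp: subspace_def vec.subspace_def scaleR_eq_vector_scalar)

lemma mat_diff_vector_mult:
  fixes A :: "'a::comm_ring_1^'n^'n"
  shows "(A - mat z) *v v = A *v v - z *s v"
proof -
  have "mat z *v v = z *s v"
    by (simp add: vec_eq_iff matrix_vector_mult_def mat_def
        if_distrib[of "\<lambda>x. x * y" for y] cong: if_cong)
  then show ?thesis by (simp add: matrix_vector_mult_diff_rdistrib)
qed

section \<open>Annihilating products of linear factors\<close>

definition vpoly :: "complex^'n^'n \<Rightarrow> complex poly \<Rightarrow> complex^'n \<Rightarrow> complex^'n"
  where "vpoly A p v = (\<Sum>i\<le>degree p. coeff p i *s (((*v) A) ^^ i) v)"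

lemma vpoly_eq_sum:
  assumes "degree p \<le> N"
  shows "vpoly A p v = (\<Sum>i\<le>N. coeff p i *s (((*v) A) ^^ i) v)"
  unfolding vpoly_def
  by (rule sum.mono_neutral_left) (use assms in \<open>auto simp: coeff_eq_0\<close>)

lemma vpoly_root_factor: "vpoly A ([:- z, 1:] * q) v = (A - mat z) *v vpoly A q v"
proof -
  define N where "N = degree q"
  have eq: "[:- z, 1:] * q = pCons 0 q - smult z q" by simp
  have deg: "degree (pCons 0 q - smult z q) \<le> Suc N"
    unfolding N_def by (rule degree_diff_le) (auto simp: degree_pCons_le intro: order_trans[OF degree_smult_le])
  have "vpoly A ([:- z, 1:] * q) v =
      (\<Sum>i\<le>Suc N. coeff (pCons 0 q) i *s (((*v) A) ^^ i) v)
      - z *s (\<Sum>i\<le>Suc N. coeff q i *s (((*v) A) ^^ i) v)"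
    unfolding eq vpoly_eq_sum[OF deg]
    by (simp only: coeff_diff coeff_smult vec.scale_left_diff_distrib sum_subtractf
        vec.scale_sum_right vec.scale_scale)
  also have "(\<Sum>i\<le>Suc N. coeff q i *s (((*v) A) ^^ i) v) = vpoly A q v"
    by (rule vpoly_eq_sum[symmetric]) (simp add: N_def)
  also have "(\<Sum>i\<le>Suc N. coeff (pCons 0 q) i *s (((*v) A) ^^ i) v) = A *v vpoly A q v"
    unfolding sum.atMost_Suc_shift vpoly_def N_def
    by (simp add: vec.sum vec.scale)
  finally show ?thesis by (simp add: mat_diff_vector_mult)
qed

text \<open>Split a root z off p. Either the quotient q, of smaller degree, already kills v, or q(A)
  v is a nonzero vector of U killed by A - z.\<close>

lemma ex_eigenvector_of_vpoly:
  assumes U: "vec.subspace U" "\<And>v. v \<in> U \<Longrightarrow> A *v v \<in> U"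
    and "p \<noteq> 0" "v \<in> U" "v \<noteq> 0" "vpoly A p v = 0"
  shows "\<exists>z w. w \<in> U \<and> w \<noteq> 0 \<and> (A - mat z) *v w = 0"
  using assms(3,6)
proof (induction "degree p" arbitrary: p)
  case 0
  then obtain c where "p = [:c:]" "c \<noteq> 0" by (metis degree_eq_zeroE pCons_0_0)
  then have "c *s v = 0" using 0 by (simp add: vpoly_def)
  with \<open>c \<noteq> 0\<close> \<open>v \<noteq> 0\<close> show ?case by simp
next
  case (Suc n)
  have "\<not> constant (poly p)" using Suc(2) by (simp add: constant_degree)
  then obtain z where "poly p z = 0" using fundamental_theorem_of_algebra by blast
  then obtain q where q: "p = [:- z, 1:] * q" by (meson dvdE poly_eq_0_iff_dvd)
  then have "q \<noteq> 0" using Suc by auto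
  have "degree p = degree [:- z, 1:] + degree q"
    unfolding q using \<open>q \<noteq> 0\<close> by (intro degree_mult_eq) auto
  then have deg: "n = degree q" using Suc(2) by simp
  have pow: "(((*v) A) ^^ i) v \<in> U" for i
    by (induction i) (use U \<open>v \<in> U\<close> in auto)
  have mem: "vpoly A q v \<in> U"
    unfolding vpoly_def by (intro vec.subspace_sum U vec.subspace_scale pow)
  show ?case
  proof (cases "vpoly A q v = 0")
    case True
    with Suc(1)[OF deg \<open>q \<noteq> 0\<close>] show ?thesis by blast
  next
    case False
    with mem show ?thesis using Suc(4) unfolding q vpoly_root_factor by blast
  qed
qed

text \<open>More powers of A applied to v than the dimension are dependent. A repetition among the
  powers is not visible as a dependence of the set of vectors and is treated apart, by a difference
  of two monomials.\<close>

lemma ex_annihilating_vpoly: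
  fixes A :: "complex^'n^'n"
  shows "\<exists>p. p \<noteq> 0 \<and> vpoly A p v = 0"
proof -
  let ?f = "\<lambda>i. (((*v) A) ^^ i) v"
  define n where "n = DIM(complex^'n)"
  show ?thesis
  proof (cases "inj_on ?f {..n}")
    case False
    then obtain i j where ij: "i \<noteq> j" "?f i = ?f j" by (auto simp: inj_on_def)
    define p :: "complex poly" where "p = monom 1 i - monom 1 j"
    have "coeff p i = 1" using ij by (simp add: p_def)
    then have "p \<noteq> 0" by auto
    have d: "degree p \<le> max i j" unfolding p_def
      by (intro degree_diff_le order_trans[OF degree_monom_le]) auto
    have "vpoly A p v = (\<Sum>k\<le>max i j. coeff p k *s ?f k)"
      using d by (rule vpoly_eq_sum)
    also have "\<dots> = (\<Sum>k\<le>max i j. (if k = i then ?f i else 0) - (if k = j then ?f j else 0))"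
      by (rule sum.cong) (auto simp: p_def)
    also have "\<dots> = 0" using ij by (simp add: sum_subtractf)
    finally show ?thesis using \<open>p \<noteq> 0\<close> by blast
  next
    case True
    have "card (?f ` {..n}) > DIM(complex^'n)" using True by (simp add: card_image n_def)
    then have "dependent (?f ` {..n})"
      using independent_bound[of "?f ` {..n}"] by (meson linorder_not_less)
    then obtain u k where u: "(\<Sum>w\<in>?f ` {..n}. u w *\<^sub>R w) = 0" and k: "k \<le> n" "u (?f k) \<noteq> 0"
      by (auto simp: dependent_finite)
    define p :: "complex poly" where "p = (\<Sum>i\<le>n. monom (complex_of_real (u (?f i))) i)"
    have cp: "coeff p i = (if i \<le> n then complex_of_real (u (?f i)) else 0)" for i
      by (simp add: p_def coeff_sum)
    have "p \<noteq> 0" using cp[of k] k by auto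
    have "degree p \<le> n" by (rule degree_le) (simp add: cp)
    then have "vpoly A p v = (\<Sum>i\<le>n. u (?f i) *\<^sub>R ?f i)"
      by (simp add: vpoly_eq_sum cp scaleR_eq_vector_scalar)
    also have "\<dots> = (\<Sum>w\<in>?f ` {..n}. u w *\<^sub>R w)"
      by (simp add: sum.reindex[OF True])
    finally show ?thesis using u \<open>p \<noteq> 0\<close> by auto
  qed
qed

primrec eigprod :: "complex^'n^'n \<Rightarrow> complex list \<Rightarrow> complex^'n \<Rightarrow> complex^'n" where
  "eigprod A [] v = v"
| "eigprod A (z # zs) v = eigprod A zs ((A - mat z) *v v)"

lemma eigprod_diff: "eigprod A zs (v - w) = eigprod A zs v - eigprod A zs w"
  and eigprod_add: "eigprod A zs (v + w) = eigprod A zs v + eigprod A zs w"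
  and eigprod_smult: "eigprod A zs (c *s v) = c *s eigprod A zs v"
  and eigprod_zero [simp]: "eigprod A zs 0 = 0"
  by (induction zs arbitrary: v w) (simp_all add: vec.diff vec.add vec.scale)

lemma eigprod_scaleR: "eigprod A zs (r *\<^sub>R v) = r *\<^sub>R eigprod A zs v"
  by (simp add: scaleR_eq_vector_scalar eigprod_smult)

lemma linear_eigprod: "linear (eigprod A zs)"
  by (rule linearI) (simp_all add: eigprod_add eigprod_scaleR)

lemma eigprod_commute: "eigprod A zs (A *v v) = A *v eigprod A zs v"
  by (induction zs arbitrary: v)
     (simp_all add: mat_diff_vector_mult vec.scale vec.diff eigprod_diff eigprod_smult)

lemma eigprod_mult: "eigprod A zs ((A - mat z) *v v) = (A - mat z) *v eigprod A zs v"
  by (simp add: mat_diff_vector_mult eigprod_diff eigprod_smult eigprod_commute)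

text \<open>Choose a list of eigenvalues whose product has minimal rank. A nonzero range would be
  invariant under A and contain an eigenvector, and the corresponding further factor would lower the
  rank.\<close>

lemma ex_annihilating_eigprod:
  fixes A :: "complex^'n^'n"
  shows "\<exists>zs. (\<forall>v. eigprod A zs v = 0) \<and> (\<forall>z\<in>set zs. \<exists>w. w \<noteq> 0 \<and> (A - mat z) *v w = 0)"
proof -
  let ?E = "\<lambda>zs. \<forall>z\<in>set zs. \<exists>w. w \<noteq> 0 \<and> (A - mat z) *v w = 0"
  have "?E []" by simp
  then obtain zs where zs: "?E zs"
      "\<And>ys. ?E ys \<Longrightarrow> dim (range (eigprod A zs)) \<le> dim (range (eigprod A ys))"
    using ex_has_least_nat[of ?E "[]" "\<lambda>zs. dim (range (eigprod A zs))"] by blast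
  have "eigprod A zs v0 = 0" for v0
  proof (rule ccontr)
    assume ne: "eigprod A zs v0 \<noteq> 0"
    let ?U = "range (eigprod A zs)"
    have U: "vec.subspace ?U"
      unfolding vec.subspace_def
      by (auto simp: eigprod_add[symmetric] eigprod_smult[symmetric] intro: range_eqI[of _ _ 0])
    have Ui: "A *v v \<in> ?U" if "v \<in> ?U" for v
      using that by (auto simp: eigprod_commute[symmetric])
    obtain p where "p \<noteq> 0" "vpoly A p (eigprod A zs v0) = 0" using ex_annihilating_vpoly by blast
    then obtain z w where zw: "w \<in> ?U" "w \<noteq> 0" "(A - mat z) *v w = 0"
      using ex_eigenvector_of_vpoly[OF U Ui _ _ ne] by blast
    have "range (eigprod A (z # zs)) = (\<lambda>v. (A - mat z) *v v) ` ?U"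
      by (auto simp: eigprod_mult)
    moreover have "linear (\<lambda>v. (A - mat z) *v v)"
      by (rule linearI) (simp_all add: vec.add scaleR_eq_vector_scalar vec.scale)
    ultimately have "dim (range (eigprod A (z # zs))) < dim ?U"
      using dim_image_less[of "\<lambda>v. (A - mat z) *v v", OF _ vec_subspace_imp_subspace[OF U] zw] by simp
    moreover have "?E (z # zs)" using zs(1) zw by auto
    ultimately show False using zs(2)[of "z # zs"] by simp
  qed
  with zs(1) show ?thesis by blast
qed

lemma hyperbolic_annihilating_eigprod:
  assumes "hyperbolic M"
  obtains zs where "\<And>v. eigprod (complexify_mat M) zs v = 0" "\<And>z. z \<in> set zs \<Longrightarrow> cmod z \<noteq> 1"
proof -
  obtain zs where zs: "\<And>v. eigprod (complexify_mat M) zs v = 0"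
      "\<And>z. z \<in> set zs \<Longrightarrow> \<exists>w. w \<noteq> 0 \<and> (complexify_mat M - mat z) *v w = 0"
    using ex_annihilating_eigprod by metis
  have "cmod z \<noteq> 1" if z: "z \<in> set zs" for z
  proof
    assume "cmod z = 1"
    then have "invertible (complexify_mat M - mat z)"
      using assms unfolding hyperbolic_def invertible_det_nz by blast
    then have "\<exists>B. B ** (complexify_mat M - mat z) = mat 1" unfolding invertible_def by blast
    then show False using zs(2)[OF z] unfolding matrix_left_invertible_ker by blast
  qed
  with zs(1) show ?thesis using that by blast
qed

section \<open>Generalised eigenspaces\<close>

text \<open>With the exponent left free, membership passes from (A - z) v to v without counting;
  \<open>funpow_kernel_stabilises\<close> returns to the fixed exponent of
  \<open>gen_eigenspace\<close>.\<close>

definition root_space :: "complex^'n^'n \<Rightarrow> complex \<Rightarrow> (complex^'n) set"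
  where "root_space A z = {v. \<exists>e. (((*v) (A - mat z)) ^^ e) v = 0}"

lemma funpow_matrix_smult: "(((*v) B) ^^ e) (c *s v) = c *s (((*v) B) ^^ e) v"
  and funpow_matrix_add: "(((*v) B) ^^ e) (v + w) = (((*v) B) ^^ e) v + (((*v) B) ^^ e) (w :: complex^'n)"
  and funpow_matrix_zero [simp]: "(((*v) B) ^^ e) 0 = (0 :: complex^'n)"
  by (induction e) (simp_all add: vec.scale vec.add)

text \<open>The kernels of the powers increase, and once two neighbours agree they stay constant.
  Strict growth through step \<open>CARD('n)\<close> would exceed the dimension of the
  space.\<close>

lemma funpow_kernel_stabilises:
  fixes B :: "complex^'n^'n"
  assumes "(((*v) B) ^^ e) v = 0"
  shows "(((*v) B) ^^ CARD('n)) v = 0"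
proof -
  define K where "K = (\<lambda>k. {v. (((*v) B) ^^ k) v = 0})"
  have sub: "vec.subspace (K k)" for k
    unfolding K_def vec.subspace_def by (auto simp: funpow_matrix_add funpow_matrix_smult)
  have mono1: "K k \<subseteq> K (Suc k)" for k
    unfolding K_def by auto
  then have mono: "K k \<subseteq> K l" if "k \<le> l" for k l
    using that lift_Suc_mono_le by blast
  have "\<exists>k\<le>CARD('n). K (Suc k) = K k"
  proof (rule ccontr)
    assume n: "\<not> ?thesis"
    have "k \<le> vec.dim (K k)" if "k \<le> Suc CARD('n)" for k
      using that
    proof (induction k)
      case (Suc k)
      then have "K k \<subset> K (Suc k)" using n mono1 by auto
      then have "vec.span (K k) \<subset> vec.span (K (Suc k))"
        using sub by (simp add: vec.span_eq_iff[THEN iffD2])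
      then have "vec.dim (K k) < vec.dim (K (Suc k))" by (rule vec.dim_psubset)
      then show ?case using Suc by simp
    qed simp
    from this[of "Suc CARD('n)"] have "Suc CARD('n) \<le> vec.dim (K (Suc CARD('n)))" by simp
    then show False using dim_subset_UNIV_cart_gen[of "K (Suc CARD('n))"] by simp
  qed
  then obtain k where k: "k \<le> CARD('n)" "K (Suc k) = K k" by blast
  have "K (k + j) = K k" for j
  proof (induction j)
    case (Suc j)
    have "w \<in> K (k + j)" if "w \<in> K (k + Suc j)" for w
    proof -
      have "(((*v) B) ^^ Suc k) ((((*v) B) ^^ j) w) = (((*v) B) ^^ (k + Suc j)) w"
        by (metis add_Suc add_Suc_right comp_apply funpow_add)
      then have "(((*v) B) ^^ j) w \<in> K (Suc k)"
        using that unfolding K_def by simp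
      then have "(((*v) B) ^^ j) w \<in> K k" using k by simp
      then show ?thesis unfolding K_def by (simp add: funpow_add)
    qed
    then show ?case using Suc mono[of "k + j" "k + Suc j"] by auto
  qed simp
  then have "K e \<subseteq> K k" using mono[of e "k + e"] by simp
  also have "\<dots> \<subseteq> K CARD('n)" using mono k by blast
  finally show ?thesis using assms unfolding K_def by blast
qed

lemma gen_eigenspace_eq_root_space: "gen_eigenspace M z = root_space (complexify_mat M) z"
  unfolding gen_eigenspace_def root_space_def using funpow_kernel_stabilises by blast

lemma root_space_induct [consumes 1, case_names zero step]:
  assumes "v \<in> root_space A z" and "P 0"
    and "\<And>v. (A - mat z) *v v \<in> root_space A z \<Longrightarrow> P ((A - mat z) *v v) \<Longrightarrow> P v"
  shows "P v"
proof -
  have "P v" if "(((*v) (A - mat z)) ^^ e) v = 0" for e v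
    using that
  proof (induction e arbitrary: v)
    case 0
    then show ?case using assms(2) by simp
  next
    case (Suc e)
    then have "(((*v) (A - mat z)) ^^ e) ((A - mat z) *v v) = 0"
      by (simp add: funpow_swap1)
    then show ?case using assms(3) Suc.IH unfolding root_space_def by blast
  qed
  then show ?thesis using assms(1) unfolding root_space_def by blast
qed

lemma root_spaceI: "(A - mat z) *v v \<in> root_space A z \<Longrightarrow> v \<in> root_space A z"
proof -
  assume "(A - mat z) *v v \<in> root_space A z"
  then obtain e where "(((*v) (A - mat z)) ^^ e) ((A - mat z) *v v) = 0"
    unfolding root_space_def by blast
  then have "(((*v) (A - mat z)) ^^ Suc e) v = 0" by (simp add: funpow_swap1)
  then show ?thesis unfolding root_space_def by blast
qed

lemma vec_subspace_root_space: "vec.subspace (root_space A z)"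
proof -
  have eq: "root_space A z = {v. (((*v) (A - mat z)) ^^ CARD('n)) v = 0}" for A :: "complex^'n^'n"
    unfolding root_space_def using funpow_kernel_stabilises by blast
  show ?thesis
    unfolding eq vec.subspace_def by (auto simp: funpow_matrix_add funpow_matrix_smult)
qed

lemma root_space_surj:
  assumes "u \<in> root_space A y" "y \<noteq> z"
  shows "\<exists>t\<in>root_space A y. (A - mat z) *v t = u"
  using assms(1)
proof (induction u rule: root_space_induct)
  case zero
  then show ?case using vec.subspace_0[OF vec_subspace_root_space] by (intro bexI[of _ 0]) auto
next
  case (step u)
  then obtain t where t: "t \<in> root_space A y" "(A - mat z) *v t = (A - mat y) *v u" by blast
  \<comment> \<open>Since (A - z) t = (A - y) u, the operator A - z sends u - t to (A - z) u - (A -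
    y) u = (y - z) u.\<close>
  let ?t = "(1 / (y - z)) *s (u - t)"
  have "?t \<in> root_space A y"
    using vec.subspace_diff[OF vec_subspace_root_space root_spaceI[OF step(1)] t(1)]
    by (rule vec.subspace_scale[OF vec_subspace_root_space])
  moreover have "(A - mat z) *v ?t = u"
  proof -
    have "(A - mat z) *v (u - t) = (A - mat z) *v u - (A - mat y) *v u"
      by (simp add: vec.diff t)
    also have "\<dots> = (y - z) *s u"
      by (simp add: mat_diff_vector_mult vec.scale_left_diff_distrib)
    finally have "(A - mat z) *v ?t = (1 / (y - z)) *s ((y - z) *s u)"
      by (simp only: vec.scale)
    also have "\<dots> = u" using assms(2) by (simp only: vector_smult_assoc) simp
    finally show ?thesis .
  qed
  ultimately show ?case by blast
qed

section \<open>Inverting the shift minus a constant operator\<close>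

lemma translate_inverse [simp]: "translate k (translate (- k) x) = x" "translate (- k) (translate k x) = x"
  by (auto intro: seq_inject_ext)

lemma bij_imp_mutual_inverse:
  assumes "G o\<^sub>L F = id_blinfun" "F o\<^sub>L G = id_blinfun"
  shows "blinfun_apply G (F x) = x" "blinfun_apply F (G y) = y"
  using arg_cong[OF assms(1), of "\<lambda>f. blinfun_apply f x"] arg_cong[OF assms(2), of "\<lambda>f. blinfun_apply f y"]
  by simp_all

lemma norm_blinfun_compose_less_1:
  assumes "norm f \<le> 1" "norm g < 1"
  shows "norm (f o\<^sub>L g) < 1"
  using norm_blinfun_compose[of f g] assms mult_right_mono[of "norm f" 1 "norm g"] by simp

text \<open>Factor S - c = S (1 - S^{-1} c) with S isometric.\<close>

lemma shift_minus_contraction_invertible: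
  fixes c :: "'a::banach \<Rightarrow>\<^sub>L 'a"
  assumes c: "norm c < 1"
  shows "\<exists>G :: 'a ell2 \<Rightarrow>\<^sub>L 'a ell2. (\<forall>x. blinfun_apply G (translate 1 x - mulop (\<lambda>_. c) x) = x) \<and>
             (\<forall>y. translate 1 (blinfun_apply G y) - mulop (\<lambda>_. c) (G y) = y)"
proof -
  let ?T = "translate (- 1) o\<^sub>L mulop (\<lambda>_. c)"
  have "norm (mulop (\<lambda>_. c)) < 1" using norm_mulop[of "\<lambda>_. c" "norm c"] c by simp
  then have "norm ?T < 1" by (intro norm_blinfun_compose_less_1 norm_translate)
  then obtain G where G: "G o\<^sub>L (id_blinfun - ?T) = id_blinfun" "(id_blinfun - ?T) o\<^sub>L G = id_blinfun"
    using neumann_bij by blast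
  have eq: "translate 1 x - mulop (\<lambda>_. c) x = translate 1 ((id_blinfun - ?T) x)" for x
    by (simp add: blinfun.diff_left blinfun.diff_right)
  show ?thesis
    unfolding eq
    by (intro exI[of _ "G o\<^sub>L translate (- 1)"])
       (simp add: bij_imp_mutual_inverse[OF G])
qed

text \<open>Factor S - c = - c (1 - d S), where d is the inverse of c.\<close>

lemma shift_minus_expansion_invertible:
  fixes c d :: "'a::banach \<Rightarrow>\<^sub>L 'a"
  assumes d: "norm d < 1" and cd: "\<And>x. c (d x) = x" "\<And>x. d (c x) = x"
  shows "\<exists>G :: 'a ell2 \<Rightarrow>\<^sub>L 'a ell2. (\<forall>x. blinfun_apply G (translate 1 x - mulop (\<lambda>_. c) x) = x) \<and>
             (\<forall>y. translate 1 (blinfun_apply G y) - mulop (\<lambda>_. c) (G y) = y)"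
proof -
  let ?T = "mulop (\<lambda>_. d) o\<^sub>L translate 1"
  have md: "norm (mulop (\<lambda>_. d)) < 1" using norm_mulop[of "\<lambda>_. d" "norm d"] d by simp
  have "norm ?T \<le> norm (mulop (\<lambda>_. d)) * norm (translate 1 :: 'a ell2 \<Rightarrow>\<^sub>L _)"
    by (rule norm_blinfun_compose)
  also have "\<dots> \<le> norm (mulop (\<lambda>_. d)) * 1" by (intro mult_left_mono norm_translate) simp
  finally have "norm ?T < 1" using md by simp
  then obtain G where G: "G o\<^sub>L (id_blinfun - ?T) = id_blinfun" "(id_blinfun - ?T) o\<^sub>L G = id_blinfun"
    using neumann_bij by blast
  have inv: "mulop (\<lambda>_. c) (mulop (\<lambda>_. d) x) = x" "mulop (\<lambda>_. d) (mulop (\<lambda>_. c) x) = x" for x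
    by (rule seq_inject_ext; simp add: cd)+
  have eq: "translate 1 x - mulop (\<lambda>_. c) x = - mulop (\<lambda>_. c) ((id_blinfun - ?T) x)" for x
    by (simp add: blinfun.diff_left blinfun.diff_right inv)
  show ?thesis
    unfolding eq
    by (intro exI[of _ "- (G o\<^sub>L mulop (\<lambda>_. d))"])
       (simp add: bij_imp_mutual_inverse[OF G] inv blinfun.minus_left blinfun.minus_right)
qed

lemma norm_vector_smult: "norm (c *s v) = cmod c * norm (v :: complex^'n)"
  by (simp add: norm_vec_def norm_mult L2_set_right_distrib)

lift_definition smult_op :: "complex \<Rightarrow> (complex^'n) \<Rightarrow>\<^sub>L (complex^'n)" is "\<lambda>c v. c *s v"
  unfolding linear_conv_bounded_linear[symmetric]
  by (rule linearI) (simp_all add: scaleR_eq_vector_scalar vector_add_ldistrib mult.commute)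

declare smult_op.rep_eq [simp]

lemma norm_smult_op: "norm (smult_op c) \<le> cmod c"
  by (rule norm_blinfun_bound) (auto simp: norm_vector_smult)

lemma shift_minus_smult_invertible:
  assumes "cmod z \<noteq> 1"
  shows "\<exists>G :: (complex^'n) ell2 \<Rightarrow>\<^sub>L _. (\<forall>x. blinfun_apply G (translate 1 x - mulop (\<lambda>_. smult_op z) x) = x) \<and>
             (\<forall>y. translate 1 (blinfun_apply G y) - mulop (\<lambda>_. smult_op z) (G y) = y)"
proof (cases "cmod z < 1")
  case True
  then have "norm (smult_op z :: (complex^'n) \<Rightarrow>\<^sub>L _) < 1" by (rule le_less_trans[OF norm_smult_op])
  then show ?thesis by (rule shift_minus_contraction_invertible)
next
  case False
  then have "cmod (1 / z) < 1" using assms by (simp add: norm_divide divide_less_eq_1)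
  then have "norm (smult_op (1 / z) :: (complex^'n) \<Rightarrow>\<^sub>L _) < 1" by (rule le_less_trans[OF norm_smult_op])
  moreover have "z \<noteq> 0" using False by auto
  ultimately show ?thesis by (intro shift_minus_expansion_invertible) auto
qed

lemma bounded_linear_complex_matrix: "bounded_linear (\<lambda>v. (A :: complex^'n^'m) *v v)"
  unfolding linear_conv_bounded_linear[symmetric]
  by (rule linearI) (simp_all add: vec.add vec.scale scaleR_eq_vector_scalar)

lift_definition cmat_op :: "complex^'n^'m \<Rightarrow> (complex^'n) \<Rightarrow>\<^sub>L (complex^'m)" is "\<lambda>A v. A *v v"
  by (rule bounded_linear_complex_matrix)

declare cmat_op.rep_eq [simp]

lift_definition eigprod_op :: "complex^'n^'n \<Rightarrow> complex list \<Rightarrow> (complex^'n) \<Rightarrow>\<^sub>L (complex^'n)" is eigprod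
  unfolding linear_conv_bounded_linear[symmetric] by (rule linear_eigprod)

declare eigprod_op.rep_eq [simp]

text \<open>Induction along an annihilating product of linear factors reduces the invertibility of
  \<open>S - A\<close> to that of the scalar operators \<open>S - z\<close>.\<close>

lemma shift_minus_matrix_inj:
  assumes "\<And>z. z \<in> set zs \<Longrightarrow> cmod z \<noteq> 1"
    and "translate 1 x = mulop (\<lambda>_. cmat_op A) x" "\<And>n. eigprod A zs (seq x n) = 0"
  shows "x = 0"
  using assms
proof (induction zs arbitrary: x)
  case Nil
  then show ?case by (intro seq_inject_ext) simp
next
  case (Cons z zs)
  have rec: "seq x (n + 1) = A *v seq x n" for n
    using arg_cong[OF Cons.prems(2), of "\<lambda>x. seq x n"] by simp
  \<comment> \<open>Applying A - z to an orbit of A gives an orbit, now killed by the shorter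
    product. Once it vanishes, A acts on x as the scalar z.\<close>
  let ?u = "mulop (\<lambda>_. cmat_op (A - mat z)) x"
  have "?u = 0"
  proof (rule Cons.IH)
    show "translate 1 ?u = mulop (\<lambda>_. cmat_op A) ?u"
      by (rule seq_inject_ext) (simp add: rec mat_diff_vector_mult vec.diff vec.scale)
  qed (use Cons.prems in auto)
  have "A *v seq x n = z *s seq x n" for n
    using arg_cong[OF \<open>?u = 0\<close>, of "\<lambda>x. seq x n"] by (simp add: mat_diff_vector_mult)
  then have "translate 1 x - mulop (\<lambda>_. smult_op z) x = 0"
    by (intro seq_inject_ext) (simp add: rec)
  moreover have "cmod z \<noteq> 1" using Cons.prems(1) by simp
  ultimately show ?case using shift_minus_smult_invertible[of z] by (metis blinfun.zero_right)
qed

text \<open>Solve with the scalar z in place of A first. This leaves the error (A - z) H y, which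
  the shorter product kills, so the induction hypothesis corrects it. One operator has to serve all
  y, so that the solution is bounded in y.\<close>

lemma shift_minus_matrix_surj:
  fixes A :: "complex^'n^'n"
  assumes "\<And>z. z \<in> set zs \<Longrightarrow> cmod z \<noteq> 1"
  shows "\<exists>G. \<forall>y. (\<forall>n. eigprod A zs (seq y n) = 0) \<longrightarrow>
    translate 1 (blinfun_apply G y) - mulop (\<lambda>_. cmat_op A) (G y) = y"
  using assms
proof (induction zs)
  case Nil
  have "y = 0" if "\<forall>n. eigprod A [] (seq y n) = 0" for y
    using that by (intro seq_inject_ext) simp
  then show ?case by (intro exI[of _ 0]) (auto simp: blinfun.zero_left)
next
  case (Cons z zs)
  then obtain G where G: "\<And>y. (\<forall>n. eigprod A zs (seq y n) = 0) \<Longrightarrow>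
      translate 1 (blinfun_apply G y) - mulop (\<lambda>_. cmat_op A) (G y) = y" by auto
  have "cmod z \<noteq> 1" using Cons.prems(1) by simp
  then obtain H :: "(complex^'n) ell2 \<Rightarrow>\<^sub>L _" where H: "\<And>x. blinfun_apply H (translate 1 x - mulop (\<lambda>_. smult_op z) x) = x"
    "\<And>y. translate 1 (blinfun_apply H y) - mulop (\<lambda>_. smult_op z) (H y) = y"
    using shift_minus_smult_invertible[of z] by auto
  let ?D = "mulop (\<lambda>_. cmat_op (A - mat z))"
  have "translate 1 (H y + G (?D (H y))) - mulop (\<lambda>_. cmat_op A) (H y + G (?D (H y))) = y"
    if y: "\<forall>n. eigprod A (z # zs) (seq y n) = 0" for y
  proof -
    \<comment> \<open>The full product commutes with the scalar equation and kills y, so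
      \<open>?u\<close> solves (S - z) u = 0 and vanishes.\<close>
    let ?u = "mulop (\<lambda>_. eigprod_op A (z # zs)) (H y)"
    have Hy: "seq (H y) (n + 1) = z *s seq (H y) n + seq y n" for n
      using arg_cong[OF H(2)[of y], of "\<lambda>x. seq x n"] by (simp add: algebra_simps)
    have "translate 1 ?u - mulop (\<lambda>_. smult_op z) ?u = 0"
      using y by (intro seq_inject_ext) (simp add: Hy vec.add vec.scale eigprod_add eigprod_smult)
    then have uz: "?u = 0" using H(1) by (metis blinfun.zero_right)
    have "eigprod A zs (seq (?D (H y)) n) = 0" for n
      using arg_cong[OF uz, of "\<lambda>x. seq x n"] by simp
    then have Gy: "translate 1 (G (?D (H y))) - mulop (\<lambda>_. cmat_op A) (G (?D (H y))) = ?D (H y)"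
      by (intro G) simp
    have "translate 1 (H y) - mulop (\<lambda>_. cmat_op A) (H y) = y - ?D (H y)"
      by (rule seq_inject_ext) (simp add: Hy mat_diff_vector_mult)
    with Gy show ?thesis by (simp add: blinfun.add_right algebra_simps)
  qed
  then show ?case
    by (intro exI[of _ "H + (G o\<^sub>L (?D o\<^sub>L H))"]) (simp add: blinfun.add_left)
qed

section \<open>Return from the complexification to the real matrix\<close>

lift_definition complexify_op :: "(real^'n) \<Rightarrow>\<^sub>L (complex^'n)" is complexify_vec
  unfolding linear_conv_bounded_linear[symmetric]
  by (rule linearI) (simp_all add: complexify_vec_def vec_eq_iff complex_eq_iff)

lift_definition re_op :: "(complex^'n) \<Rightarrow>\<^sub>L (real^'n)" is "\<lambda>v. \<chi> i. Re (v $ i)"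
  unfolding linear_conv_bounded_linear[symmetric]
  by (rule linearI) (simp_all add: vec_eq_iff)

lift_definition mat_op :: "real^'n^'m \<Rightarrow> (real^'n) \<Rightarrow>\<^sub>L (real^'m)" is "\<lambda>A v. A *v v"
  by (rule matrix_vector_mul_bounded_linear)

declare complexify_op.rep_eq [simp] mat_op.rep_eq [simp]

lemma re_op_complexify [simp]: "re_op (complexify_vec v) = v"
  by (simp add: re_op.rep_eq complexify_vec_def vec_eq_iff)

lemma complexify_matrix_mult: "complexify_mat M *v complexify_vec v = complexify_vec (M *v v)"
  by (simp add: complexify_mat_def complexify_vec_def vec_eq_iff matrix_vector_mult_def)

lemma re_op_matrix_mult: "re_op (complexify_mat M *v v) = M *v re_op v"
  by (simp add: re_op.rep_eq complexify_mat_def vec_eq_iff matrix_vector_mult_def)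

definition inverts_shift_minus :: "('a::real_normed_vector ell2 \<Rightarrow>\<^sub>L 'a ell2) \<Rightarrow> ('a \<Rightarrow>\<^sub>L 'a) \<Rightarrow> bool"
  where "inverts_shift_minus G c \<longleftrightarrow>
    G o\<^sub>L (translate 1 - mulop (\<lambda>_. c)) = id_blinfun \<and> (translate 1 - mulop (\<lambda>_. c)) o\<^sub>L G = id_blinfun"

text \<open>The real part of a complex solution with real source is a real solution, and injectivity
  is inherited from the complexification. A right inverse of an injective operator is also a left
  inverse.\<close>

lemma hyperbolic_shift_minus_invertible:
  assumes "hyperbolic M"
  shows "\<exists>G. inverts_shift_minus G (mat_op M)"
proof -
  let ?A = "complexify_mat M"
  obtain zs where zs: "\<And>v. eigprod ?A zs v = 0" "\<And>z. z \<in> set zs \<Longrightarrow> cmod z \<noteq> 1"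
    using hyperbolic_annihilating_eigprod[OF assms] by blast
  obtain G where G: "\<And>y. translate 1 (blinfun_apply G y) - mulop (\<lambda>_. cmat_op ?A) (G y) = y"
    using shift_minus_matrix_surj[OF zs(2), of zs ?A] zs(1) by auto
  let ?H = "mulop (\<lambda>_. re_op) o\<^sub>L G o\<^sub>L mulop (\<lambda>_. complexify_op)"
  let ?L = "translate 1 - mulop (\<lambda>_. mat_op M)"
  have LH: "?L (?H y) = y" for y
  proof (rule seq_inject_ext)
    fix n
    let ?x = "G (mulop (\<lambda>_. complexify_op) y)"
    have "seq ?x (n + 1) - ?A *v seq ?x n = complexify_vec (seq y n)"
      using arg_cong[OF G[of "mulop (\<lambda>_. complexify_op) y"], of "\<lambda>x. seq x n"] by simp
    then have "re_op (seq ?x (n + 1) - ?A *v seq ?x n) = seq y n" by simp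
    then show "seq (?L (?H y)) n = seq y n"
      by (simp add: blinfun.diff_left blinfun.diff_right re_op_matrix_mult)
  qed
  have inj: "x = 0" if "?L x = 0" for x
  proof -
    have x: "seq x (n + 1) = M *v seq x n" for n
      using arg_cong[OF that, of "\<lambda>x. seq x n"] by (simp add: blinfun.diff_left)
    have z: "mulop (\<lambda>_. complexify_op) x = 0"
      by (rule shift_minus_matrix_inj[OF zs(2), of zs _ ?A])
         (auto intro!: seq_inject_ext simp: x complexify_matrix_mult zs)
    have "seq x n = 0" for n
      using arg_cong[OF z, of "\<lambda>x. re_op (seq x n)"] by (simp add: blinfun.zero_right)
    then show ?thesis by (intro seq_inject_ext) simp
  qed
  have "?H (?L x) = x" for x
  proof -
    have "?L (?H (?L x) - x) = 0" unfolding blinfun.diff_right LH by simp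
    then show ?thesis using inj by fastforce
  qed
  with LH show ?thesis unfolding inverts_shift_minus_def
    by (intro exI[of _ ?H] conjI blinfun_eqI) simp_all
qed

section \<open>The stable space as the set of initial values of square summable orbits\<close>

text \<open>A two-sided sequence constrained only for n \<ge> 0 serves as a half-line orbit. As f
  does not depend on n, the starting index can be moved, which \<open>stable_setI\<close> and
  \<open>stable_setE\<close> do.\<close>

definition stable_set :: "('a::real_normed_vector \<Rightarrow> 'a) \<Rightarrow> 'a set"
  where "stable_set f = {v. \<exists>z. seq z 0 = v \<and> (\<forall>n\<ge>0. seq z (n + 1) = f (seq z n))}"

lemma stable_setI:
  assumes "seq z k = v" "\<And>n. n \<ge> k \<Longrightarrow> seq z (n + 1) = f (seq z n)"
  shows "v \<in> stable_set f"
  unfolding stable_set_def using assms(1) assms(2)[of "_ + k"]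
  by (auto intro!: exI[of _ "translate k z"] simp: algebra_simps)

lemma stable_setE:
  assumes "v \<in> stable_set f"
  obtains z where "seq z k = v" "\<And>n. n \<ge> k \<Longrightarrow> seq z (n + 1) = f (seq z n)" "\<And>n. n < k \<Longrightarrow> seq z n = 0"
proof -
  obtain z where z: "seq z 0 = v" "\<And>n. n \<ge> 0 \<Longrightarrow> seq z (n + 1) = f (seq z n)"
    using assms unfolding stable_set_def by blast
  let ?z = "cutoff {k..} (translate (- k) z)"
  have "seq ?z (n + 1) = f (seq ?z n)" if "n \<ge> k" for n
    using z(2)[of "n - k"] that by (simp add: algebra_simps)
  then show ?thesis using that[of ?z] z(1) by simp
qed

lemma stable_set_orbitE:
  assumes "v \<in> stable_set f"
  obtains z where "seq z 0 = v" "\<And>n. n \<ge> 0 \<Longrightarrow> seq z (n + 1) = f (seq z n)"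
  using assms unfolding stable_set_def by blast

lemma vec_subspace_stable_set: "vec.subspace (stable_set ((*v) A) :: (complex^'n) set)"
  unfolding vec.subspace_def
proof (intro conjI ballI allI)
  show "0 \<in> stable_set ((*v) A)" by (rule stable_setI[of 0 0]) auto
  fix v w c assume "v \<in> stable_set ((*v) A)"
  then obtain x where x: "seq x 0 = v" "\<And>n. n \<ge> 0 \<Longrightarrow> seq x (n + 1) = A *v (seq x n)"
    by (rule stable_set_orbitE) blast
  show "c *s v \<in> stable_set ((*v) A)"
    by (rule stable_setI[of "mulop (\<lambda>_. smult_op c) x" 0]) (auto simp: x vec.scale)
  assume "w \<in> stable_set ((*v) A)"
  then obtain y where y: "seq y 0 = w" "\<And>n. n \<ge> 0 \<Longrightarrow> seq y (n + 1) = A *v (seq y n)"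
    by (rule stable_set_orbitE) blast
  show "v + w \<in> stable_set ((*v) A)"
    by (rule stable_setI[of "x + y" 0]) (auto simp: x y vec.add)
qed

lemma matrix_mult_stable_set:
  assumes "v \<in> stable_set ((*v) A)"
  shows "(A - mat z) *v v \<in> stable_set ((*v) (A :: complex^'n^'n))"
proof -
  obtain x where x: "seq x 0 = v" "\<And>n. n \<ge> 0 \<Longrightarrow> seq x (n + 1) = A *v (seq x n)"
    using assms by (rule stable_set_orbitE) blast
  show ?thesis
    by (rule stable_setI[of "mulop (\<lambda>_. cmat_op (A - mat z)) x" 0])
       (auto simp: x mat_diff_vector_mult vec.diff vec.scale)
qed

text \<open>The orbit of an eigenvector is z^n v, and its entries have norm at least that of v, so
  it is square summable only for v = 0.\<close>

lemma eigenvector_stable_set_imp_zero: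
  fixes v :: "complex^'n"
  assumes "v \<in> stable_set ((*v) A)" "(A - mat z) *v v = 0" "cmod z \<ge> 1"
  shows "v = 0"
proof -
  obtain x where x: "seq x 0 = v" "\<And>n. n \<ge> 0 \<Longrightarrow> seq x (n + 1) = A *v (seq x n)"
    using assms(1) by (rule stable_set_orbitE) blast
  have Av: "A *v v = z *s v" using assms(2) by (simp add: mat_diff_vector_mult)
  have orb: "seq x (int n) = z ^ n *s v" for n
  proof (induction n)
    case (Suc n)
    then show ?case using x(2)[of "int n"] by (simp add: vec.scale Av add.commute)
  qed (simp add: x)
  have "real N * (norm v)\<^sup>2 \<le> (norm x)\<^sup>2" for N
  proof -
    have "real N * (norm v)\<^sup>2 = (\<Sum>n\<in>int ` {..<N}. (norm v)\<^sup>2)"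
      by (simp add: card_image)
    also have "\<dots> \<le> (\<Sum>n\<in>int ` {..<N}. (norm (seq x n))\<^sup>2)"
    proof (rule sum_mono)
      fix k assume "k \<in> int ` {..<N}"
      then obtain n where k: "k = int n" by blast
      have "1 * norm v \<le> cmod z ^ n * norm v"
        using assms(3) by (intro mult_right_mono one_le_power) auto
      then show "(norm v)\<^sup>2 \<le> (norm (seq x k))\<^sup>2"
        unfolding k orb norm_vector_smult norm_power by (intro power_mono) auto
    qed
    also have "\<dots> = (L2_set (\<lambda>n. norm (seq x n)) (int ` {..<N}))\<^sup>2"
      unfolding L2_set_def by (simp add: sum_nonneg)
    also have "\<dots> \<le> (norm x)\<^sup>2" by (intro power_mono L2_set_le_norm) auto
    finally show ?thesis .
  qed
  then have "(norm v)\<^sup>2 \<le> 0"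
    using ex_less_of_nat_mult[of "(norm v)\<^sup>2" "(norm x)\<^sup>2"] by (meson not_le)
  then show ?thesis by simp
qed

lemma geometric_square_summable:
  fixes v :: "complex^'n"
  assumes "cmod z < 1"
  shows "\<exists>x. \<forall>n. seq x n = (if n \<ge> 0 then z ^ nat n *s v else 0)"
proof -
  let ?f = "\<lambda>n. if n \<ge> 0 then z ^ nat n *s v else 0"
  have "summable (\<lambda>n. ((cmod z)\<^sup>2) ^ n * (norm v)\<^sup>2)"
    using assms by (intro summable_mult2 summable_geometric) (simp add: abs_square_less_1)
  then have "(\<lambda>n. ((cmod z)\<^sup>2) ^ n * (norm v)\<^sup>2) summable_on UNIV"
    by (intro summable_nonneg_imp_summable_on) auto
  then have "(\<lambda>n. (norm (?f (int n)))\<^sup>2) summable_on UNIV"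
    by (simp add: norm_vector_smult norm_power power_mult_distrib power2_eq_square mult_ac)
  then have "((\<lambda>n. (norm (?f n))\<^sup>2) \<circ> int) summable_on UNIV" by (simp add: o_def)
  then have "(\<lambda>n. (norm (?f n))\<^sup>2) summable_on range int"
    by (subst summable_on_reindex) auto
  then have "(\<lambda>n. (norm (?f n))\<^sup>2) summable_on UNIV"
    by (rule summable_on_cong_neutral[THEN iffD1, rotated -1])
       (auto simp: image_iff intro: nonneg_int_cases)
  then show ?thesis by (intro exI[of _ "Ell2 ?f"]) (simp add: Ell2_inverse)
qed

text \<open>By induction (A - z) v has a square summable orbit w. An orbit x of v must satisfy A x n
  = z x n + w n, so it is found by solving the scalar equation x (n + 1) = z x n + w n.\<close>

lemma root_space_subset_stable_set:
  fixes A :: "complex^'n^'n"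
  assumes z: "cmod z < 1"
  shows "root_space A z \<subseteq> stable_set ((*v) A)"
proof
  fix v assume "v \<in> root_space A z"
  then show "v \<in> stable_set ((*v) A)"
  proof (induction v rule: root_space_induct)
    case zero
    then show ?case using vec.subspace_0[OF vec_subspace_stable_set] .
  next
    case (step v)
    obtain w where w: "seq w 0 = (A - mat z) *v v" "\<And>n. n \<ge> 0 \<Longrightarrow> seq w (n + 1) = A *v seq w n"
      using step(2) by (rule stable_set_orbitE) blast
    obtain H :: "(complex^'n) ell2 \<Rightarrow>\<^sub>L _" where H: "\<And>y. translate 1 (blinfun_apply H y) - mulop (\<lambda>_. smult_op z) (H y) = y"
      using shift_minus_smult_invertible[of z] z by auto
    \<comment> \<open>\<open>H w\<close> solves the scalar equation with the wrong value at 0; a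
      decaying homogeneous solution moves that value to v.\<close>
    obtain g where g: "\<And>n. seq g n = (if n \<ge> 0 then z ^ nat n *s (v - seq (H w) 0) else 0)"
      using geometric_square_summable[OF z] by blast
    let ?x = "H w + g"
    have Hw: "seq (H w) (n + 1) = z *s seq (H w) n + seq w n" for n
      using arg_cong[OF H[of w], of "\<lambda>x. seq x n"] by (simp add: algebra_simps)
    have rec: "seq ?x (n + 1) = z *s seq ?x n + seq w n" if "n \<ge> 0" for n
      using that by (simp add: Hw g nat_add_distrib vector_add_ldistrib)
    have x0: "seq ?x 0 = v" by (simp add: g)
    have eig: "A *v seq ?x n = z *s seq ?x n + seq w n" if "n \<ge> 0" for n
      using that
    proof (induction n rule: int_ge_induct)
      case base
      then show ?case unfolding x0 w(1) by (simp add: mat_diff_vector_mult)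
    next
      case (step n)
      have "A *v seq ?x (n + 1) = A *v (z *s seq ?x n + seq w n)"
        using rec step(1) by simp
      also have "\<dots> = z *s (A *v seq ?x n) + A *v seq w n"
        by (simp add: vec.add vec.scale)
      also have "\<dots> = z *s seq ?x (n + 1) + seq w (n + 1)"
        using step rec w(2) by simp
      finally show ?case .
    qed
    show ?case by (rule stable_setI[of ?x 0]) (use x0 rec eig in auto)
  qed
qed

lemma span_root_spaces_surj:
  assumes "u \<in> span (\<Union>y\<in>Z. root_space A y)"
  shows "\<exists>t \<in> span (\<Union>y\<in>Z. root_space A y). u - (A - mat z) *v t \<in> (if z \<in> Z then root_space A z else {0})"
  using assms
proof (induction u rule: span_induct_alt)
  case base
  show ?case using vec.subspace_0[OF vec_subspace_root_space]
    by (intro bexI[of _ 0]) (auto intro: span_zero)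
next
  case (step c u w)
  let ?K = "if z \<in> Z then root_space A z else {0}"
  have K: "vec.subspace ?K" using vec_subspace_root_space by (auto simp: vec.subspace_def)
  obtain t where t: "t \<in> span (\<Union>y\<in>Z. root_space A y)" "w - (A - mat z) *v t \<in> ?K" using step by blast
  obtain y where y: "y \<in> Z" "u \<in> root_space A y" using step by blast
  have "\<exists>s \<in> span (\<Union>y\<in>Z. root_space A y). u - (A - mat z) *v s \<in> ?K"
  proof (cases "y = z")
    case True
    then show ?thesis using y by (intro bexI[of _ 0]) (auto intro: span_zero)
  next
    case False
    then obtain s where "s \<in> root_space A y" "(A - mat z) *v s = u" using root_space_surj[OF y(2)] by blast
    then show ?thesis using y(1) vec.subspace_0[OF K] by (intro bexI[of _ s]) (auto intro!: span_base)
  qed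
  then obtain s where s: "s \<in> span (\<Union>y\<in>Z. root_space A y)" "u - (A - mat z) *v s \<in> ?K" by blast
  have "c *\<^sub>R u + w - (A - mat z) *v (c *\<^sub>R s + t)
      = complex_of_real c *s (u - (A - mat z) *v s) + (w - (A - mat z) *v t)"
    by (simp add: scaleR_eq_vector_scalar vec.add vec.scale algebra_simps)
  also have "\<dots> \<in> ?K" using s(2) t(2) by (intro vec.subspace_add[OF K] vec.subspace_scale[OF K])
  finally show ?case using s(1) t(1) by (intro bexI[of _ "c *\<^sub>R s + t"] span_add span_scale)
qed

text \<open>By induction (A - z) v lies in the span, and modulo the root space of z it equals (A -
  z) t with t in the span. So v - t is in that root space if the modulus of z is below 1; otherwise
  it is an eigenvector with a square summable orbit, hence 0.\<close>

lemma stable_set_subset_span_root_spaces: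
  assumes "v \<in> stable_set ((*v) A)" "eigprod A zs v = 0"
  shows "v \<in> span (\<Union>z\<in>{z. cmod z < 1}. root_space A z)"
  using assms
proof (induction zs arbitrary: v)
  case Nil
  then show ?case by (simp add: span_zero)
next
  case (Cons z zs)
  let ?K = "\<Union>z\<in>{z. cmod z < 1}. root_space A z"
  have "(A - mat z) *v v \<in> span ?K"
    using Cons.IH[OF matrix_mult_stable_set[OF Cons.prems(1)]] Cons.prems(2) by simp
  then obtain t where t: "t \<in> span ?K"
      "(A - mat z) *v v - (A - mat z) *v t \<in> (if cmod z < 1 then root_space A z else {0})"
    using span_root_spaces_surj[of _ A "{z. cmod z < 1}" z] by auto
  have "v - t \<in> span ?K"
  proof (cases "cmod z < 1")
    case True
    then have "(A - mat z) *v (v - t) \<in> root_space A z" using t(2) by (simp add: vec.diff)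
    then have "v - t \<in> root_space A z" by (rule root_spaceI)
    then show ?thesis using True by (intro span_base) auto
  next
    case False
    have "span ?K \<subseteq> stable_set ((*v) A)"
      using root_space_subset_stable_set
      by (intro span_minimal vec_subspace_imp_subspace vec_subspace_stable_set) blast
    then have "v - t \<in> stable_set ((*v) A)"
      using vec.subspace_diff[OF vec_subspace_stable_set Cons.prems(1)] t(1) by blast
    moreover have "(A - mat z) *v (v - t) = 0" using t(2) False by (simp add: vec.diff)
    ultimately have "v - t = 0" using eigenvector_stable_set_imp_zero False by force
    then show ?thesis by (simp add: span_zero)
  qed
  then show ?case using t(1) span_add[of "v - t" ?K t] by simp
qed

text \<open>This replaces generalised eigenspaces by square summable orbits, which can be compared
  with the inverse of S - M.\<close>

theorem Es_eq_stable_set: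
  assumes "hyperbolic M"
  shows "Es M = stable_set ((*v) M)"
proof -
  let ?A = "complexify_mat M"
  obtain zs where zs: "\<And>v. eigprod ?A zs v = 0"
    using hyperbolic_annihilating_eigprod[OF assms] by blast
  have c: "span (\<Union>z\<in>{z. cmod z < 1}. gen_eigenspace M z) = stable_set ((*v) ?A)"
    unfolding gen_eigenspace_eq_root_space
  proof
    show "span (\<Union>z\<in>{z. cmod z < 1}. root_space ?A z) \<subseteq> stable_set ((*v) ?A)"
      using root_space_subset_stable_set
      by (intro span_minimal vec_subspace_imp_subspace vec_subspace_stable_set) blast
    show "stable_set ((*v) ?A) \<subseteq> span (\<Union>z\<in>{z. cmod z < 1}. root_space ?A z)"
      using stable_set_subset_span_root_spaces zs by blast
  qed
  have "complexify_vec v \<in> stable_set ((*v) ?A) \<longleftrightarrow> v \<in> stable_set ((*v) M)" for v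
  proof
    assume "complexify_vec v \<in> stable_set ((*v) ?A)"
    then obtain x where x: "seq x 0 = complexify_vec v" "\<And>n. n \<ge> 0 \<Longrightarrow> seq x (n + 1) = ?A *v seq x n"
      by (rule stable_set_orbitE) blast
    show "v \<in> stable_set ((*v) M)"
      by (rule stable_setI[of "mulop (\<lambda>_. re_op) x" 0]) (auto simp: x re_op_matrix_mult)
  next
    assume "v \<in> stable_set ((*v) M)"
    then obtain x where x: "seq x 0 = v" "\<And>n. n \<ge> 0 \<Longrightarrow> seq x (n + 1) = M *v seq x n"
      by (rule stable_set_orbitE) blast
    show "complexify_vec v \<in> stable_set ((*v) ?A)"
      by (rule stable_setI[of "mulop (\<lambda>_. complexify_op) x" 0]) (auto simp: x complexify_matrix_mult)
  qed
  then show ?thesis unfolding Es_def c by blast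
qed

section \<open>Solution operators for the equation cut open at one index\<close>

definition inl_blinfun :: "'a::real_normed_vector \<Rightarrow>\<^sub>L ('a \<times> 'b::real_normed_vector)"
  where "inl_blinfun = Blinfun (\<lambda>x. (x, 0))"

definition inr_blinfun :: "'b::real_normed_vector \<Rightarrow>\<^sub>L ('a::real_normed_vector \<times> 'b)"
  where "inr_blinfun = Blinfun (\<lambda>x. (0, x))"

lemma inl_blinfun_apply [simp]: "inl_blinfun x = (x, 0)"
  and inr_blinfun_apply [simp]: "inr_blinfun y = (0, y)"
  unfolding inl_blinfun_def inr_blinfun_def
  by (simp_all add: bounded_linear_Blinfun_apply bounded_linear_Pair bounded_linear_ident bounded_linear_zero)

lemma inverts_shift_minus_eq:
  assumes "inverts_shift_minus G c"
  shows "seq (G y) (n + 1) = c (seq (G y) n) + seq y n"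
proof -
  have "(translate 1 - mulop (\<lambda>_. c)) (G y) = y"
    using assms bij_imp_mutual_inverse(2) unfolding inverts_shift_minus_def by blast
  from arg_cong[OF this, of "\<lambda>x. seq x n"] show ?thesis
    by (simp add: blinfun.diff_left algebra_simps)
qed

lemma inverts_shift_minus_unique:
  assumes "inverts_shift_minus G c" "\<And>n. seq x (n + 1) = c (seq x n) + seq y n"
  shows "x = G y"
proof -
  have "(translate 1 - mulop (\<lambda>_. c)) x = y"
    by (rule seq_inject_ext) (simp add: blinfun.diff_left assms(2))
  then show ?thesis
    using assms(1) bij_imp_mutual_inverse(1) unfolding inverts_shift_minus_def by metis
qed

text \<open>If \<open>G\<close> inverts \<open>S - c\<close>, then \<open>G (delta (k - 1) v)\<close> is the forward orbit of the stable part
  of \<open>v\<close> from index \<open>k\<close> on, and minus the backward orbit of the unstable part below \<open>k\<close>.\<close>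

definition stable_proj :: "('a::real_normed_vector ell2 \<Rightarrow>\<^sub>L 'a ell2) \<Rightarrow> int \<Rightarrow> 'a \<Rightarrow>\<^sub>L 'a"
  where "stable_proj G k = ev k o\<^sub>L (G o\<^sub>L delta (k - 1))"

context
  fixes G :: "'a::banach ell2 \<Rightarrow>\<^sub>L 'a ell2" and c :: "'a \<Rightarrow>\<^sub>L 'a"
  assumes G: "inverts_shift_minus G c"
begin

text \<open>Cutting an orbit off below k leaves one source term: at index k - 1 the sequence jumps
  from 0 to x k.\<close>

lemma forward_orbit_eq:
  assumes "\<And>n. n \<ge> k \<Longrightarrow> seq x (n + 1) = c (seq x n)"
  shows "cutoff {k..} x = G (delta (k - 1) (seq x k))"
  by (rule inverts_shift_minus_unique[OF G]) (auto simp: assms blinfun.zero_right)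

text \<open>Here the cut sequence jumps to 0 at k, where the recursion asks for x k. The sign turns
  this into the same source as for a forward orbit.\<close>

lemma backward_orbit_eq:
  assumes "\<And>n. n < k \<Longrightarrow> seq x (n + 1) = c (seq x n)"
  shows "- cutoff {..<k} x = G (delta (k - 1) (seq x k))"
proof (rule inverts_shift_minus_unique[OF G])
  fix n
  show "seq (- cutoff {..<k} x) (n + 1) = c (seq (- cutoff {..<k} x) n) + seq (delta (k - 1) (seq x k)) n"
    using assms[of n] by (auto simp: blinfun.zero_right blinfun.minus_right)
qed

lemma stable_proj_forward_orbit:
  "(\<And>n. n \<ge> k \<Longrightarrow> seq x (n + 1) = c (seq x n)) \<Longrightarrow> stable_proj G k (seq x k) = seq x k"
  using arg_cong[OF forward_orbit_eq[of k x], of "\<lambda>x. seq x k"] by (simp add: stable_proj_def)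

lemma stable_proj_backward_orbit:
  "(\<And>n. n < k \<Longrightarrow> seq x (n + 1) = c (seq x n)) \<Longrightarrow> stable_proj G k (seq x k) = 0"
  using arg_cong[OF backward_orbit_eq[of k x], of "\<lambda>x. seq x k"] by (simp add: stable_proj_def)

lemma range_stable_proj: "range (stable_proj G k) = stable_set c"
proof safe
  fix v
  show "stable_proj G k v \<in> stable_set c"
    by (rule stable_setI[where z = "G (delta (k - 1) v)" and k = k])
       (simp_all add: stable_proj_def inverts_shift_minus_eq[OF G])
next
  fix v assume "v \<in> stable_set c"
  then obtain z where z: "seq z k = v" "\<And>n. n \<ge> k \<Longrightarrow> seq z (n + 1) = c (seq z n)"
    by (rule stable_setE[where k = k]) blast
  show "v \<in> range (stable_proj G k)"
    using stable_proj_forward_orbit[of k z] z by (metis rangeI)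
qed

lemma stable_proj_id: "v \<in> stable_set c \<Longrightarrow> stable_proj G k v = v"
proof -
  assume "v \<in> stable_set c"
  then obtain z where z: "seq z k = v" "\<And>n. n \<ge> k \<Longrightarrow> seq z (n + 1) = c (seq z n)"
    by (rule stable_setE[where k = k]) blast
  then show ?thesis using stable_proj_forward_orbit[of k z] by simp
qed

lemma stable_proj_idem: "stable_proj G k (stable_proj G k v) = stable_proj G k v"
  using stable_proj_id range_stable_proj by blast

end

text \<open>\<open>R\<close> solves \<open>x (n + 1) = a n (x n) + y n\<close> for all \<open>n\<close> outside \<open>{m0..m1}\<close>, for sequences
  vanishing on \<open>{m0<..m1}\<close>; \<open>N\<close> parametrises the homogeneous solutions by the range of the
  projection \<open>E\<close>, and \<open>C\<close> reads the parameter off a solution.\<close>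

definition cut_solution ::
  "(int \<Rightarrow> ('a::real_normed_vector \<Rightarrow>\<^sub>L 'a)) \<Rightarrow> ('e::real_normed_vector \<Rightarrow>\<^sub>L 'e) \<Rightarrow> int \<Rightarrow> int \<Rightarrow>
    ('a ell2 \<Rightarrow>\<^sub>L 'a ell2) \<Rightarrow> ('e \<Rightarrow>\<^sub>L 'a ell2) \<Rightarrow> ('a ell2 \<Rightarrow>\<^sub>L 'e) \<Rightarrow> bool"
  where "cut_solution a E m0 m1 R N C \<longleftrightarrow>
    (\<forall>y n. m0 < n \<and> n \<le> m1 \<longrightarrow> seq (R y) n = 0) \<and>
    (\<forall>e n. m0 < n \<and> n \<le> m1 \<longrightarrow> seq (N e) n = 0) \<and>
    (\<forall>y n. n < m0 \<or> m1 < n \<longrightarrow> seq (R y) (n + 1) = a n (seq (R y) n) + seq y n) \<and>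
    (\<forall>e n. n < m0 \<or> m1 < n \<longrightarrow> seq (N e) (n + 1) = a n (seq (N e) n)) \<and>
    (\<forall>x y. (\<forall>n. m0 < n \<and> n \<le> m1 \<longrightarrow> seq x n = 0) \<longrightarrow>
       (\<forall>n. n < m0 \<or> m1 < n \<longrightarrow> seq x (n + 1) = a n (seq x n) + seq y n) \<longrightarrow>
       x = R y + N (C x)) \<and>
    (\<forall>y. C (R y) = 0) \<and> (\<forall>e. C (N e) = E e) \<and> (\<forall>x. E (C x) = C x)"

lemma cut_solutionD:
  assumes "cut_solution a E m0 m1 R N C"
  shows "m0 < n \<Longrightarrow> n \<le> m1 \<Longrightarrow> seq (R y) n = 0"
    and "m0 < n \<Longrightarrow> n \<le> m1 \<Longrightarrow> seq (N e) n = 0"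
    and "n < m0 \<or> m1 < n \<Longrightarrow> seq (R y) (n + 1) = a n (seq (R y) n) + seq y n"
    and "n < m0 \<or> m1 < n \<Longrightarrow> seq (N e) (n + 1) = a n (seq (N e) n)"
    and "(\<And>n. m0 < n \<Longrightarrow> n \<le> m1 \<Longrightarrow> seq x n = 0) \<Longrightarrow>
       (\<And>n. n < m0 \<or> m1 < n \<Longrightarrow> seq x (n + 1) = a n (seq x n) + seq y n) \<Longrightarrow>
       x = R y + N (C x)"
    and "C (R y) = 0" and "C (N e) = E e" and "E (C x) = C x"
  using assms unfolding cut_solution_def by blast+

text \<open>The range is E^s(+oo) x E^u(-oo), with the stable part read at the first index of the
  right half-line and the unstable part at the last index of the left one.\<close>

definition cut_proj ::
  "('a::real_normed_vector ell2 \<Rightarrow>\<^sub>L 'a ell2) \<Rightarrow> ('a ell2 \<Rightarrow>\<^sub>L 'a ell2) \<Rightarrow> int \<Rightarrow> int \<Rightarrow> ('a \<times> 'a) \<Rightarrow>\<^sub>L ('a \<times> 'a)"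
  where "cut_proj G H m0 m1 =
    (inl_blinfun o\<^sub>L (stable_proj G (m1 + 1) o\<^sub>L fst_blinfun)) +
    (inr_blinfun o\<^sub>L ((id_blinfun - stable_proj H m0) o\<^sub>L snd_blinfun))"

lemma cut_proj_apply [simp]:
  "cut_proj G H m0 m1 (p, q) = (stable_proj G (m1 + 1) p, q - stable_proj H m0 q)"
  by (simp add: cut_proj_def blinfun.add_left blinfun.diff_left)

text \<open>Green's operator of the two half-lines. On the left the sources have indices below m0
  while the solution reaches up to m0, which accounts for the two different cutoffs.\<close>

definition cut_res :: "('a::real_normed_vector ell2 \<Rightarrow>\<^sub>L 'a ell2) \<Rightarrow> ('a ell2 \<Rightarrow>\<^sub>L 'a ell2) \<Rightarrow> int \<Rightarrow> int \<Rightarrow> 'a ell2 \<Rightarrow>\<^sub>L 'a ell2"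
  where "cut_res G H m0 m1 =
    (cutoff {m1<..} o\<^sub>L (G o\<^sub>L cutoff {m1<..})) + (cutoff {..m0} o\<^sub>L (H o\<^sub>L cutoff {..<m0}))"

text \<open>The right summand of the sequence is the forward orbit of the stable part of p. On the
  left, - H (delta (m0 - 1) q) is the backward orbit of the unstable part of q below m0, and the
  added \<open>delta m0\<close> makes the value at m0 that unstable part as well.\<close>

definition cut_hom :: "('a::real_normed_vector ell2 \<Rightarrow>\<^sub>L 'a ell2) \<Rightarrow> ('a ell2 \<Rightarrow>\<^sub>L 'a ell2) \<Rightarrow> int \<Rightarrow> int \<Rightarrow> ('a \<times> 'a) \<Rightarrow>\<^sub>L 'a ell2"
  where "cut_hom G H m0 m1 =
    (cutoff {m1<..} o\<^sub>L (G o\<^sub>L (delta m1 o\<^sub>L fst_blinfun))) +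
    (cutoff {..m0} o\<^sub>L ((delta m0 - (H o\<^sub>L delta (m0 - 1))) o\<^sub>L snd_blinfun))"

definition cut_data :: "('a::real_normed_vector ell2 \<Rightarrow>\<^sub>L 'a ell2) \<Rightarrow> ('a ell2 \<Rightarrow>\<^sub>L 'a ell2) \<Rightarrow> int \<Rightarrow> int \<Rightarrow> 'a ell2 \<Rightarrow>\<^sub>L ('a \<times> 'a)"
  where "cut_data G H m0 m1 =
    (inl_blinfun o\<^sub>L (stable_proj G (m1 + 1) o\<^sub>L ev (m1 + 1))) +
    (inr_blinfun o\<^sub>L ((id_blinfun - stable_proj H m0) o\<^sub>L ev m0))"

lemma cut_data_apply:
  "cut_data G H m0 m1 x =
    (stable_proj G (m1 + 1) (seq x (m1 + 1)), seq x m0 - stable_proj H m0 (seq x m0))"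
  by (simp add: cut_data_def blinfun.add_left blinfun.diff_left)

lemma seq_cut_res:
  "seq (cut_res G H m0 m1 y) n =
    (if m1 < n then seq (G (cutoff {m1<..} y)) n else 0) +
    (if n \<le> m0 then seq (H (cutoff {..<m0} y)) n else 0)"
  by (simp add: cut_res_def blinfun.add_left)

lemma seq_cut_hom:
  "seq (cut_hom G H m0 m1 (p, q)) n =
    (if m1 < n then seq (G (delta m1 p)) n else 0) +
    (if n \<le> m0 then (if n = m0 then q else 0) - seq (H (delta (m0 - 1) q)) n else 0)"
  by (simp add: cut_hom_def blinfun.add_left blinfun.diff_left)

text \<open>Subtracting \<open>?R y\<close> from a solution leaves a forward orbit on the right and
  a backward orbit on the left. The inverses of S - A and S - B identify each with the orbit of its
  value at the end of its half-line.\<close>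

lemma cut_solution_const:
  fixes G H :: "'a::banach ell2 \<Rightarrow>\<^sub>L 'a ell2"
  assumes G: "inverts_shift_minus G A" and H: "inverts_shift_minus H B" and m: "m0 \<le> m1"
  shows "cut_solution (\<lambda>n. if n < m0 then B else A) (cut_proj G H m0 m1) m0 m1
    (cut_res G H m0 m1) (cut_hom G H m0 m1) (cut_data G H m0 m1)"
    (is "cut_solution ?a ?E m0 m1 ?R ?N ?C")
  unfolding cut_solution_def
proof (intro conjI allI impI)
  note Geq = inverts_shift_minus_eq[OF G] and Heq = inverts_shift_minus_eq[OF H]
  have Gdelta: "stable_proj G (m1 + 1) v = seq (G (delta m1 v)) (m1 + 1)" for v
    by (simp add: stable_proj_def)
  have Hdelta: "stable_proj H m0 v = seq (H (delta (m0 - 1) v)) m0" for v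
    by (simp add: stable_proj_def)
  fix y x :: "'a ell2" and e :: "'a \<times> 'a" and n :: int
  obtain p q where e: "e = (p, q)" by (cases e)
  show "m0 < n \<and> n \<le> m1 \<Longrightarrow> seq (?R y) n = 0" by (simp add: seq_cut_res)
  show "m0 < n \<and> n \<le> m1 \<Longrightarrow> seq (?N e) n = 0" by (simp add: e seq_cut_hom)
  show "n < m0 \<or> m1 < n \<Longrightarrow> seq (?R y) (n + 1) = ?a n (seq (?R y) n) + seq y n"
    using m by (auto simp: seq_cut_res Geq Heq)
  show "n < m0 \<or> m1 < n \<Longrightarrow> seq (?N e) (n + 1) = ?a n (seq (?N e) n)"
    using m by (auto simp: e seq_cut_hom Geq Heq blinfun.minus_right)
  show "?C (?R y) = 0"
  proof -
    \<comment> \<open>The source on the right starts after m1, so up to m1 + 1 the solution is a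
      backward orbit and has no stable part there. On the left the source ends before m0, and the
      solution is a forward orbit from m0 on, hence purely stable there.\<close>
    have "stable_proj G (m1 + 1) (seq (G (cutoff {m1<..} y)) (m1 + 1)) = 0"
      by (rule stable_proj_backward_orbit[OF G]) (simp add: Geq)
    moreover have "stable_proj H m0 (seq (H (cutoff {..<m0} y)) m0) = seq (H (cutoff {..<m0} y)) m0"
      by (rule stable_proj_forward_orbit[OF H]) (simp add: Heq)
    ultimately show ?thesis using m by (simp add: cut_data_apply seq_cut_res zero_prod_def)
  qed
  show "?C (?N e) = ?E e"
    using m by (simp add: e cut_data_apply seq_cut_hom Gdelta[symmetric] Hdelta[symmetric]
        stable_proj_idem[OF G] stable_proj_idem[OF H] blinfun.diff_right)
  show "?E (?C x) = ?C x"
    by (simp add: cut_data_apply stable_proj_idem[OF G] stable_proj_idem[OF H] blinfun.diff_right)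
  assume supp: "\<forall>n. m0 < n \<and> n \<le> m1 \<longrightarrow> seq x n = 0"
    and eqs: "\<forall>n. n < m0 \<or> m1 < n \<longrightarrow> seq x (n + 1) = ?a n (seq x n) + seq y n"
  let ?u = "x - ?R y"
  have u: "seq ?u (n + 1) = ?a n (seq ?u n)" if "n < m0 \<or> m1 < n" for n
    using eqs that m by (auto simp: seq_cut_res Geq Heq blinfun.diff_right)
  have Cu: "?C ?u = ?C x" using \<open>?C (?R y) = 0\<close> by (simp add: blinfun.diff_right)
  have right: "cutoff {m1 + 1..} ?u = G (delta m1 (seq ?u (m1 + 1)))"
    using forward_orbit_eq[OF G, of "m1 + 1" ?u] u m by simp
  have left: "- cutoff {..<m0} ?u = H (delta (m0 - 1) (seq ?u m0))"
    using backward_orbit_eq[OF H, of m0 ?u] u m by simp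
  have Pu: "stable_proj G (m1 + 1) (seq ?u (m1 + 1)) = seq ?u (m1 + 1)"
    using stable_proj_forward_orbit[OF G, of "m1 + 1" ?u] u m by simp
  have Qu: "stable_proj H m0 (seq ?u m0) = 0"
    using stable_proj_backward_orbit[OF H, of m0 ?u] u m by simp
  have "?u = ?N (?C ?u)"
  proof (rule seq_inject_ext)
    fix n
    consider "n \<le> m0" | "m0 < n" "n \<le> m1" | "m1 < n" using m by linarith
    then show "seq ?u n = seq (?N (?C ?u)) n"
    proof cases
      case 1
      then show ?thesis
        unfolding cut_data_apply Pu Qu seq_cut_hom diff_zero left[symmetric] using m by simp
    next
      case 2
      then show ?thesis using supp m by (simp add: cut_data_apply seq_cut_hom seq_cut_res)
    next
      case 3
      then show ?thesis
        unfolding cut_data_apply Pu Qu seq_cut_hom right[symmetric] using m by simp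
    qed
  qed
  then show "x = ?R y + ?N (?C x)" unfolding Cu by (simp add: algebra_simps)
qed

text \<open>A solution of the perturbed equation with source y solves the unperturbed one with
  source D x + y, so (1 - R D) x = R y + N (C x), and \<open>W\<close> inverts the factor on the
  left. \<open>C\<close> can stay the same because it vanishes on the range of
  \<open>R\<close>.\<close>

lemma cut_solution_perturb:
  assumes S: "cut_solution c E m0 m1 R N C"
    and D: "\<And>x n. n < m0 \<or> m1 < n \<Longrightarrow> seq (blinfun_apply D x) n = blinfun_apply (a n) (seq x n) - c n (seq x n)"
    and W: "W o\<^sub>L (id_blinfun - (R o\<^sub>L D)) = id_blinfun" "(id_blinfun - (R o\<^sub>L D)) o\<^sub>L W = id_blinfun"
  shows "cut_solution a E m0 m1 (W o\<^sub>L R) (W o\<^sub>L N) C"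
  unfolding cut_solution_def
proof (intro conjI allI impI)
  note S = cut_solutionD[OF S]
  have W1: "W (x - R (D x)) = x" for x
    using bij_imp_mutual_inverse(1)[OF W, of x] by (simp add: blinfun.diff_left)
  have W2: "W x = R (D (W x)) + x" for x
    using bij_imp_mutual_inverse(2)[OF W, of x] by (simp add: blinfun.diff_left algebra_simps)
  have WR: "W (R y) = R (D (W (R y)) + y)" for y
    by (subst W2) (simp add: blinfun.add_right)
  fix y x e n
  show "seq ((W o\<^sub>L R) y) n = 0" if "m0 < n \<and> n \<le> m1"
    using that by (simp, subst WR) (simp add: S)
  show "seq ((W o\<^sub>L N) e) n = 0" if "m0 < n \<and> n \<le> m1"
    using that by (simp, subst W2) (simp add: S)
  show "seq ((W o\<^sub>L R) y) (n + 1) = a n (seq ((W o\<^sub>L R) y) n) + seq y n" if n: "n < m0 \<or> m1 < n"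
  proof -
    have "seq (W (R y)) (n + 1) = seq (R (D (W (R y)) + y)) (n + 1)"
      by (subst WR) simp
    also have "\<dots> = c n (seq (R (D (W (R y)) + y)) n) + seq (D (W (R y)) + y) n"
      using S(3)[OF n] .
    also have "\<dots> = c n (seq (W (R y)) n) + seq (D (W (R y)) + y) n"
      by (simp only: WR[symmetric])
    finally show ?thesis by (simp add: D[OF n])
  qed
  show "seq ((W o\<^sub>L N) e) (n + 1) = a n (seq ((W o\<^sub>L N) e) n)" if n: "n < m0 \<or> m1 < n"
  proof -
    have "seq (W (N e)) (n + 1) = seq (R (D (W (N e))) + N e) (n + 1)"
      by (subst W2) simp
    also have "\<dots> = c n (seq (R (D (W (N e))) + N e) n) + seq (D (W (N e))) n"
      by (simp only: seq_add S(3,4)[OF n] blinfun.add_right) simp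
    also have "\<dots> = c n (seq (W (N e)) n) + seq (D (W (N e))) n"
      by (simp only: W2[symmetric])
    finally show ?thesis by (simp add: D[OF n])
  qed
  show "C ((W o\<^sub>L R) y) = 0"
    by (simp, subst WR) (simp add: S)
  show "C ((W o\<^sub>L N) e) = E e"
    by (simp, subst W2) (simp add: S blinfun.add_right)
  show "E (C x) = C x" by (rule S)
  assume supp: "\<forall>n. m0 < n \<and> n \<le> m1 \<longrightarrow> seq x n = 0"
    and eqs: "\<forall>n. n < m0 \<or> m1 < n \<longrightarrow> seq x (n + 1) = a n (seq x n) + seq y n"
  have "x = R (D x + y) + N (C x)"
    using supp eqs by (intro S) (auto simp: D)
  then have "x - R (D x) = R y + N (C x)" by (simp add: blinfun.add_right algebra_simps)
  then have "W (R y + N (C x)) = x" using W1[of x] by simp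
  then show "x = (W o\<^sub>L R) y + (W o\<^sub>L N) (C x)" by (simp add: blinfun.add_right)
qed

text \<open>The entry at m0 + 1, zero so far, is now computed from the entry at m0 by the equation
  there. \<open>C\<close> first erases this entry, since the old uniqueness property concerns
  sequences vanishing at m0 + 1.\<close>

lemma cut_solution_step:
  assumes S: "cut_solution a E m0 m1 R N C" and m: "m0 < m1"
  shows "cut_solution a E (m0 + 1) m1
    (R + (delta (m0 + 1) o\<^sub>L ((a m0 o\<^sub>L (ev m0 o\<^sub>L R)) + ev m0)))
    (N + (delta (m0 + 1) o\<^sub>L (a m0 o\<^sub>L (ev m0 o\<^sub>L N))))
    (C o\<^sub>L (id_blinfun - (delta (m0 + 1) o\<^sub>L ev (m0 + 1))))"
    (is "cut_solution a E _ m1 ?R ?N ?C")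
  unfolding cut_solution_def
proof (intro conjI allI impI)
  note S = cut_solutionD[OF S]
  have R: "seq (?R y) n = seq (R y) n + (if n = m0 + 1 then a m0 (seq (R y) m0) + seq y m0 else 0)" for y n
    by (simp add: blinfun.add_left)
  have N: "seq (?N e) n = seq (N e) n + (if n = m0 + 1 then a m0 (seq (N e) m0) else 0)" for e n
    by (simp add: blinfun.add_left)
  have C: "?C x = C (x - delta (m0 + 1) (seq x (m0 + 1)))" for x
    by (simp add: blinfun.diff_left)
  have r: "?R y - delta (m0 + 1) (seq (?R y) (m0 + 1)) = R y" for y
    using m by (intro seq_inject_ext) (simp add: R S(1) del: blinfun_apply_blinfun_compose)
  have h: "?N e - delta (m0 + 1) (seq (?N e) (m0 + 1)) = N e" for e
    using m by (intro seq_inject_ext) (simp add: N S(2) del: blinfun_apply_blinfun_compose)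
  fix y x e n
  show "seq (?R y) n = 0" if "m0 + 1 < n \<and> n \<le> m1"
    unfolding R using that by (simp add: S(1))
  show "seq (?N e) n = 0" if "m0 + 1 < n \<and> n \<le> m1"
    unfolding N using that by (simp add: S(2))
  show "seq (?R y) (n + 1) = a n (seq (?R y) n) + seq y n" if "n < m0 + 1 \<or> m1 < n"
    unfolding R using that m S(3)[of n y] S(1)[of "m0 + 1" y] by (cases "n = m0") auto
  show "seq (?N e) (n + 1) = a n (seq (?N e) n)" if "n < m0 + 1 \<or> m1 < n"
    unfolding N using that m S(4)[of n e] S(2)[of "m0 + 1" e] by (cases "n = m0") auto
  show "?C (?R y) = 0" unfolding C r by (rule S)
  show "?C (?N e) = E e" unfolding C h by (rule S)
  show "E (?C x) = ?C x" unfolding C by (rule S)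
  assume supp: "\<forall>n. m0 + 1 < n \<and> n \<le> m1 \<longrightarrow> seq x n = 0"
    and eqs: "\<forall>n. n < m0 + 1 \<or> m1 < n \<longrightarrow> seq x (n + 1) = a n (seq x n) + seq y n"
  let ?x = "x - delta (m0 + 1) (seq x (m0 + 1))"
  have x: "?x = R y + N (C ?x)"
  proof (rule S(5))
    show "seq ?x n = 0" if "m0 < n" "n \<le> m1" for n
      using that supp by (cases "n = m0 + 1") auto
    show "seq ?x (n + 1) = a n (seq ?x n) + seq y n" if "n < m0 \<or> m1 < n" for n
      using that eqs m by auto
  qed
  show "x = ?R y + ?N (?C x)"
  proof (rule seq_inject_ext)
    fix n
    have xn: "seq ?x n = seq (R y) n + seq (N (C ?x)) n" for n
      by (subst x) simp
    show "seq x n = seq (?R y + ?N (?C x)) n"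
    proof (cases "n = m0 + 1")
      case True
      have "seq x (m0 + 1) = a m0 (seq ?x m0) + seq y m0" using eqs by simp
      also have "\<dots> = a m0 (seq (R y) m0) + a m0 (seq (N (C ?x)) m0) + seq y m0"
        unfolding xn by (simp add: blinfun.add_right)
      finally show ?thesis
        unfolding seq_add R N C True using S(1)[of "m0 + 1" y] S(2)[of "m0 + 1" "C ?x"] m by (simp add: ac_simps)
    next
      case False
      then show ?thesis unfolding seq_add R N C using xn[of n] by simp
    qed
  qed
qed

lemma ex_cut_solution_family:
  fixes a :: "int \<Rightarrow> 'p::metric_space \<Rightarrow> ('a::real_normed_vector \<Rightarrow>\<^sub>L 'a)"
  assumes cont: "\<And>n. continuous_on U (a n)"
    and "m0 \<le> m1"
    and "continuous_on U R" "continuous_on U N" "continuous_on U C"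
    and "\<And>l. l \<in> U \<Longrightarrow> cut_solution (\<lambda>n. a n l) (E l) m0 m1 (R l) (N l) (C l)"
  shows "\<exists>R N C. continuous_on U R \<and> continuous_on U N \<and> continuous_on U C \<and>
    (\<forall>l\<in>U. cut_solution (\<lambda>n. a n l) (E l) m1 m1 (R l) (N l) (C l))"
  using assms(2-)
proof (induction "nat (m1 - m0)" arbitrary: m0 R N C)
  case 0
  then show ?case by (intro exI[of _ R] exI[of _ N] exI[of _ C]) auto
next
  case (Suc k)
  show ?case
  proof (rule Suc(1))
    show "k = nat (m1 - (m0 + 1))" "m0 + 1 \<le> m1" using Suc(2,3) by auto
    show "cut_solution (\<lambda>n. a n l) (E l) (m0 + 1) m1
        (R l + (delta (m0 + 1) o\<^sub>L ((a m0 l o\<^sub>L (ev m0 o\<^sub>L R l)) + ev m0)))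
        (N l + (delta (m0 + 1) o\<^sub>L (a m0 l o\<^sub>L (ev m0 o\<^sub>L N l))))
        (C l o\<^sub>L (id_blinfun - (delta (m0 + 1) o\<^sub>L ev (m0 + 1))))" if "l \<in> U" for l
      using Suc(2,3) Suc.prems(5)[OF that] by (intro cut_solution_step) auto
  qed (intro continuous_intros Suc.prems cont)+
qed

section \<open>Continuity in the parameter, uniformly in the index\<close>

lemma linear_blinfun_apply: "linear (blinfun_apply f)"
  by (rule bounded_linear.linear[OF blinfun.bounded_linear_right])

lemma continuous_on_uniform_limit_int:
  fixes a :: "int \<Rightarrow> 'p::metric_space \<Rightarrow> 'b::metric_space"
  assumes "\<And>n. continuous_on U (a n)" "F \<noteq> bot" "uniform_limit U a A F"
  shows "continuous_on U A"
  by (rule uniform_limit_theorem[OF _ assms(3,2)]) (simp add: assms(1))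

text \<open>Far out each a n is uniformly close to one of two continuous limits; only finitely many
  indices in between need their own modulus of continuity.\<close>

lemma uniform_equicontinuous:
  fixes a :: "int \<Rightarrow> 'p::metric_space \<Rightarrow> 'b::metric_space"
  assumes cont: "\<And>n. continuous_on U (a n)"
    and A: "uniform_limit U a A at_top" and B: "uniform_limit U a B at_bot"
    and l: "l \<in> U" and e: "0 < e"
  shows "\<forall>\<^sub>F m in at l within U. \<forall>n. dist (a n m) (a n l) < e"
proof -
  have contA: "continuous_on U A" and contB: "continuous_on U B"
    using continuous_on_uniform_limit_int[OF cont _ A] continuous_on_uniform_limit_int[OF cont _ B] by auto
  obtain N1 where N1: "\<And>n l. n \<ge> N1 \<Longrightarrow> l \<in> U \<Longrightarrow> dist (a n l) (A l) < e / 3"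
    using A e unfolding uniform_limit_iff eventually_at_top_linorder by (meson divide_pos_pos zero_less_numeral)
  obtain N0 where N0: "\<And>n l. n \<le> N0 \<Longrightarrow> l \<in> U \<Longrightarrow> dist (a n l) (B l) < e / 3"
    using B e unfolding uniform_limit_iff eventually_at_bot_linorder by (meson divide_pos_pos zero_less_numeral)
  have tend: "\<forall>\<^sub>F m in at l within U. dist (f m) (f l) < d" if "continuous_on U f" "0 < d" for f :: "'p \<Rightarrow> 'b" and d
    using that l unfolding continuous_on_def by (simp add: tendstoD)
  have "\<forall>\<^sub>F m in at l within U. \<forall>n\<in>{N0..N1}. dist (a n m) (a n l) < e"
    using tend[OF cont e] by (intro eventually_ball_finite) auto
  moreover have "\<forall>\<^sub>F m in at l within U. dist (A m) (A l) < e / 3" "\<forall>\<^sub>F m in at l within U. dist (B m) (B l) < e / 3"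
    by (rule tend[OF contA], use e in simp) (rule tend[OF contB], use e in simp)
  moreover have "\<forall>\<^sub>F m in at l within U. m \<in> U" by (simp add: eventually_at_filter)
  ultimately show ?thesis
  proof eventually_elim
    case (elim m)
    have tri: "dist (a n m) (a n l) < e" if "dist (a n m) (f m) < e / 3" "dist (a n l) (f l) < e / 3"
      "dist (f m) (f l) < e / 3" for n and f :: "'p \<Rightarrow> 'b"
      using that dist_triangle[of "a n m" "a n l" "f m"] dist_triangle[of "f m" "a n l" "f l"]
      by (simp add: dist_commute)
    show ?case
    proof
      fix n
      consider "n \<in> {N0..N1}" | "n \<le> N0" | "n \<ge> N1" by force
      then show "dist (a n m) (a n l) < e"
      proof cases
        case 1
        then show ?thesis using elim by blast
      next
        case 2
        then show ?thesis using elim l N0 by (intro tri[of _ B]) auto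
      next
        case 3
        then show ?thesis using elim l N1 by (intro tri[of _ A]) auto
      qed
    qed
  qed
qed

lemma bounded_of_limits:
  fixes a :: "int \<Rightarrow> 'p \<Rightarrow> 'b::real_normed_vector"
  assumes A: "uniform_limit U a A at_top" and B: "uniform_limit U a B at_bot" and l: "l \<in> U"
  shows "\<exists>K. \<forall>n. norm (a n l) \<le> K"
proof -
  obtain N1 where N1: "\<And>n. n \<ge> N1 \<Longrightarrow> dist (a n l) (A l) < 1"
    using A l unfolding uniform_limit_iff eventually_at_top_linorder by (meson zero_less_one)
  obtain N0 where N0: "\<And>n. n \<le> N0 \<Longrightarrow> dist (a n l) (B l) < 1"
    using B l unfolding uniform_limit_iff eventually_at_bot_linorder by (meson zero_less_one)
  have b1: "norm (a n l) \<le> 1 + norm (A l)" if "n \<ge> N1" for n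
    using N1[OF that] norm_triangle_sub[of "a n l" "A l"] by (simp add: dist_norm)
  have b0: "norm (a n l) \<le> 1 + norm (B l)" if "n \<le> N0" for n
    using N0[OF that] norm_triangle_sub[of "a n l" "B l"] by (simp add: dist_norm)
  have bm: "norm (a n l) \<le> (\<Sum>n\<in>{N0..N1}. norm (a n l))" if "n \<in> {N0..N1}" for n
    using that by (intro member_le_sum) auto
  have nn: "0 \<le> (\<Sum>n\<in>{N0..N1}. norm (a n l))" by (intro sum_nonneg) auto
  have "norm (a n l) \<le> 1 + norm (A l) + norm (B l) + (\<Sum>n\<in>{N0..N1}. norm (a n l))" for n
  proof -
    consider "n \<in> {N0..N1}" | "n \<le> N0" | "n \<ge> N1" by force
    then show ?thesis
      using b1[of n] b0[of n] bm[of n] nn norm_ge_zero[of "A l"] norm_ge_zero[of "B l"]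
      by cases linarith+
  qed
  then show ?thesis by blast
qed

lemma continuous_on_mulop_uniform:
  fixes c :: "int \<Rightarrow> 'p::metric_space \<Rightarrow> ('a::real_normed_vector \<Rightarrow>\<^sub>L 'b::real_normed_vector)"
  assumes bdd: "\<And>l. l \<in> U \<Longrightarrow> \<exists>K. \<forall>n. norm (c n l) \<le> K"
    and equi: "\<And>l e. l \<in> U \<Longrightarrow> 0 < e \<Longrightarrow> \<forall>\<^sub>F m in at l within U. \<forall>n. dist (c n m) (c n l) < e"
  shows "continuous_on U (\<lambda>l. mulop (\<lambda>n. c n l))"
proof (rule continuous_on_mulop[OF bdd])
  fix l and e :: real assume "l \<in> U" "0 < e"
  then obtain d where "d > 0" "\<forall>m\<in>U. m \<noteq> l \<and> dist m l < d \<longrightarrow> (\<forall>n. dist (c n m) (c n l) < e)"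
    using equi[of l e] unfolding eventually_at by blast
  then show "\<exists>d>0. \<forall>m\<in>U. dist m l < d \<longrightarrow> (\<forall>n. norm (c n m - c n l) \<le> e)"
    using \<open>0 < e\<close> by (intro exI[of _ d]) (metis diff_self dist_norm less_eq_real_def norm_zero)
qed

text \<open>Cutoffs have norm at most 1, so the bound is the same for all m0 and m1. This lets
  \<open>ex_cut_solution\<close> choose these indices after the bound.\<close>

lemma norm_cut_res: "norm (cut_res G H m0 m1) \<le> norm G + norm H"
proof -
  have le: "norm (cutoff S o\<^sub>L (F o\<^sub>L cutoff T)) \<le> norm F"
    for S T and F :: "'a::real_normed_vector ell2 \<Rightarrow>\<^sub>L 'a ell2"
  proof -
    have "norm (cutoff S o\<^sub>L (F o\<^sub>L cutoff T)) \<le> 1 * (norm F * 1)"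
      by (intro order_trans[OF norm_blinfun_compose] mult_mono norm_cutoff) auto
    then show ?thesis by simp
  qed
  show ?thesis unfolding cut_res_def
    by (rule order_trans[OF norm_triangle_ineq add_mono[OF le le]])
qed

lemma continuous_on_shift_inverse:
  assumes "continuous_on U A" "\<And>l. l \<in> U \<Longrightarrow> inverts_shift_minus (G l) (A l)"
  shows "continuous_on (U :: 'p::metric_space set) G"
proof (rule continuous_on_blinfun_inverse)
  have "\<forall>\<^sub>F m in at l within U. \<forall>n::int. dist (A m) (A l) < e" if "l \<in> U" "0 < e" for l e
    using assms(1) that unfolding continuous_on_def by (simp add: tendstoD)
  then have "continuous_on U (\<lambda>l. mulop (\<lambda>_. A l))"
    by (intro continuous_on_mulop_uniform) auto
  then show "continuous_on U (\<lambda>l. translate 1 - mulop (\<lambda>_. A l))"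
    by (intro continuous_intros)
qed (use assms(2) in \<open>auto simp: inverts_shift_minus_def\<close>)

theorem ex_cut_solution:
  fixes a :: "int \<Rightarrow> 'p::metric_space \<Rightarrow> ('a::banach \<Rightarrow>\<^sub>L 'a)"
  assumes U: "compact U" and cont: "\<And>n. continuous_on U (a n)"
    and A: "uniform_limit U a A at_top" and B: "uniform_limit U a B at_bot"
    and G: "\<And>l. l \<in> U \<Longrightarrow> inverts_shift_minus (G l) (A l)"
    and H: "\<And>l. l \<in> U \<Longrightarrow> inverts_shift_minus (H l) (B l)"
  shows "\<exists>m0 m1 R N C. continuous_on U R \<and> continuous_on U N \<and> continuous_on U C \<and>
    (\<forall>l\<in>U. cut_solution (\<lambda>n. a n l) (cut_proj (G l) (H l) m0 m1) m1 m1 (R l) (N l) (C l))"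
proof -
  have contA: "continuous_on U A" and contB: "continuous_on U B"
    using continuous_on_uniform_limit_int[OF cont _ A] continuous_on_uniform_limit_int[OF cont _ B] by auto
  have contG: "continuous_on U G" using continuous_on_shift_inverse[OF contA G] .
  have contH: "continuous_on U H" using continuous_on_shift_inverse[OF contB H] .
  obtain K1 where K1: "\<And>l. l \<in> U \<Longrightarrow> norm (G l) \<le> K1"
    using compact_imp_bounded[OF compact_continuous_image[OF contG U]] by (auto simp: bounded_iff)
  obtain K2 where K2: "\<And>l. l \<in> U \<Longrightarrow> norm (H l) \<le> K2"
    using compact_imp_bounded[OF compact_continuous_image[OF contH U]] by (auto simp: bounded_iff)
  \<comment> \<open>\<open>K\<close> bounds \<open>cut_res\<close> over the compact
    \<open>U\<close>, whatever the cut indices; the tolerance 1 / (2 K) then keeps the norm of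
    \<open>?R l o\<^sub>L D l\<close> at most 1/2.\<close>
  define K where "K = \<bar>K1\<bar> + \<bar>K2\<bar> + 1"
  define e where "e = 1 / (2 * K)"
  have K: "K > 0" unfolding K_def by linarith
  then have e: "e > 0" unfolding e_def by simp
  obtain N1 where N1: "\<And>n l. n \<ge> N1 \<Longrightarrow> l \<in> U \<Longrightarrow> norm (a n l - A l) < e"
    using A e unfolding uniform_limit_iff eventually_at_top_linorder dist_norm by meson
  obtain N0 where N0: "\<And>n l. n \<le> N0 \<Longrightarrow> l \<in> U \<Longrightarrow> norm (a n l - B l) < e"
    using B e unfolding uniform_limit_iff eventually_at_bot_linorder dist_norm by meson
  define m0 m1 where "m0 = min N0 N1" and "m1 = max N0 N1"
  have m: "m0 \<le> m1" unfolding m0_def m1_def by simp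
  \<comment> \<open>Zero on the block from m0 to m1: there the coefficients may be far from both
    limits, and the cut system has no equation to perturb.\<close>
  define d where "d = (\<lambda>n l. if n < m0 then a n l - B l else if m1 < n then a n l - A l else 0)"
  define D where "D = (\<lambda>l. mulop (\<lambda>n. d n l))"
  have d_le: "norm (d n l) \<le> e" if "l \<in> U" for n l
    using that N0[of n l] N1[of n l] e unfolding d_def m0_def m1_def by (auto intro: less_imp_le)
  have contD: "continuous_on U D"
    unfolding D_def
  proof (rule continuous_on_mulop_uniform)
    fix l and r :: real assume l: "l \<in> U" and r: "0 < r"
    have "\<forall>\<^sub>F m in at l within U. \<forall>n. dist (a n m) (a n l) < r / 2"
      by (rule uniform_equicontinuous[OF cont A B l]) (use r in simp)
    moreover have "\<forall>\<^sub>F m in at l within U. dist (A m) (A l) < r / 2"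
      "\<forall>\<^sub>F m in at l within U. dist (B m) (B l) < r / 2"
      using contA contB l unfolding continuous_on_def
      by (rule_tac tendstoD; use r in simp)+
    ultimately show "\<forall>\<^sub>F m in at l within U. \<forall>n. dist (d n m) (d n l) < r"
    proof eventually_elim
      case (elim m)
      have tri: "dist (u - v) (u' - v') < r" if "dist u u' < r / 2" "dist v v' < r / 2"
        for u v u' v' :: "'a \<Rightarrow>\<^sub>L 'a"
        using that norm_triangle_ineq4[of "u - u'" "v - v'"] by (simp add: dist_norm algebra_simps)
      show ?case unfolding d_def using elim r by (auto intro: tri)
    qed
  qed (use d_le in blast)
  let ?R = "\<lambda>l. cut_res (G l) (H l) m0 m1"
  have contR: "continuous_on U ?R"
    unfolding cut_res_def by (intro continuous_intros contG contH)
  have small: "norm (?R l o\<^sub>L D l) < 1" if l: "l \<in> U" for l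
  proof -
    have "norm (?R l o\<^sub>L D l) \<le> K * e"
      using norm_cut_res[of "G l" "H l" m0 m1] K1[OF l] K2[OF l] e
      by (intro order_trans[OF norm_blinfun_compose] mult_mono) (auto simp: K_def D_def d_le[OF l] intro!: norm_mulop)
    also have "\<dots> < 1" using K unfolding e_def by simp
    finally show ?thesis .
  qed
  have "\<forall>l\<in>U. \<exists>W. W o\<^sub>L (id_blinfun - (?R l o\<^sub>L D l)) = id_blinfun \<and> (id_blinfun - (?R l o\<^sub>L D l)) o\<^sub>L W = id_blinfun"
    using neumann_bij[OF small] by blast
  then obtain W where W: "\<And>l. l \<in> U \<Longrightarrow> W l o\<^sub>L (id_blinfun - (?R l o\<^sub>L D l)) = id_blinfun"
    "\<And>l. l \<in> U \<Longrightarrow> (id_blinfun - (?R l o\<^sub>L D l)) o\<^sub>L W l = id_blinfun"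
    by metis
  have contW: "continuous_on U W"
    by (rule continuous_on_blinfun_inverse[OF _ W]) (auto intro!: continuous_intros contR contD)
  have "\<exists>R N C. continuous_on U R \<and> continuous_on U N \<and> continuous_on U C \<and>
    (\<forall>l\<in>U. cut_solution (\<lambda>n. a n l) (cut_proj (G l) (H l) m0 m1) m1 m1 (R l) (N l) (C l))"
  proof (rule ex_cut_solution_family[OF cont m])
    fix l assume l: "l \<in> U"
    show "cut_solution (\<lambda>n. a n l) (cut_proj (G l) (H l) m0 m1) m0 m1 (W l o\<^sub>L ?R l)
        (W l o\<^sub>L cut_hom (G l) (H l) m0 m1) (cut_data (G l) (H l) m0 m1)"
    proof (rule cut_solution_perturb[OF cut_solution_const[OF G[OF l] H[OF l] m] _ W[OF l]])
      show "seq (D l x) n = a n l (seq x n) - (if n < m0 then B l else A l) (seq x n)"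
        if "n < m0 \<or> m1 < n" for x n
        using that m unfolding D_def seq_mulop[OF d_le[OF l]] by (auto simp: d_def blinfun.diff_left)
    qed
  qed (auto intro!: continuous_intros contR contW contG contH
        simp: cut_hom_def cut_data_def stable_proj_def)
  then show ?thesis by blast
qed

section \<open>Right inverses of surjective families\<close>

lemma blinfun_injective_imp_inverse:
  fixes f :: "'v::euclidean_space \<Rightarrow>\<^sub>L 'v"
  assumes "\<And>x. f x = 0 \<Longrightarrow> x = 0"
  shows "\<exists>g. g o\<^sub>L f = id_blinfun \<and> f o\<^sub>L g = id_blinfun"
proof -
  have l: "linear (blinfun_apply f)" by (rule linear_blinfun_apply)
  then have "inj (blinfun_apply f)" using assms linear_injective_0 by blast
  then obtain g where g: "linear g" "\<forall>x. g (f x) = x" "\<forall>x. f (g x) = x"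
    using linear_injective_isomorphism[OF l] by blast
  then have "blinfun_apply (Blinfun g) = g"
    by (simp add: bounded_linear_Blinfun_apply linear_conv_bounded_linear)
  then show ?thesis using g by (intro exI[of _ "Blinfun g"]) (auto intro!: blinfun_eqI)
qed

text \<open>The Gram operator of the columns \<open>D t\<close> is positive definite because they span.\<close>

lemma ex_right_inverse_family:
  fixes D :: "'p::metric_space \<Rightarrow> ('y::real_normed_vector \<Rightarrow>\<^sub>L 'v::euclidean_space)"
  assumes D: "continuous_on U D" and T: "finite T"
    and surj: "\<And>l w. l \<in> U \<Longrightarrow> \<exists>t\<in>span T. D l t = w"
  shows "\<exists>\<rho>. continuous_on U \<rho> \<and>
    (\<forall>l\<in>U. \<forall>w. D l (blinfun_apply (\<rho> l) w) = w \<and> blinfun_apply (\<rho> l) w \<in> span T)"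
proof -
  define S where "S = (\<lambda>l. \<Sum>t\<in>T. blinfun_scaleR_left (D l t) o\<^sub>L blinfun_inner_right (D l t))"
  have S_apply: "S l u = (\<Sum>t\<in>T. (D l t \<bullet> u) *\<^sub>R D l t)" for l u
    by (simp add: S_def blinfun.sum_left)
  have contS: "continuous_on U S"
    unfolding S_def by (intro continuous_intros D)
  have "\<exists>g. g o\<^sub>L S l = id_blinfun \<and> S l o\<^sub>L g = id_blinfun" if l: "l \<in> U" for l
  proof (rule blinfun_injective_imp_inverse)
    fix u assume z: "S l u = 0"
    have "(\<Sum>t\<in>T. (D l t \<bullet> u)\<^sup>2) = 0"
      using arg_cong[OF z, of "\<lambda>x. x \<bullet> u"]
      by (simp add: S_apply inner_sum_left power2_eq_square)
    then have *: "\<forall>t\<in>T. D l t \<bullet> u = 0"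
      using sum_nonneg_eq_0_iff[OF T, of "\<lambda>t. (D l t \<bullet> u)\<^sup>2"] by simp
    have "D l t \<bullet> u = 0" if "t \<in> span T" for t
      using that
      by (induction rule: span_induct_alt)
         (use * in \<open>auto simp: blinfun.add_right blinfun.scaleR_right blinfun.zero_right inner_add_left\<close>)
    then show "u = 0" using surj[OF l, of u] by (metis inner_eq_zero_iff)
  qed
  then obtain g where g: "\<And>l. l \<in> U \<Longrightarrow> g l o\<^sub>L S l = id_blinfun" "\<And>l. l \<in> U \<Longrightarrow> S l o\<^sub>L g l = id_blinfun"
    by metis
  have contg: "continuous_on U g" using continuous_on_blinfun_inverse[OF contS g] by blast
  \<comment> \<open>The usual right inverse: the adjoint followed after the inverse Gram operator,
    with coordinates along \<open>T\<close> in place of an inner product on the domain.\<close>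
  define \<rho> where "\<rho> = (\<lambda>l. (\<Sum>t\<in>T. blinfun_scaleR_left t o\<^sub>L blinfun_inner_right (D l t)) o\<^sub>L g l)"
  have \<rho>: "\<rho> l w = (\<Sum>t\<in>T. (D l t \<bullet> g l w) *\<^sub>R t)" for l w
    by (simp add: \<rho>_def blinfun.sum_left)
  have "D l (\<rho> l w) = w" if "l \<in> U" for l w
  proof -
    have "D l (\<rho> l w) = S l (g l w)"
      by (simp add: \<rho> S_apply blinfun.sum_right blinfun.scaleR_right)
    then show ?thesis using bij_imp_mutual_inverse(2)[OF g[OF that]] by simp
  qed
  moreover have "\<rho> l w \<in> span T" for l w
    unfolding \<rho> by (intro span_sum span_scale span_base)
  moreover have "continuous_on U \<rho>"
    unfolding \<rho>_def by (intro continuous_intros D contg)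
  ultimately show ?thesis by blast
qed

section \<open>Continuity of sections and vector bundles\<close>

lemma l2_eq_range_seq: "l2 = range seq"
  using type_definition.Rep_range[OF type_definition_ell2] unfolding l2_def by (rule sym)

lemma l2norm_seq: "l2norm (seq x) = norm x"
  by (simp add: l2norm_def norm_ell2_def)

lemma seq_plus_fun: "seq (x + y) = seq x + seq y"
  and seq_minus_fun: "seq (x - y) = seq x - seq y"
  and seq_scaleR_fun: "seq (r *\<^sub>R x) = r *\<^sub>R seq x"
  and seq_zero_fun: "seq 0 = 0"
  by (simp_all add: fun_eq_iff scaleR_fun_def)

lemma linear_seq: "linear seq"
  by (rule linearI) (simp_all add: seq_plus_fun seq_scaleR_fun)

lemma cont_nm_norm: "cont_nm norm U s \<longleftrightarrow> continuous_on U s"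
  by (simp add: cont_nm_def continuous_on_iff dist_norm)

lemma cont_nm_seq: "cont_nm l2norm U (\<lambda>l. seq (s l)) \<longleftrightarrow> continuous_on U s"
  by (simp add: cont_nm_def continuous_on_iff dist_norm l2norm_seq flip: seq_minus_fun)

lemma l2norm_nonneg: "0 \<le> l2norm x"
  by (simp add: l2norm_def infsum_nonneg)

lemma prod_nm_nonneg: "(\<And>x. 0 \<le> n1 x) \<Longrightarrow> (\<And>y. 0 \<le> n2 y) \<Longrightarrow> 0 \<le> prod_nm n1 n2 z"
  by (simp add: prod_nm_def case_prod_unfold)

lemma cont_nm_prod:
  assumes n1: "\<And>x. 0 \<le> n1 x" and n2: "\<And>y. 0 \<le> n2 y"
  shows "cont_nm (prod_nm n1 n2) U s \<longleftrightarrow> cont_nm n1 U (\<lambda>l. fst (s l)) \<and> cont_nm n2 U (\<lambda>l. snd (s l))"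
proof -
  have p: "prod_nm n1 n2 (s m - s l) = n1 (fst (s m) - fst (s l)) + n2 (snd (s m) - snd (s l))" for m l
    by (simp add: prod_nm_def case_prod_unfold)
  have le: "n1 (fst (s m) - fst (s l)) \<le> prod_nm n1 n2 (s m - s l)"
    "n2 (snd (s m) - snd (s l)) \<le> prod_nm n1 n2 (s m - s l)" for m l
    unfolding p using n1 n2 by simp_all
  show ?thesis
  proof (intro iffI conjI)
    assume c: "cont_nm (prod_nm n1 n2) U s"
    show "cont_nm n1 U (\<lambda>l. fst (s l))" "cont_nm n2 U (\<lambda>l. snd (s l))"
      using c unfolding cont_nm_def by (meson le le_less_trans)+
  next
    assume c: "cont_nm n1 U (\<lambda>l. fst (s l)) \<and> cont_nm n2 U (\<lambda>l. snd (s l))"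
    show "cont_nm (prod_nm n1 n2) U s"
      unfolding cont_nm_def p
    proof (intro ballI allI impI)
      fix l and e :: real assume "l \<in> U" "0 < e"
      then obtain d1 d2 where d: "d1 > 0" "d2 > 0"
        "\<forall>m\<in>U. dist m l < d1 \<longrightarrow> n1 (fst (s m) - fst (s l)) < e / 2"
        "\<forall>m\<in>U. dist m l < d2 \<longrightarrow> n2 (snd (s m) - snd (s l)) < e / 2"
        using c[THEN conjunct1, unfolded cont_nm_def, rule_format, of l "e / 2"]
          c[THEN conjunct2, unfolded cont_nm_def, rule_format, of l "e / 2"] by auto
      have "n1 (fst (s m) - fst (s l)) + n2 (snd (s m) - snd (s l)) < e"
        if "m \<in> U" "dist m l < min d1 d2" for m
        using d(3,4) that by force
      then show "\<exists>d>0. \<forall>m\<in>U. dist m l < d \<longrightarrow> n1 (fst (s m) - fst (s l)) + n2 (snd (s m) - snd (s l)) < e"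
        using d(1,2) by (intro exI[of _ "min d1 d2"]) auto
    qed
  qed
qed

lemma continuous_on_Pair_iff:
  "continuous_on U z \<longleftrightarrow> continuous_on U (\<lambda>l. fst (z l)) \<and> continuous_on U (\<lambda>l. snd (z l))"
  using continuous_on_Pair[of U "\<lambda>l. fst (z l)" "\<lambda>l. snd (z l)"]
    continuous_on_fst[of U z] continuous_on_snd[of U z] by auto

text \<open>Projections at distance below 1 are injective on each other's ranges, so these have
  equal dimension, and the images of a basis at l0 form a continuous frame nearby.
  \<open>\<pi> l\<close> has to project only within \<open>span T\<close>, and
  \<open>\<Psi> l\<close> carries the model fibres into l2.\<close>

lemma is_bundle_projection_family:
  fixes \<pi> :: "complex \<Rightarrow> ('z::real_normed_vector \<Rightarrow>\<^sub>L 'z)" and \<Psi> :: "complex \<Rightarrow> ('z \<Rightarrow>\<^sub>L (real^'d) ell2)"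
  assumes T: "finite T" and contp: "continuous_on Lam \<pi>" and contP: "continuous_on Lam \<Psi>"
    and F: "\<And>l. l \<in> Lam \<Longrightarrow> subspace (F l)" "\<And>l. l \<in> Lam \<Longrightarrow> F l \<subseteq> span T"
    and p: "\<And>l z. l \<in> Lam \<Longrightarrow> z \<in> span T \<Longrightarrow> \<pi> l z \<in> F l" "\<And>l z. l \<in> Lam \<Longrightarrow> z \<in> F l \<Longrightarrow> \<pi> l z = z"
    and inj: "\<And>l. l \<in> Lam \<Longrightarrow> inj_on (\<Psi> l) (F l)"
    and E: "\<And>l. l \<in> Lam \<Longrightarrow> E l = (\<lambda>z. seq (\<Psi> l z)) ` F l"
  shows "is_bundle l2 l2norm Lam E"
  unfolding is_bundle_def
proof (intro conjI ballI)
  have lin: "linear (\<lambda>z. seq (\<Psi> l (\<pi> m z)))" for l m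
    by (intro linear_compose[OF _ linear_seq, unfolded o_def]
        linear_compose[OF linear_blinfun_apply linear_blinfun_apply, unfolded o_def])
  have linP: "linear (\<lambda>z. seq (\<Psi> l z))" for l
    by (intro linear_compose[OF _ linear_seq, unfolded o_def] linear_blinfun_apply)
  fix l0 assume l0: "l0 \<in> Lam"
  show "subspace (E l0)" unfolding E[OF l0] by (intro linear_subspace_image linP F l0)
  show "E l0 \<subseteq> l2" unfolding E[OF l0] l2_eq_range_seq by auto
  obtain B where B: "B \<subseteq> F l0" "independent B" "F l0 \<subseteq> span B"
    using maximal_independent_subset by metis
  have spanB: "span B = F l0" using B span_minimal[OF B(1) F(1)[OF l0]] by auto
  have finB: "finite B" using independent_span_bound[OF T B(2)] B(1) F(2)[OF l0] by auto
  then obtain f where f: "bij_betw f {..<card B} B"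
    using ex_bij_betw_nat_finite lessThan_atLeast0 by metis
  define U where "U = Lam \<inter> (\<lambda>l. norm (\<pi> l - \<pi> l0)) -` {..<1}"
  have "continuous_on Lam (\<lambda>l. norm (\<pi> l - \<pi> l0))" by (intro continuous_intros contp)
  then have Uopen: "openin (top_of_set Lam) U"
    unfolding U_def by (rule continuous_openin_preimage_gen) simp
  have l0U: "l0 \<in> U" using l0 by (simp add: U_def)
  \<comment> \<open>A vector fixed by one projection and killed by the other is sent by their
    difference to a vector of the same norm, which on \<open>U\<close> forces it to be 0.\<close>
  have cancel: "z = 0" if "l \<in> U" "norm (\<pi> l z - \<pi> l0 z) = norm z" for l z
  proof (rule ccontr)
    assume "z \<noteq> 0"
    have "norm (\<pi> l z - \<pi> l0 z) \<le> norm (\<pi> l - \<pi> l0) * norm z"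
      using norm_blinfun[of "\<pi> l - \<pi> l0" z] by (simp add: blinfun.diff_left)
    also have "\<dots> < 1 * norm z"
      using that(1) \<open>z \<noteq> 0\<close> unfolding U_def by (intro mult_strict_right_mono) auto
    finally show False using that(2) by simp
  qed
  have inj0: "inj_on (\<pi> l) (F l0)" and injl: "inj_on (\<pi> l0) (F l)" if l: "l \<in> U" for l
  proof -
    have lL: "l \<in> Lam" using l by (simp add: U_def)
    show "inj_on (\<pi> l) (F l0)"
    proof (rule inj_onI)
      fix x y assume "x \<in> F l0" "y \<in> F l0" "\<pi> l x = \<pi> l y"
      then have "\<pi> l (x - y) = 0" "\<pi> l0 (x - y) = x - y"
        using p(2)[OF l0] subspace_diff[OF F(1)[OF l0]] by (auto simp: blinfun.diff_right)
      then show "x = y" using cancel[OF l, of "x - y"] by (simp add: norm_minus_commute)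
    qed
    show "inj_on (\<pi> l0) (F l)"
    proof (rule inj_onI)
      fix x y assume "x \<in> F l" "y \<in> F l" "\<pi> l0 x = \<pi> l0 y"
      then have "\<pi> l0 (x - y) = 0" "\<pi> l (x - y) = x - y"
        using p(2)[OF lL] subspace_diff[OF F(1)[OF lL]] by (auto simp: blinfun.diff_right)
      then show "x = y" using cancel[OF l, of "x - y"] by simp
    qed
  qed
  let ?s = "\<lambda>i l. seq (\<Psi> l (\<pi> l (f i)))"
  have UL: "U \<subseteq> Lam" by (simp add: U_def)
  have sec: "cont_nm l2norm U (?s i)" for i
    unfolding cont_nm_seq
    by (intro continuous_intros continuous_on_subset[OF contp UL] continuous_on_subset[OF contP UL])
  have frame: "\<forall>l\<in>U. inj_on (\<lambda>i. ?s i l) {..<card B} \<and> independent ((\<lambda>i. ?s i l) ` {..<card B}) \<and>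
        span ((\<lambda>i. ?s i l) ` {..<card B}) = E l"
  proof (intro conjI ballI)
    fix l assume l: "l \<in> U"
    then have lL: "l \<in> Lam" by (simp add: U_def)
    let ?\<chi> = "\<lambda>z. seq (\<Psi> l (\<pi> l z))"
    have F0l: "\<pi> l z \<in> F l" if "z \<in> F l0" for z
      using p(1)[OF lL] F(2)[OF l0] that by blast
    have injc: "inj_on ?\<chi> (F l0)"
    proof (rule inj_onI)
      fix x y assume xy: "x \<in> F l0" "y \<in> F l0" "?\<chi> x = ?\<chi> y"
      then have "\<Psi> l (\<pi> l x) = \<Psi> l (\<pi> l y)" by (simp add: seq_inject)
      then have "\<pi> l x = \<pi> l y"
        using inj_onD[OF inj[OF lL], of "\<pi> l x" "\<pi> l y"] F0l xy(1,2) by blast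
      then show "x = y" using inj_onD[OF inj0[OF l]] xy(1,2) by blast
    qed
    have im: "(\<lambda>i. ?\<chi> (f i)) ` {..<card B} = ?\<chi> ` B"
      using f image_image[of ?\<chi> f "{..<card B}"] by (simp add: bij_betw_def)
    show "inj_on (\<lambda>i. ?\<chi> (f i)) {..<card B}"
      using comp_inj_on[of f "{..<card B}" ?\<chi>] f injc B(1) inj_on_subset
      unfolding bij_betw_def o_def by blast
    show "independent ((\<lambda>i. ?\<chi> (f i)) ` {..<card B})"
      unfolding im using injc by (intro linear_independent_injective_image lin B(2)) (simp add: spanB)
    \<comment> \<open>Dimension count: a further vector of F l would yield, through the injective
      \<open>\<pi> l0\<close>, card B + 1 independent vectors in the span of B.\<close>
    have "F l \<subseteq> span (\<pi> l ` B)"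
    proof (rule ccontr)
      assume "\<not> ?thesis"
      then obtain y where y: "y \<in> F l" "y \<notin> span (\<pi> l ` B)" by blast
      have "independent (\<pi> l ` B)"
        using inj0[OF l] by (intro linear_independent_injective_image linear_blinfun_apply B(2)) (simp add: spanB)
      then have ind: "independent (insert y (\<pi> l ` B))" using y(2) by (simp add: independent_insertI)
      have sub: "insert y (\<pi> l ` B) \<subseteq> F l" using y(1) B(1) F0l by auto
      then have inj': "inj_on (\<pi> l0) (span (insert y (\<pi> l ` B)))"
        using injl[OF l] span_minimal[OF sub F(1)[OF lL]] inj_on_subset by blast
      have "independent (\<pi> l0 ` insert y (\<pi> l ` B))"
        using inj' by (intro linear_independent_injective_image linear_blinfun_apply ind)
      moreover have "\<pi> l0 ` insert y (\<pi> l ` B) \<subseteq> span B"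
        using sub p(1)[OF l0] F(2)[OF lL] unfolding spanB by blast
      ultimately have "card (\<pi> l0 ` insert y (\<pi> l ` B)) \<le> card B"
        using independent_span_bound[OF finB] by blast
      also have "card (\<pi> l0 ` insert y (\<pi> l ` B)) = card (insert y (\<pi> l ` B))"
        by (rule card_image[OF inj_on_subset[OF inj' span_superset]])
      also have "\<dots> = Suc (card B)"
        using y(2) span_base[of y "\<pi> l ` B"] finB card_image[OF inj_on_subset[OF inj0[OF l] B(1)]]
        by (subst card_insert_disjoint) auto
      finally show False by simp
    qed
    moreover have "span (\<pi> l ` B) = \<pi> l ` F l0"
      using linear_span_image[OF linear_blinfun_apply, of "\<pi> l" B] spanB by simp
    ultimately have "F l = \<pi> l ` F l0" using F0l by blast
    then show "span ((\<lambda>i. ?\<chi> (f i)) ` {..<card B}) = E l"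
      unfolding im linear_span_image[OF lin] spanB E[OF lL] by (simp add: image_image)
  qed
  show "\<exists>U (k::nat) s. openin (top_of_set Lam) U \<and> l0 \<in> U \<and> (\<forall>i<k. cont_nm l2norm U (s i)) \<and>
      (\<forall>l\<in>U. inj_on (\<lambda>i. s i l) {..<k} \<and> independent ((\<lambda>i. s i l) ` {..<k}) \<and>
        span ((\<lambda>i. s i l) ` {..<k}) = E l)"
    by (intro exI[of _ U] exI[of _ "card B"] exI[of _ ?s] conjI Uopen l0U allI impI sec frame)
qed

lemma cont_nm_blinfun_apply:
  fixes Th :: "complex \<Rightarrow> ('u::real_normed_vector \<Rightarrow>\<^sub>L 'v::real_normed_vector)"
  assumes c: "continuous_on Lam Th" and U: "openin (top_of_set Lam) U"
    and s: "\<And>l. l \<in> U \<Longrightarrow> s l \<in> range J" "cont_nm nm U s"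
    and K: "\<And>z. K (J z) = z" and J: "\<And>U z. cont_nm nm U (\<lambda>l. J (z l)) \<longleftrightarrow> continuous_on U z"
    and J': "\<And>U z. cont_nm nm' U (\<lambda>l. J' (z l)) \<longleftrightarrow> continuous_on U z"
  shows "cont_nm nm' U (\<lambda>l. J' (Th l (K (s l))))"
proof -
  have "s l = J (K (s l))" if "l \<in> U" for l using s(1)[OF that] K by auto
  then have "cont_nm nm U (\<lambda>l. J (K (s l)))" using s(2) unfolding cont_nm_def by simp
  then have "continuous_on U (\<lambda>l. K (s l))" using J by blast
  then show ?thesis
    unfolding J' using continuous_on_subset[OF c] openin_imp_subset[OF U] by (intro continuous_intros) auto
qed

text \<open>\<open>E'\<close> and \<open>F'\<close> are fibres in normed types. \<open>J1\<close>
  and \<open>J2\<close> embed them into the functions of the statement and turn norm continuity into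
  \<open>cont_nm\<close>, so norm continuous families of operators map continuous local sections to
  continuous ones.\<close>

lemma bundle_iso_of_blinfuns:
  fixes \<Phi> :: "complex \<Rightarrow> ('x::real_normed_vector \<Rightarrow>\<^sub>L 'y::real_normed_vector)" and \<Psi> :: "complex \<Rightarrow> ('y \<Rightarrow>\<^sub>L 'x)"
  assumes J1: "linear J1" "\<And>z. K1 (J1 z) = z" "\<And>U z. cont_nm nm1 U (\<lambda>l. J1 (z l)) \<longleftrightarrow> continuous_on U z"
    and J2: "linear J2" "\<And>z. K2 (J2 z) = z" "\<And>U z. cont_nm nm2 U (\<lambda>l. J2 (z l)) \<longleftrightarrow> continuous_on U z"
    and cont: "continuous_on Lam \<Phi>" "continuous_on Lam \<Psi>"
    and E: "\<And>l. l \<in> Lam \<Longrightarrow> E l = J1 ` E' l" and F: "\<And>l. l \<in> Lam \<Longrightarrow> F l = J2 ` F' l"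
    and P1: "\<And>l z. l \<in> Lam \<Longrightarrow> z \<in> E' l \<Longrightarrow> \<Phi> l z \<in> F' l \<and> \<Psi> l (\<Phi> l z) = z"
    and P2: "\<And>l z. l \<in> Lam \<Longrightarrow> z \<in> F' l \<Longrightarrow> \<Psi> l z \<in> E' l \<and> \<Phi> l (\<Psi> l z) = z"
  shows "bundle_iso nm1 nm2 Lam E F"
proof -
  interpret J1: linear J1 by fact
  interpret J2: linear J2 by fact
  show ?thesis
    unfolding bundle_iso_def
  proof (intro exI[of _ "\<lambda>l x. J2 (\<Phi> l (K1 x))"] exI[of _ "\<lambda>l y. J1 (\<Psi> l (K2 y))"] conjI ballI allI impI)
    fix l assume l: "l \<in> Lam"
    fix x y and c :: real assume xy: "x \<in> E l" "y \<in> E l"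
    then obtain x' y' where x': "x = J1 x'" "y = J1 y'" unfolding E[OF l] by blast
    show "J2 (\<Phi> l (K1 (x + y))) = J2 (\<Phi> l (K1 x)) + J2 (\<Phi> l (K1 y))"
      unfolding x' J1.add[symmetric] J1(2) by (simp add: blinfun.add_right J2.add)
    show "J2 (\<Phi> l (K1 (c *\<^sub>R x))) = c *\<^sub>R J2 (\<Phi> l (K1 x))"
      unfolding x' J1.scale[symmetric] J1(2) by (simp add: blinfun.scaleR_right J2.scale)
  next
    fix l assume l: "l \<in> Lam"
    show "(\<lambda>x. J2 (\<Phi> l (K1 x))) ` E l \<subseteq> F l" "(\<lambda>y. J1 (\<Psi> l (K2 y))) ` F l \<subseteq> E l"
      unfolding E[OF l] F[OF l] using P1[OF l] P2[OF l] by (auto simp: J1 J2)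
  next
    fix l x assume "l \<in> Lam" "x \<in> E l"
    then show "J1 (\<Psi> l (K2 (J2 (\<Phi> l (K1 x))))) = x" using P1 E by (auto simp: J1(2) J2(2))
  next
    fix l x assume "l \<in> Lam" "x \<in> F l"
    then show "J2 (\<Phi> l (K1 (J1 (\<Psi> l (K2 x))))) = x" using P2 F by (auto simp: J1(2) J2(2))
  next
    fix U s assume U: "openin (top_of_set Lam) U \<and> (\<forall>l\<in>U. s l \<in> E l) \<and> cont_nm nm1 U s"
    then have "s l \<in> range J1" if "l \<in> U" for l
      using E openin_imp_subset that by fastforce
    then show "cont_nm nm2 U (\<lambda>l. J2 (\<Phi> l (K1 (s l))))"
      using U by (intro cont_nm_blinfun_apply[OF cont(1) _ _ _ J1(2,3) J2(3)]) auto
  next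
    fix U s assume U: "openin (top_of_set Lam) U \<and> (\<forall>l\<in>U. s l \<in> F l) \<and> cont_nm nm2 U s"
    then have "s l \<in> range J2" if "l \<in> U" for l
      using F openin_imp_subset that by fastforce
    then show "cont_nm nm1 U (\<lambda>l. J1 (\<Psi> l (K2 (s l))))"
      using U by (intro cont_nm_blinfun_apply[OF cont(2) _ _ _ J2(2,3) J1(3)]) auto
  qed
qed

section \<open>Reduction to a family of finite matrices\<close>

locale cut_system =
  fixes a :: "int \<Rightarrow> complex \<Rightarrow> ('v::euclidean_space \<Rightarrow>\<^sub>L 'v)" and U :: "complex set" and m :: int
    and E :: "complex \<Rightarrow> ('e::euclidean_space \<Rightarrow>\<^sub>L 'e)"
    and R :: "complex \<Rightarrow> ('v ell2 \<Rightarrow>\<^sub>L 'v ell2)" and N :: "complex \<Rightarrow> ('e \<Rightarrow>\<^sub>L 'v ell2)"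
    and C :: "complex \<Rightarrow> ('v ell2 \<Rightarrow>\<^sub>L 'e)"
  assumes bdd: "\<And>l. l \<in> U \<Longrightarrow> \<exists>K. \<forall>n. norm (a n l) \<le> K"
    and cont_mulop: "continuous_on U (\<lambda>l. mulop (\<lambda>n. a n l))"
    and cont_a: "continuous_on U (a m)" and cont_E: "continuous_on U E"
    and cont_R: "continuous_on U R" and cont_N: "continuous_on U N" and cont_C: "continuous_on U C"
    and sol: "\<And>l. l \<in> U \<Longrightarrow> cut_solution (\<lambda>n. a n l) (E l) m m (R l) (N l) (C l)"
begin

definition Lb :: "complex \<Rightarrow> 'v ell2 \<Rightarrow>\<^sub>L 'v ell2"
  where "Lb l = translate 1 - mulop (\<lambda>n. a n l)"

definition Nr :: "complex \<Rightarrow> ('e \<times> 'v ell2) \<Rightarrow>\<^sub>L 'v ell2"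
  where "Nr l = (N l o\<^sub>L fst_blinfun) + (R l o\<^sub>L snd_blinfun)"

text \<open>\<open>D l\<close> measures the failure of \<open>Nr l (e, v)\<close> to solve \<open>L x = v\<close> at the one index \<open>m\<close>.\<close>

definition D :: "complex \<Rightarrow> ('e \<times> 'v ell2) \<Rightarrow>\<^sub>L 'v"
  where "D l = ((ev (m + 1) - (a m l o\<^sub>L ev m)) o\<^sub>L Nr l) - (ev m o\<^sub>L snd_blinfun)"

lemma cont_Lb: "continuous_on U Lb"
  unfolding Lb_def by (intro continuous_intros cont_mulop)

lemma cont_Nr: "continuous_on U Nr"
  unfolding Nr_def by (intro continuous_intros cont_N cont_R)

lemma cont_D: "continuous_on U D"
  unfolding D_def by (intro continuous_intros cont_Nr cont_a)

lemma Nr_apply: "Nr l (e, v) = N l e + R l v"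
  by (simp add: Nr_def blinfun.add_left)

lemma D_apply: "D l t = seq (Nr l t) (m + 1) - a m l (seq (Nr l t) m) - seq (snd t) m"
  by (simp add: D_def blinfun.diff_left)

lemma D_add: "D l (e, v) = D l (e, 0) + D l (0, v)"
  using blinfun.add_right[of "D l" "(e, 0)" "(0, v)"] by simp

context
  fixes l assumes l: "l \<in> U"
begin

lemma seq_Lb: "seq (Lb l x) n = seq x (n + 1) - a n l (seq x n)"
proof -
  obtain K where K: "\<And>n. norm (a n l) \<le> K" using bdd[OF l] by blast
  show ?thesis
    using seq_mulop[of "\<lambda>n. a n l" K x n, OF K] by (simp add: Lb_def blinfun.diff_left)
qed

lemma Lb_Nr: "Lb l (Nr l t) = snd t + delta m (D l t)"
proof (rule seq_inject_ext)
  fix n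
  obtain e v where t: "t = (e, v)" by (cases t)
  show "seq (Lb l (Nr l t)) n = seq (snd t + delta m (D l t)) n"
  proof (cases "n = m")
    case True
    then show ?thesis by (simp add: seq_Lb D_apply)
  next
    case False
    then have n: "n < m \<or> m < n" by auto
    show ?thesis
      using False cut_solutionD(3)[OF sol[OF l] n, of v] cut_solutionD(4)[OF sol[OF l] n, of e]
      by (simp add: seq_Lb t Nr_apply blinfun.add_right)
  qed
qed

text \<open>The cut system imposes nothing at m, so x solves it with source y whatever the defect w
  is.\<close>

lemma Lb_eq_imp:
  assumes "Lb l x = y + delta m w"
  shows "x = Nr l (C l x, y)"
proof -
  have "x = R l y + N l (C l x)"
  proof (rule cut_solutionD(5)[OF sol[OF l]])
    show "seq x (n + 1) = a n l (seq x n) + seq y n" if "n < m \<or> m < n" for n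
      using arg_cong[OF assms, of "\<lambda>x. seq x n"] that by (auto simp: seq_Lb algebra_simps)
  qed auto
  then show ?thesis unfolding Nr_apply by (simp only: add.commute)
qed

lemma C_Nr: "C l (Nr l t) = E l (fst t)"
  using cut_solutionD(6,7)[OF sol[OF l]] by (cases t) (simp add: Nr_apply blinfun.add_right)

lemma E_C: "E l (C l x) = C l x"
  by (rule cut_solutionD(8)[OF sol[OF l]])

lemma E_idem: "E l (E l e) = E l e"
  using E_C[of "Nr l (e, 0)"] by (simp add: C_Nr)

lemma Nr_E: "Nr l (E l e, v) = Nr l (e, v)"
proof -
  have "Lb l (Nr l (e, v)) = v + delta m (D l (e, v))" by (simp add: Lb_Nr)
  from Lb_eq_imp[OF this] show ?thesis by (simp add: C_Nr)
qed

lemma D_E: "D l (E l e, v) = D l (e, v)"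
  unfolding D_apply Nr_E by simp

lemma solution_parameters:
  assumes "Lb l x = v"
  shows "x = Nr l (C l x, v)" "D l (C l x, v) = 0"
proof -
  have "Lb l x = v + delta m 0" using assms by (simp add: blinfun.zero_right)
  then show x: "x = Nr l (C l x, v)" by (rule Lb_eq_imp)
  have "delta m (D l (C l x, v)) = 0" using Lb_Nr[of "(C l x, v)"] x assms by simp
  from arg_cong[OF this, of "\<lambda>x. seq x m"] show "D l (C l x, v) = 0" by simp
qed

text \<open>By \<open>range_Lb\<close> a source y is attained iff its defect D l (0, y) can be
  cancelled by the free parameters. So this subspace of \<open>'v\<close> determines the codimension
  of the range.\<close>

definition I :: "'v set" where "I = (\<lambda>e. D l (e, 0)) ` range (E l)"

lemma linear_D_Pair: "linear (\<lambda>e. D l (e, 0))" "linear (\<lambda>v. D l (0, v))"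
  by (rule linearI; simp flip: blinfun.add_right blinfun.scaleR_right)+

lemma subspace_range_E: "subspace (range (E l))"
  by (intro linear_subspace_image linear_blinfun_apply subspace_UNIV)

lemma subspace_I: "subspace I"
  unfolding I_def by (intro linear_subspace_image linear_D_Pair subspace_range_E)

lemma D_fst_in_I: "D l (e, 0) \<in> I"
  unfolding I_def using D_E[of e 0] by (metis image_eqI rangeI)

lemma range_Lb: "y \<in> range (Lb l) \<longleftrightarrow> D l (0, y) \<in> I"
proof
  assume "y \<in> range (Lb l)"
  then obtain x where "Lb l x = y" by blast
  then have "D l (C l x, y) = 0" by (rule solution_parameters)
  then have "D l (0, y) = - D l (C l x, 0)" using D_add[of l "C l x" y] by (simp add: eq_neg_iff_add_eq_0 add.commute)
  then show "D l (0, y) \<in> I" using subspace_neg[OF subspace_I D_fst_in_I] by simp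
next
  assume "D l (0, y) \<in> I"
  then obtain e where e: "D l (0, y) = D l (e, 0)" unfolding I_def by blast
  have "D l (- e, y) = 0"
    using e D_add[of l "- e" y] blinfun.minus_right[of "D l" "(e, 0)"] by simp
  then have "Lb l (Nr l (- e, y)) = y" by (simp add: Lb_Nr blinfun.zero_right)
  then show "y \<in> range (Lb l)" by (metis rangeI)
qed

text \<open>A subspace of the Euclidean space \<open>'v\<close> is closed, and the range is its
  preimage under a continuous map.\<close>

lemma closed_range_Lb: "closed (range (Lb l))"
proof -
  have "range (Lb l) = (\<lambda>y. D l (0, y)) -` I" using range_Lb by blast
  moreover have "closed ((\<lambda>y. D l (0, y)) -` I)"
    by (intro closed_vimage closed_subspace subspace_I continuous_intros)
  ultimately show ?thesis by simp
qed

lemma kernel_Lb: "{x. Lb l x = 0} = (\<lambda>e. Nr l (e, 0)) ` {e \<in> range (E l). D l (e, 0) = 0}"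
proof safe
  fix x assume x: "Lb l x = 0"
  have "C l x \<in> range (E l)" by (metis E_C rangeI)
  then show "x \<in> (\<lambda>e. Nr l (e, 0)) ` {e \<in> range (E l). D l (e, 0) = 0}"
    using solution_parameters[OF x] by blast
qed (simp add: Lb_Nr blinfun.zero_right)

lemma inj_Nr_Pair: "inj_on (\<lambda>e. Nr l (e, 0)) (range (E l))"
proof (rule inj_onI)
  fix e e' assume e: "e \<in> range (E l)" "e' \<in> range (E l)" "Nr l (e, 0) = Nr l (e', 0)"
  then have "E l e = e" "E l e' = e'" using E_idem by blast+
  then show "e = e'" using e(3) C_Nr by (metis fst_conv)
qed

text \<open>Split \<open>delta m w\<close> along the supplement. The resulting x solves the cut
  system with source - v and has defect exactly w.\<close>

lemma D_surj_of_supplement: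
  assumes "\<And>y. \<exists>x. \<exists>v\<in>V. y = Lb l x + v" "subspace V"
  shows "\<exists>e. \<exists>v\<in>V. D l (e, v) = w"
proof -
  obtain x v where v: "v \<in> V" "delta m w = Lb l x + v" using assms(1) by blast
  have Lx: "Lb l x = - v + delta m w" using v(2) by simp
  have x: "x = Nr l (C l x, - v)" using Lb_eq_imp[OF Lx] .
  have "- v + delta m (D l (C l x, - v)) = - v + delta m w"
    using Lb_Nr[of "(C l x, - v)"] Lx x by simp
  then have "delta m (D l (C l x, - v)) = delta m w" by simp
  from arg_cong[OF this, of "\<lambda>x. seq x m"] have "D l (C l x, - v) = w" by simp
  then show ?thesis using subspace_neg[OF assms(2) v(1)] by blast
qed

text \<open>Parameters cancel the component in \<open>I\<close> of the defect D l (0, y); the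
  orthogonal remainder is compensated by an impulse at m.\<close>

lemma supplement_of_orthogonal:
  "\<exists>x. \<exists>w. (\<forall>z\<in>I. orthogonal z w) \<and> y = Lb l x + delta m w"
proof -
  obtain i w where iw: "i \<in> span I" "\<And>z. z \<in> span I \<Longrightarrow> orthogonal w z" "D l (0, y) = i + w"
    using orthogonal_subspace_decomp_exists by blast
  obtain e where e: "i = D l (e, 0)" using iw(1) subspace_I unfolding I_def by (auto simp: span_eq_iff[THEN iffD2])
  have "D l (- e, y) = w"
    using e iw(3) D_add[of l "- e" y] blinfun.minus_right[of "D l" "(e, 0)"] by simp
  then have "y = Lb l (Nr l (- e, y)) + delta m (- w)"
    by (simp add: Lb_Nr blinfun.minus_right)
  moreover have "\<forall>z\<in>I. orthogonal z (- w)"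
    using iw(2)[OF span_base] by (simp add: orthogonal_def inner_commute)
  ultimately show ?thesis by blast
qed

end

end

locale cut_system_supplement = cut_system a U m E R N C
  for a :: "int \<Rightarrow> complex \<Rightarrow> ('v::euclidean_space \<Rightarrow>\<^sub>L 'v)" and U m
    and E :: "complex \<Rightarrow> ('e::euclidean_space \<Rightarrow>\<^sub>L 'e)" and R N C +
  fixes B V :: "'v ell2 set"
  assumes B: "finite B" and V: "V = span B"
    and surj: "\<And>l y. l \<in> U \<Longrightarrow> \<exists>x. \<exists>v\<in>V. y = Lb l x + v"
begin

text \<open>A finite spanning set of the product of \<open>'e\<close> and \<open>V\<close> inside an
  infinite-dimensional type, as required by \<open>ex_right_inverse_family\<close>.\<close>

definition T :: "('e \<times> 'v ell2) set" where "T = (\<lambda>b. (b, 0)) ` Basis \<union> (\<lambda>v. (0, v)) ` B"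

lemma finite_T: "finite T" unfolding T_def using B by simp

lemma span_T: "t \<in> span T \<longleftrightarrow> snd t \<in> V"
proof
  assume "t \<in> span T"
  then show "snd t \<in> V"
  proof (induction t rule: span_induct_alt)
    case (step c x y)
    have "snd x \<in> span B" using step(1) by (auto simp: T_def span_zero span_base)
    then show ?case using step(2) unfolding V by (auto intro: span_add span_scale)
  qed (simp add: V span_zero)
next
  assume s: "snd t \<in> V"
  have "(\<lambda>b. (b, 0)) ` span Basis \<subseteq> span T"
    unfolding linear_span_image[OF bounded_linear.linear[OF bounded_linear_Pair[OF bounded_linear_ident bounded_linear_zero]], symmetric]
    by (intro span_mono) (simp add: T_def)
  then have 1: "(fst t, 0) \<in> span T" by auto
  have "(\<lambda>v. (0, v)) ` span B \<subseteq> span T"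
    unfolding linear_span_image[OF bounded_linear.linear[OF bounded_linear_Pair[OF bounded_linear_zero bounded_linear_ident]], symmetric]
    by (intro span_mono) (simp add: T_def)
  then have 2: "(0, snd t) \<in> span T" using s unfolding V by auto
  have "t = (fst t, 0) + (0, snd t)" by simp
  then show "t \<in> span T" using span_add[OF 1 2] by metis
qed

definition Ep :: "complex \<Rightarrow> ('e \<times> 'v ell2) \<Rightarrow>\<^sub>L ('e \<times> 'v ell2)"
  where "Ep l = (inl_blinfun o\<^sub>L (E l o\<^sub>L fst_blinfun)) + (inr_blinfun o\<^sub>L snd_blinfun)"

lemma Ep_apply: "Ep l t = (E l (fst t), snd t)"
  by (simp add: Ep_def blinfun.add_left)

lemma cont_Ep: "continuous_on U Ep"
  unfolding Ep_def by (intro continuous_intros cont_E)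

text \<open>Model of the fibre L^{-1}(V): \<open>Nr l\<close> maps it bijectively onto that fibre,
  with inverse x to (C l x, Lb l x).\<close>

definition F :: "complex \<Rightarrow> ('e \<times> 'v ell2) set"
  where "F l = {t. E l (fst t) = fst t \<and> snd t \<in> V \<and> D l t = 0}"

lemma D_Ep: "l \<in> U \<Longrightarrow> D l (Ep l t) = D l t"
  by (cases t) (simp add: Ep_apply D_E)

lemma ex_rho:
  "\<exists>\<rho>. continuous_on U \<rho> \<and> (\<forall>l\<in>U. \<forall>w. D l (blinfun_apply (\<rho> l) w) = w \<and>
    snd (blinfun_apply (\<rho> l) w) \<in> V \<and> E l (fst (blinfun_apply (\<rho> l) w)) = fst (blinfun_apply (\<rho> l) w))"
proof -
  have "\<exists>t\<in>span T. D l t = w" if l: "l \<in> U" for l w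
  proof -
    have "\<exists>e. \<exists>v\<in>V. D l (e, v) = w"
      by (rule D_surj_of_supplement[OF l surj[OF l]]) (simp add: V)
    then obtain e v where ev: "v \<in> V" "D l (e, v) = w" by blast
    then show ?thesis using span_T[of "(e, v)"] by auto
  qed
  then obtain \<rho> where r: "continuous_on U \<rho>"
      "\<And>l w. l \<in> U \<Longrightarrow> D l (blinfun_apply (\<rho> l) w) = w \<and> blinfun_apply (\<rho> l) w \<in> span T"
    using ex_right_inverse_family[OF cont_D finite_T] by metis
  show ?thesis
  \<comment> \<open>Composing with \<open>Ep\<close> moves the values into the range of the
    projection E and leaves D unchanged, by \<open>D_E\<close>.\<close>
  proof (intro exI[of _ "\<lambda>l. Ep l o\<^sub>L \<rho> l"] conjI ballI allI)
    show "continuous_on U (\<lambda>l. Ep l o\<^sub>L \<rho> l)" by (intro continuous_intros cont_Ep r(1))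
  qed (use r(2) span_T E_idem in \<open>auto simp: Ep_apply D_E\<close>)
qed

lemma image_F: "l \<in> U \<Longrightarrow> {x. Lb l x \<in> V} = Nr l ` F l"
proof safe
  fix x assume l: "l \<in> U" and x: "Lb l x \<in> V"
  have "(C l x, Lb l x) \<in> F l" using solution_parameters(2)[OF l refl] x E_C[OF l] by (simp add: F_def)
  then show "x \<in> Nr l ` F l" using solution_parameters(1)[OF l refl] by (metis image_eqI)
next
  fix t assume l: "l \<in> U" and t: "t \<in> F l"
  then show "Lb l (Nr l t) \<in> V" by (simp add: Lb_Nr F_def blinfun.zero_right)
qed

lemma parameters_Nr: "l \<in> U \<Longrightarrow> t \<in> F l \<Longrightarrow> (C l (Nr l t), Lb l (Nr l t)) = t"
  by (simp add: C_Nr Lb_Nr F_def blinfun.zero_right)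

lemma inj_Nr: "l \<in> U \<Longrightarrow> inj_on (Nr l) (F l)"
  by (rule inj_on_inverseI[of _ "\<lambda>x. (C l x, Lb l x)"]) (rule parameters_Nr)

lemma subspace_F: "subspace (F l)"
  unfolding F_def
  by (rule subspaceI; simp add: V blinfun.add_right blinfun.scaleR_right blinfun.zero_right
      span_add span_scale span_zero)

end

section \<open>The Fredholm property and the index\<close>

lemma seq_Ell2_l2: "x \<in> l2 \<Longrightarrow> seq (Ell2 x) = x"
  by (simp add: l2_def Ell2_inverse)

locale matrix_cut_system = cut_system "\<lambda>n l. mat_op (A n l)" U m E R N C
  for A :: "int \<Rightarrow> complex \<Rightarrow> real^'d^'d" and U m
    and E :: "complex \<Rightarrow> ('e::euclidean_space \<Rightarrow>\<^sub>L 'e)" and R N C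
begin

context
  fixes l assumes l: "l \<in> U"
begin

lemma Lop_seq: "Lop A l (seq x) = seq (Lb l x)"
  by (rule ext) (simp add: Lop_def shift_def seq_Lb[OF l])

lemma range_l2_Lop: "range_l2 (Lop A l) = seq ` range (Lb l)"
  by (simp add: range_l2_def l2_eq_range_seq image_image Lop_seq)

lemma kernel_l2_Lop: "kernel_l2 (Lop A l) = seq ` {x. Lb l x = 0}"
proof -
  have "Lop A l (seq x) = 0 \<longleftrightarrow> Lb l x = 0" for x
    unfolding Lop_seq seq_zero_fun[symmetric] seq_inject by simp
  then show ?thesis unfolding kernel_l2_def l2_eq_range_seq by auto
qed

lemma preimage_l2_Lop: "{x \<in> l2. Lop A l x \<in> seq ` V} = seq ` {x. Lb l x \<in> V}"
proof -
  have "Lop A l (seq x) \<in> seq ` V \<longleftrightarrow> Lb l x \<in> V" for x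
    unfolding Lop_seq by (auto simp: seq_inject)
  then show ?thesis unfolding l2_eq_range_seq by auto
qed

lemma bounded_linear_l2_Lop: "bounded_linear_l2 (Lop A l)"
  unfolding bounded_linear_l2_def
proof (intro conjI ballI allI)
  fix x y :: "int \<Rightarrow> real^'d" and c :: real
  assume "x \<in> l2"
  then obtain x' where x: "x = seq x'" unfolding l2_eq_range_seq by blast
  show "Lop A l x \<in> l2" unfolding x Lop_seq l2_eq_range_seq by blast
  show "Lop A l (c *\<^sub>R x) = c *\<^sub>R Lop A l x"
    unfolding x Lop_seq seq_scaleR_fun[symmetric] by (simp add: blinfun.scaleR_right)
  assume "y \<in> l2"
  then obtain y' where y: "y = seq y'" unfolding l2_eq_range_seq by blast
  show "Lop A l (x + y) = Lop A l x + Lop A l y"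
    unfolding x y Lop_seq seq_plus_fun[symmetric] by (simp add: blinfun.add_right)
next
  show "\<exists>c. \<forall>x\<in>l2. l2norm (Lop A l x) \<le> c * l2norm x"
    unfolding l2_eq_range_seq using norm_blinfun[of "Lb l"] by (auto simp: Lop_seq l2norm_seq)
qed

lemma closed_l2_range: "closed_l2 (range_l2 (Lop A l))"
  unfolding closed_l2_def
proof (intro allI impI)
  fix y k
  assume *: "(\<forall>j. k j \<in> range_l2 (Lop A l)) \<and> y \<in> l2 \<and> (\<lambda>j. l2norm (k j - y)) \<longlonglongrightarrow> 0"
  then obtain y' where y: "y = seq y'" unfolding l2_eq_range_seq by blast
  have "\<forall>j. \<exists>z\<in>range (Lb l). k j = seq z" using * unfolding range_l2_Lop by blast
  then obtain k' where k: "\<And>j. k' j \<in> range (Lb l)" "\<And>j. k j = seq (k' j)" by metis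
  have "(\<lambda>j. norm (k' j - y')) \<longlonglongrightarrow> 0"
    using * by (simp add: y k(2) l2norm_seq flip: seq_minus_fun)
  then have "k' \<longlonglongrightarrow> y'" by (simp add: LIM_zero_iff tendsto_norm_zero_iff)
  then have "y' \<in> range (Lb l)"
    using closed_range_Lb[OF l] k(1) closed_sequentially by blast
  then show "y \<in> range_l2 (Lop A l)" unfolding range_l2_Lop y by blast
qed

text \<open>Transfers a supplement from functions to the type \<open>ell2\<close>; the cardinality
  of B is recorded for the codimension count.\<close>

lemma fin_supplementD:
  assumes "fin_supplement (range_l2 (Lop A l)) W"
  shows "\<exists>B. finite B \<and> card B = dim W \<and> W = seq ` span B \<and> (\<forall>y. \<exists>x. \<exists>v\<in>span B. y = Lb l x + v)"
proof -
  have W: "subspace W" "W \<subseteq> l2" "{y + v |y v. y \<in> range_l2 (Lop A l) \<and> v \<in> W} = l2"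
    using assms unfolding fin_supplement_def by auto
  obtain B0 where B0: "finite B0" "W \<subseteq> span B0"
    using assms unfolding fin_supplement_def finite_dim_def by auto
  obtain B' where B': "B' \<subseteq> W" "independent B'" "W \<subseteq> span B'"
    using maximal_independent_subset by metis
  have sp: "span B' = W" using B' span_minimal[OF B'(1) W(1)] by auto
  have fin: "finite B'" using independent_span_bound[OF B0(1) B'(2)] B'(1) B0(2) by auto
  have seqE: "seq (Ell2 b) = b" if "b \<in> B'" for b
    using that B'(1) W(2) seq_Ell2_l2 by blast
  have im: "seq ` Ell2 ` B' = B'" using seqE by (simp add: image_image)
  have WB: "W = seq ` span (Ell2 ` B')"
    using linear_span_image[OF linear_seq, of "Ell2 ` B'"] unfolding im sp .
  have "\<exists>x. \<exists>v\<in>span (Ell2 ` B'). y = Lb l x + v" for y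
  proof -
    have "seq y \<in> {y + v |y v. y \<in> range_l2 (Lop A l) \<and> v \<in> W}"
      unfolding W(3) l2_eq_range_seq by blast
    then obtain x v where "v \<in> span (Ell2 ` B')" "seq y = seq (Lb l x) + seq v"
      unfolding range_l2_Lop WB by blast
    then show ?thesis unfolding seq_plus_fun[symmetric] seq_inject by blast
  qed
  moreover have "card (Ell2 ` B') = dim W"
    using seqE dim_span_eq_card_independent[OF B'(2)] sp
    by (subst card_image) (auto intro!: inj_on_inverseI[of _ seq])
  ultimately show ?thesis using fin WB by (intro exI[of _ "Ell2 ` B'"]) auto
qed

lemma fin_supplement_delta:
  assumes W: "subspace W" and surj: "\<And>y. \<exists>x. \<exists>w\<in>W. y = Lb l x + delta m w"
  shows "fin_supplement (range_l2 (Lop A l)) ((\<lambda>w. seq (delta m w)) ` W)"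
    and "dim ((\<lambda>w. seq (delta m w)) ` W) = dim W"
proof -
  have lin: "linear (\<lambda>w. seq (delta m w))"
    by (intro linear_compose[OF _ linear_seq, unfolded o_def] linear_blinfun_apply)
  have "inj (\<lambda>w. seq (delta m w))"
    by (rule inj_on_inverseI[of _ "\<lambda>x. x m"]) simp
  then show "dim ((\<lambda>w. seq (delta m w)) ` W) = dim W"
    by (intro dim_image_eq lin) (rule inj_on_subset, auto)
  obtain B where B: "finite B" "W \<subseteq> span B"
    using finite_Basis span_Basis by (metis top_greatest)
  have "(\<lambda>w. seq (delta m w)) ` W \<subseteq> span ((\<lambda>w. seq (delta m w)) ` B)"
    unfolding linear_span_image[OF lin] using B(2) by blast
  then have fd: "finite_dim ((\<lambda>w. seq (delta m w)) ` W)"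
    unfolding finite_dim_def using B(1) by blast
  have "{y + v |y v. y \<in> range_l2 (Lop A l) \<and> v \<in> (\<lambda>w. seq (delta m w)) ` W} = l2"
  proof
    show "{y + v |y v. y \<in> range_l2 (Lop A l) \<and> v \<in> (\<lambda>w. seq (delta m w)) ` W} \<subseteq> l2"
      unfolding range_l2_Lop l2_eq_range_seq by (auto simp flip: seq_plus_fun)
    show "l2 \<subseteq> {y + v |y v. y \<in> range_l2 (Lop A l) \<and> v \<in> (\<lambda>w. seq (delta m w)) ` W}"
    proof
      fix y :: "int \<Rightarrow> real^'d" assume "y \<in> l2"
      then obtain y' where y: "y = seq y'" unfolding l2_eq_range_seq by blast
      obtain x w where "w \<in> W" "y' = Lb l x + delta m w" using surj by blast
      then have "y = seq (Lb l x) + seq (delta m w)" "w \<in> W" unfolding y seq_plus_fun[symmetric] by auto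
      then show "y \<in> {y + v |y v. y \<in> range_l2 (Lop A l) \<and> v \<in> (\<lambda>w. seq (delta m w)) ` W}"
        unfolding range_l2_Lop by blast
    qed
  qed
  moreover have "(\<lambda>w. seq (delta m w)) ` W \<subseteq> l2" unfolding l2_eq_range_seq by blast
  ultimately show "fin_supplement (range_l2 (Lop A l)) ((\<lambda>w. seq (delta m w)) ` W)"
    unfolding fin_supplement_def using fd linear_subspace_image[OF lin W] by blast
qed

text \<open>The orthogonal complement of \<open>I l\<close>, placed at index m, is a supplement.
  Conversely, for any supplement with basis B, the defects of B together with a basis of
  \<open>I l\<close> span R^d, so no supplement is smaller.\<close>

lemma codim_range: "codim_l2 (range_l2 (Lop A l)) + dim (I l) = DIM(real^'d)"
proof -
  let ?W = "{w \<in> UNIV. \<forall>z\<in>I l. orthogonal z w}"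
  have W: "subspace ?W" by (auto simp: subspace_def orthogonal_def inner_add_right)
  have dW: "dim ?W + dim (I l) = DIM(real^'d)"
    using dim_subspace_orthogonal_to_vectors[OF subspace_I[OF l] subspace_UNIV] by simp
  have surj: "\<exists>x. \<exists>w\<in>?W. y = Lb l x + delta m w" for y
    using supplement_of_orthogonal[OF l, of y] by blast
  have "codim_l2 (range_l2 (Lop A l)) = dim ?W"
    unfolding codim_l2_def
  proof (rule Least_equality)
    show "\<exists>V. fin_supplement (range_l2 (Lop A l)) V \<and> dim V = dim ?W"
      using fin_supplement_delta[OF W surj] by blast
  next
    fix k assume "\<exists>V. fin_supplement (range_l2 (Lop A l)) V \<and> dim V = k"
    then obtain V where V: "fin_supplement (range_l2 (Lop A l)) V" "dim V = k" by blast
    then obtain B where B: "finite B" "card B = k" "\<And>y. \<exists>x. \<exists>v\<in>span B. y = Lb l x + v"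
      using fin_supplementD[OF V(1)] by blast
    obtain BI where BI: "BI \<subseteq> I l" "independent BI" "I l \<subseteq> span BI" "card BI = dim (I l)"
      using basis_exists by metis
    have finBI: "finite BI" using BI(2) independent_bound by blast
    let ?S = "BI \<union> (\<lambda>v. D l (0, v)) ` B"
    have "w \<in> span ?S" for w
    proof -
      obtain e v where ev: "v \<in> span B" "D l (e, v) = w"
        using D_surj_of_supplement[OF l B(3) subspace_span] by blast
      have "D l (e, 0) \<in> span ?S"
        using D_fst_in_I[OF l] BI(3) span_mono[of BI ?S] by blast
      moreover have "D l (0, v) \<in> span ?S"
        using ev(1) linear_span_image[OF linear_D_Pair(2)[OF l], of B] span_mono[of "(\<lambda>v. D l (0, v)) ` B" ?S] by blast
      ultimately show ?thesis using span_add ev(2) D_add[of l e v] by metis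
    qed
    then have "dim (UNIV :: (real^'d) set) \<le> card ?S"
      using finBI B(1) by (intro dim_le_card) auto
    also have "\<dots> \<le> card BI + card ((\<lambda>v. D l (0, v)) ` B)" by (rule card_Un_le)
    also have "\<dots> \<le> dim (I l) + k" using BI(4) card_image_le[OF B(1)] B(2) by (intro add_mono) auto
    finally show "dim ?W \<le> k" using dW by simp
  qed
  then show ?thesis using dW by simp
qed

text \<open>Rank and nullity of e to D l (e, 0) on the range of E l; \<open>Nr l\<close> carries its
  kernel bijectively to the kernel of L.\<close>

lemma dim_kernel: "dim (kernel_l2 (Lop A l)) + dim (I l) = dim (range (E l))"
  and finite_dim_kernel: "finite_dim (kernel_l2 (Lop A l))"
proof -
  let ?K = "{e \<in> range (E l). D l (e, 0) = 0}"
  let ?f = "\<lambda>e. seq (Nr l (e, 0))"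
  have k: "kernel_l2 (Lop A l) = ?f ` ?K"
    unfolding kernel_l2_Lop kernel_Lb[OF l] by (simp add: image_image)
  have lin: "linear ?f"
    by (rule linearI; simp add: blinfun.add_right[symmetric] blinfun.scaleR_right[symmetric]
        seq_plus_fun[symmetric] seq_scaleR_fun[symmetric])
  have "inj_on ?f (range (E l))"
    using inj_Nr_Pair[OF l] by (auto simp: inj_on_def seq_inject)
  moreover have "subspace ?K"
  proof -
    note sr = subspace_range_E[OF l] and lD = linear_D_Pair(1)[OF l]
    show ?thesis
      by (rule subspaceI; simp only: mem_Collect_eq subspace_0[OF sr] subspace_add[OF sr] subspace_scale[OF sr]
          linear_0[OF lD] linear_add[OF lD] linear_scale[OF lD]) simp_all
  qed
  ultimately have "dim (kernel_l2 (Lop A l)) = dim ?K"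
    unfolding k by (intro dim_image_eq lin) (rule inj_on_subset, auto simp: span_eq_iff[THEN iffD2])
  then show "dim (kernel_l2 (Lop A l)) + dim (I l) = dim (range (E l))"
    using dim_image_plus_dim_kernel[OF linear_D_Pair(1)[OF l] subspace_range_E[OF l]]
    by (simp add: I_def[OF l])
  have "kernel_l2 (Lop A l) \<subseteq> span (?f ` Basis)"
    unfolding k linear_span_image[OF lin] by auto
  then show "finite_dim (kernel_l2 (Lop A l))"
    unfolding finite_dim_def using finite_imageI[OF finite_Basis] by fast
qed

lemma fin_supplement_range_delta: "fin_supplement (range_l2 (Lop A l)) (range (\<lambda>w. seq (delta m w)))"
proof (rule fin_supplement_delta(1))
  show "\<exists>x. \<exists>w\<in>UNIV. y = Lb l x + delta m w" for y
    using supplement_of_orthogonal[OF l, of y] by blast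
qed simp

lemma fredholm_Lop: "fredholm_l2 (Lop A l)"
  unfolding fredholm_l2_def
  by (intro conjI exI[of _ "range (\<lambda>w. seq (delta m w))"] bounded_linear_l2_Lop finite_dim_kernel
      closed_l2_range fin_supplement_range_delta)

lemma fred_index_Lop: "fred_index (Lop A l) = int (dim (range (E l))) - int (DIM(real^'d))"
  unfolding fred_index_def using dim_kernel codim_range by linarith

end

end

section \<open>The index bundle\<close>

locale matrix_cut_system_supplement = 
  cut_system_supplement "\<lambda>n l. mat_op (A n l)" U m E R N C B V +
  matrix_cut_system A U m E R N C
  for A :: "int \<Rightarrow> complex \<Rightarrow> real^'d^'d" and U m
    and E :: "complex \<Rightarrow> (((real^'d) \<times> (real^'d)) \<Rightarrow>\<^sub>L ((real^'d) \<times> (real^'d)))" and R N C B V +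
  fixes P Q :: "complex \<Rightarrow> ((real^'d) \<Rightarrow>\<^sub>L (real^'d))"
  assumes E_Pair: "\<And>l p q. l \<in> U \<Longrightarrow> E l (p, q) = (P l p, q - Q l q)"
    and cont_Q: "continuous_on U Q"
    and Q_idem: "\<And>l q. l \<in> U \<Longrightarrow> Q l (Q l q) = Q l q"
begin

lemma is_bundle_preimage: "is_bundle l2 l2norm U (preimage_bundle (Lop A) (seq ` V))"
proof -
  obtain \<rho> where r: "continuous_on U \<rho>" "\<And>l w. l \<in> U \<Longrightarrow> D l (blinfun_apply (\<rho> l) w) = w"
    "\<And>l w. l \<in> U \<Longrightarrow> snd (blinfun_apply (\<rho> l) w) \<in> V"
    "\<And>l w. l \<in> U \<Longrightarrow> E l (fst (blinfun_apply (\<rho> l) w)) = fst (blinfun_apply (\<rho> l) w)"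
    using ex_rho by blast
  show ?thesis
  proof (rule is_bundle_projection_family[OF finite_T _ cont_Nr subspace_F])
    \<comment> \<open>As D is unchanged by \<open>Ep\<close> and \<open>\<rho> l\<close> is a right
      inverse of D, subtracting \<rho> (D z) from Ep z removes the defect. This projects
      \<open>span T\<close> onto \<open>F l\<close>.\<close>
    show "continuous_on U (\<lambda>l. Ep l - (\<rho> l o\<^sub>L D l))"
      by (intro continuous_intros cont_Ep r cont_D)
    fix l assume l: "l \<in> U"
    show "F l \<subseteq> span T" using span_T by (auto simp: F_def)
    show "inj_on (Nr l) (F l)" by (rule inj_Nr[OF l])
    show "preimage_bundle (Lop A) (seq ` V) l = (\<lambda>z. seq (Nr l z)) ` F l"
      unfolding preimage_bundle_def preimage_l2_Lop[OF l] image_F[OF l] by (simp add: image_image)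
    have E1: "E l (fst (Ep l z - \<rho> l w)) = fst (Ep l z - \<rho> l w)" for z w
      by (simp add: Ep_apply blinfun.diff_right r(4)[OF l] E_idem[OF l])
    show "(Ep l - (\<rho> l o\<^sub>L D l)) z \<in> F l" if "z \<in> span T" for z
      using that span_T[of z] r(3)[OF l, of "D l z"] E1[of z "D l z"]
      unfolding F_def by (auto simp: V D_E[OF l] blinfun.diff_left blinfun.diff_right r(2)[OF l] D_Ep[OF l] Ep_apply span_diff)
    show "(Ep l - (\<rho> l o\<^sub>L D l)) z = z" if "z \<in> F l" for z
      using that by (cases z) (simp add: F_def blinfun.diff_left Ep_apply blinfun.zero_right)
  qed
qed

text \<open>The auxiliary bundle in \<open>KO_diff_eq\<close> must have fibres in l2, so E^u(-oo) is
  placed at index 0.\<close>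

lemma is_bundle_unstable: "is_bundle l2 l2norm U (\<lambda>l. (\<lambda>u. seq (delta 0 u)) ` {u. Q l u = 0})"
proof (rule is_bundle_projection_family[OF finite_Basis])
  show "continuous_on U (\<lambda>l. id_blinfun - Q l)" by (intro continuous_intros cont_Q)
  show "continuous_on U (\<lambda>l. delta 0)" by (rule continuous_on_const)
  show "subspace {u. Q l u = 0}" for l
    by (auto simp: subspace_def blinfun.add_right blinfun.scaleR_right blinfun.zero_right)
  show "inj_on (delta 0) {u. Q l u = 0}" for l
    by (rule inj_on_inverseI[of _ "\<lambda>x. seq x 0"]) simp
qed (auto simp: blinfun.diff_left blinfun.diff_right Q_idem)

text \<open>Each t = (p, q, v) in E^s(+oo) x E^u(-oo) x V is a kernel vector of D plus \<rho> (D t).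
  The kernel vector is (C x, L x) for a unique x in L^{-1}(V), and w = D t splits into s = Q w and u
  = w - Q w. The auxiliary bundle E^u(-oo) occurs on both sides, as u on the left and as q on the
  right.\<close>

theorem KO_diff_eq_preimage:
  assumes SP: "\<And>l. l \<in> U \<Longrightarrow> SP l = range (P l)" and SQ: "\<And>l. l \<in> U \<Longrightarrow> SQ l = range (Q l)"
  shows "KO_diff_eq U (preimage_bundle (Lop A) (seq ` V)) (\<lambda>_. seq ` V) SP SQ"
proof -
  obtain \<rho> where r: "continuous_on U \<rho>" "\<And>l w. l \<in> U \<Longrightarrow> D l (blinfun_apply (\<rho> l) w) = w"
    "\<And>l w. l \<in> U \<Longrightarrow> snd (blinfun_apply (\<rho> l) w) \<in> V"
    "\<And>l w. l \<in> U \<Longrightarrow> E l (fst (blinfun_apply (\<rho> l) w)) = fst (blinfun_apply (\<rho> l) w)"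
    using ex_rho by blast
  let ?G = "\<lambda>l. (\<lambda>u. seq (delta 0 u)) ` {u. Q l u = 0}"
  define J1 :: "((real^'d) ell2 \<times> (real^'d)) \<times> (real^'d) ell2 \<Rightarrow> _"
    where "J1 = map_prod (map_prod seq (\<lambda>s. s)) seq"
  define J2 :: "((real^'d) \<times> (real^'d) ell2) \<times> (real^'d) ell2 \<Rightarrow> _"
    where "J2 = map_prod (map_prod (\<lambda>p. p) seq) seq"
  define K1 :: "_ \<Rightarrow> ((real^'d) ell2 \<times> (real^'d)) \<times> (real^'d) ell2"
    where "K1 = map_prod (map_prod Ell2 (\<lambda>s. s)) Ell2"
  define K2 :: "_ \<Rightarrow> ((real^'d) \<times> (real^'d) ell2) \<times> (real^'d) ell2"
    where "K2 = map_prod (map_prod (\<lambda>p. p) Ell2) Ell2"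
  define E' where "E' = (\<lambda>l. ({x. Lb l x \<in> V} \<times> range (Q l)) \<times> delta 0 ` {u. Q l u = 0})"
  define F' where "F' = (\<lambda>l. (range (P l) \<times> V) \<times> delta 0 ` {u. Q l u = 0})"
  define \<Theta> where "\<Theta> = (\<lambda>l. (inl_blinfun o\<^sub>L (C l o\<^sub>L (fst_blinfun o\<^sub>L fst_blinfun)))
    + (inr_blinfun o\<^sub>L (Lb l o\<^sub>L (fst_blinfun o\<^sub>L fst_blinfun)))
    + (\<rho> l o\<^sub>L ((snd_blinfun o\<^sub>L fst_blinfun) + (ev 0 o\<^sub>L snd_blinfun))))"
  define \<Phi> where "\<Phi> = (\<lambda>l. (inl_blinfun o\<^sub>L ((inl_blinfun o\<^sub>L (fst_blinfun o\<^sub>L (fst_blinfun o\<^sub>L \<Theta> l)))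
        + (inr_blinfun o\<^sub>L (snd_blinfun o\<^sub>L \<Theta> l))))
    + (inr_blinfun o\<^sub>L (delta 0 o\<^sub>L (snd_blinfun o\<^sub>L (fst_blinfun o\<^sub>L \<Theta> l)))))"
  \<comment> \<open>Restores the order of the parameters: q, stored at index 0 in the last
    component, goes back next to p.\<close>
  define M :: "(((real^'d) \<times> (real^'d) ell2) \<times> (real^'d) ell2) \<Rightarrow>\<^sub>L
      (((real^'d) \<times> (real^'d)) \<times> (real^'d) ell2)"
    where "M = (inl_blinfun o\<^sub>L ((inl_blinfun o\<^sub>L (fst_blinfun o\<^sub>L fst_blinfun)) + (inr_blinfun o\<^sub>L (ev 0 o\<^sub>L snd_blinfun))))
    + (inr_blinfun o\<^sub>L (snd_blinfun o\<^sub>L fst_blinfun))"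
  define \<Psi> where "\<Psi> = (\<lambda>l. (inl_blinfun o\<^sub>L ((inl_blinfun o\<^sub>L (Nr l o\<^sub>L (M - (\<rho> l o\<^sub>L (D l o\<^sub>L M)))))
        + (inr_blinfun o\<^sub>L (Q l o\<^sub>L (D l o\<^sub>L M)))))
    + (inr_blinfun o\<^sub>L (delta 0 o\<^sub>L ((id_blinfun - Q l) o\<^sub>L (D l o\<^sub>L M)))))"
  have \<Theta>: "\<Theta> l ((x, s), g) = (C l x, Lb l x) + \<rho> l (s + seq g 0)" for l x s g
    unfolding \<Theta>_def by (simp add: blinfun.add_left)
  have \<Phi>: "\<Phi> l z = ((fst (fst (\<Theta> l z)), snd (\<Theta> l z)), delta 0 (snd (fst (\<Theta> l z))))" for l z
    unfolding \<Phi>_def by (simp add: blinfun.add_left)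
  have M: "M ((p, v), g) = ((p, seq g 0), v)" for p v g
    unfolding M_def by (simp add: blinfun.add_left)
  have \<Psi>: "\<Psi> l z = ((Nr l (M z - \<rho> l (D l (M z))), Q l (D l (M z))), delta 0 (D l (M z) - Q l (D l (M z))))" for l z
    unfolding \<Psi>_def by (simp add: blinfun.add_left blinfun.diff_left)
  have "bundle_iso (prod_nm (prod_nm l2norm norm) l2norm) (prod_nm (prod_nm norm l2norm) l2norm) U
     (dsum (dsum (preimage_bundle (Lop A) (seq ` V)) SQ) ?G)
     (dsum (dsum SP (\<lambda>_. seq ` V)) ?G)"
  proof (rule bundle_iso_of_blinfuns[of J1 K1 _ J2 K2 _ _ \<Phi> \<Psi> _ E' _ F'])
    show "linear J1" "linear J2"
      unfolding J1_def J2_def by (rule linearI; auto simp: seq_plus_fun seq_scaleR_fun)+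
    show "K1 (J1 z) = z" for z by (simp add: K1_def J1_def seq_inverse map_prod_def case_prod_unfold)
    show "K2 (J2 z) = z" for z by (simp add: K2_def J2_def seq_inverse map_prod_def case_prod_unfold)
    have J1: "J1 z = ((seq (fst (fst z)), snd (fst z)), seq (snd z))" for z
      by (simp add: J1_def map_prod_def case_prod_unfold)
    have J2: "J2 z = ((fst (fst z), seq (snd (fst z))), seq (snd z))" for z
      by (simp add: J2_def map_prod_def case_prod_unfold)
    note n1 = cont_nm_prod[OF l2norm_nonneg norm_ge_zero] and n2 = cont_nm_prod[OF norm_ge_zero l2norm_nonneg]
    show "cont_nm (prod_nm (prod_nm l2norm norm) l2norm) X (\<lambda>l. J1 (z l)) \<longleftrightarrow> continuous_on X z" for X z
      unfolding J1 cont_nm_prod[OF prod_nm_nonneg[OF l2norm_nonneg norm_ge_zero] l2norm_nonneg]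
        n1 fst_conv snd_conv cont_nm_seq cont_nm_norm
        continuous_on_Pair_iff[of X z] continuous_on_Pair_iff[of X "\<lambda>l. fst (z l)"] ..
    show "cont_nm (prod_nm (prod_nm norm l2norm) l2norm) X (\<lambda>l. J2 (z l)) \<longleftrightarrow> continuous_on X z" for X z
      unfolding J2 cont_nm_prod[OF prod_nm_nonneg[OF norm_ge_zero l2norm_nonneg] l2norm_nonneg]
        n2 fst_conv snd_conv cont_nm_seq cont_nm_norm
        continuous_on_Pair_iff[of X z] continuous_on_Pair_iff[of X "\<lambda>l. fst (z l)"] ..
    have "continuous_on U \<Theta>"
      unfolding \<Theta>_def by (intro continuous_intros cont_C cont_Lb r(1))
    then show "continuous_on U \<Phi>"
      unfolding \<Phi>_def by (intro continuous_intros)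
    show "continuous_on U \<Psi>"
      unfolding \<Psi>_def by (intro continuous_intros cont_Nr cont_D cont_Q r(1))
    fix l assume l: "l \<in> U"
    have pre: "preimage_bundle (Lop A) (seq ` V) l = seq ` {x. Lb l x \<in> V}"
      unfolding preimage_bundle_def preimage_l2_Lop[OF l] ..
    show "dsum (dsum (preimage_bundle (Lop A) (seq ` V)) SQ) ?G l = J1 ` E' l"
      unfolding dsum_def pre SQ[OF l] E'_def J1_def by (simp add: map_prod_surj_on[OF map_prod_surj_on[OF refl refl] refl] image_image)
    show "dsum (dsum SP (\<lambda>_. seq ` V)) ?G l = J2 ` F' l"
      unfolding dsum_def SP[OF l] F'_def J2_def by (simp add: map_prod_surj_on[OF map_prod_surj_on[OF refl refl] refl] image_image)
    have EP: "E l (p, q) = (p, q) \<longleftrightarrow> P l p = p \<and> Q l q = 0" for p q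
      by (simp add: E_Pair[OF l])
    have rP: "p \<in> range (P l) \<longleftrightarrow> P l p = p" for p
    proof
      assume "p \<in> range (P l)"
      then obtain p' where "p = P l p'" by blast
      then show "P l p = p" using E_idem[OF l, of "(p', 0)"] by (simp add: E_Pair[OF l])
    qed (metis rangeI)
    show "\<Phi> l z \<in> F' l \<and> \<Psi> l (\<Phi> l z) = z" if zE: "z \<in> E' l" for z
    proof -
      obtain x s u where z: "z = ((x, s), delta 0 u)" "Lb l x \<in> V" "s \<in> range (Q l)" "Q l u = 0"
        using zE unfolding E'_def by blast
      have s: "Q l s = s" using z(3) Q_idem[OF l] by auto
      obtain p q v where t: "\<Theta> l z = ((p, q), v)" by (metis surj_pair)
      have tr: "((p, q), v) = (C l x, Lb l x) + \<rho> l (s + u)" using t[symmetric] unfolding z(1) \<Theta> by (simp only: seq_delta simp_thms if_True)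
      have "E l (p, q) = (p, q)"
        using arg_cong[OF tr, of fst] E_C[OF l] r(4)[OF l] by (simp add: blinfun.add_right)
      then have pq: "P l p = p" "Q l q = 0" using EP by blast+
      have v: "v \<in> V" using arg_cong[OF tr, of snd] z(2) r(3)[OF l] unfolding V by (simp add: span_add)
      have Fz: "\<Phi> l z = ((p, v), delta 0 q)" unfolding \<Phi> t by simp
      have "\<Phi> l z \<in> F' l" unfolding Fz F'_def using pq v rP by (intro SigmaI imageI CollectI) blast+
      \<comment> \<open>(C x, L x) lies in the kernel of D and \<rho> is a right inverse, so D
        returns s + u; Q then separates the two summands.\<close>
      moreover have Dt: "D l ((p, q), v) = s + u"
        unfolding tr blinfun.add_right r(2)[OF l] solution_parameters(2)[OF l refl] by simp
      have "\<Psi> l (\<Phi> l z) = z"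
        unfolding Fz \<Psi> M seq_delta if_True simp_thms Dt
        unfolding tr add_diff_cancel_right' solution_parameters(1)[OF l refl, symmetric]
        by (simp add: z(1) z(4) s blinfun.add_right)
      ultimately show ?thesis by blast
    qed
    show "\<Psi> l z \<in> E' l \<and> \<Phi> l (\<Psi> l z) = z" if zF: "z \<in> F' l" for z
    proof -
      obtain p v q where z: "z = ((p, v), delta 0 q)" "P l p = p" "v \<in> V" "Q l q = 0"
        using zF rP unfolding F'_def by blast
      let ?w = "D l ((p, q), v)"
      \<comment> \<open>Subtracting \<rho> of the defect cancels it, which puts \<open>?t\<close>
        into the kernel \<open>F l\<close>.\<close>
      let ?t = "((p, q), v) - \<rho> l ?w"
      have Mz: "M z = ((p, q), v)" unfolding z(1) M by simp
      have tF: "?t \<in> F l"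
      proof -
        have e: "E l (p, q) = (p, q)" using EP z(2,4) by blast
        have "E l (fst ?t) = fst ?t"
          by (simp add: e r(4)[OF l] blinfun.diff_right)
        moreover have "snd ?t \<in> V" using z(3) r(3)[OF l] unfolding V by (simp add: span_diff)
        moreover have "D l ?t = 0" by (simp add: blinfun.diff_right r(2)[OF l])
        ultimately show ?thesis unfolding F_def by blast
      qed
      have Yz: "\<Psi> l z = ((Nr l ?t, Q l ?w), delta 0 (?w - Q l ?w))" unfolding \<Psi> Mz ..
      have Qw: "Q l (?w - Q l ?w) = 0" using Q_idem[OF l] by (simp add: blinfun.diff_right)
      have "Nr l ?t \<in> {x. Lb l x \<in> V}" using tF image_F[OF l] by blast
      then have "\<Psi> l z \<in> E' l" unfolding Yz E'_def
        using Qw by (intro SigmaI imageI CollectI rangeI) blast+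
      moreover have "\<Theta> l (\<Psi> l z) = ((p, q), v)"
        unfolding Yz \<Theta> parameters_Nr[OF l tF] by simp
      then have "\<Phi> l (\<Psi> l z) = z" unfolding \<Phi> z(1) by simp
      ultimately show ?thesis by blast
    qed
  qed
  then show ?thesis unfolding KO_diff_eq_def using is_bundle_unstable by blast
qed

end

lemma bounded_linear_mat_op: "bounded_linear (mat_op :: real^'n^'m \<Rightarrow> _)"
  unfolding linear_conv_bounded_linear[symmetric]
  by (rule linearI; rule blinfun_eqI)
     (simp_all add: matrix_vector_mult_add_rdistrib blinfun.add_left blinfun.scaleR_left scaleR_matrix_vector_assoc)

theorem mainTheorem3:
  fixes a :: "int \<Rightarrow> complex \<Rightarrow> real^'d^'d"
    and aP aM :: "complex \<Rightarrow> real^'d^'d"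
  assumes cont: "\<And>n. continuous_on S1 (a n)"
    and inv: "\<And>n lam. lam \<in> S1 \<Longrightarrow> invertible (a n lam)"
    and limP: "\<forall>e>0. \<exists>N. \<forall>n\<ge>N. \<forall>lam\<in>S1. norm (a n lam - aP lam) < e"
    and limM: "\<forall>e>0. \<exists>N. \<forall>n\<le>N. \<forall>lam\<in>S1. norm (a n lam - aM lam) < e"
    and hypP: "\<And>lam. lam \<in> S1 \<Longrightarrow> hyperbolic (aP lam)"
    and hypM: "\<And>lam. lam \<in> S1 \<Longrightarrow> hyperbolic (aM lam)"
  shows "(\<forall>lam\<in>S1. fredholm_l2 (Lop a lam) \<and>
            fred_index (Lop a lam) = int (dim (Es (aP lam))) - int (dim (Es (aM lam))))
       \<and> (\<exists>V. fin_supplement_all a V)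
       \<and> (\<forall>V. fin_supplement_all a V \<longrightarrow>
            is_bundle l2 l2norm S1 (preimage_bundle (Lop a) V) \<and>
            KO_diff_eq S1 (preimage_bundle (Lop a) V) (\<lambda>_. V)
               (\<lambda>lam. Es (aP lam)) (\<lambda>lam. Es (aM lam)))"
proof -
  let ?a = "\<lambda>n l. mat_op (a n l)"
  let ?A = "\<lambda>l. mat_op (aP l)" and ?B = "\<lambda>l. mat_op (aM l)"
  have conta: "continuous_on S1 (?a n)" for n
    by (intro bounded_linear.continuous_on[OF bounded_linear_mat_op] cont)
  have "uniform_limit S1 a aP at_top" "uniform_limit S1 a aM at_bot"
    using limP limM unfolding uniform_limit_iff eventually_at_top_linorder eventually_at_bot_linorder dist_norm
    by blast+
  then have limA: "uniform_limit S1 ?a ?A at_top" and limB: "uniform_limit S1 ?a ?B at_bot"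
    by (intro bounded_linear.uniform_limit[OF bounded_linear_mat_op]; simp)+
  have contA: "continuous_on S1 ?A" and contB: "continuous_on S1 ?B"
    using continuous_on_uniform_limit_int[OF conta _ limA] continuous_on_uniform_limit_int[OF conta _ limB] by auto
  obtain G where G: "\<And>l. l \<in> S1 \<Longrightarrow> inverts_shift_minus (G l) (?A l)"
    using hyperbolic_shift_minus_invertible[OF hypP] by metis
  obtain H where H: "\<And>l. l \<in> S1 \<Longrightarrow> inverts_shift_minus (H l) (?B l)"
    using hyperbolic_shift_minus_invertible[OF hypM] by metis
  obtain m0 m R N C where S: "continuous_on S1 R" "continuous_on S1 N" "continuous_on S1 C"
    "\<And>l. l \<in> S1 \<Longrightarrow> cut_solution (\<lambda>n. ?a n l) (cut_proj (G l) (H l) m0 m) m m (R l) (N l) (C l)"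
    using ex_cut_solution[OF compact_sphere conta limA limB G H] by metis
  \<comment> \<open>Although the gap has been closed to the single index m, the unstable parameter
    still sits at the original left end m0.\<close>
  let ?P = "\<lambda>l. stable_proj (G l) (m + 1)" and ?Q = "\<lambda>l. stable_proj (H l) m0"
  let ?E = "\<lambda>l. cut_proj (G l) (H l) m0 m"
  have contG: "continuous_on S1 G" and contH: "continuous_on S1 H"
    using continuous_on_shift_inverse[OF contA G] continuous_on_shift_inverse[OF contB H] by auto
  have contQ: "continuous_on S1 ?Q"
    unfolding stable_proj_def by (intro continuous_intros contH)
  have EsP: "Es (aP l) = range (?P l)" and EsM: "Es (aM l) = range (?Q l)" if "l \<in> S1" for l
    using that Es_eq_stable_set[OF hypP] Es_eq_stable_set[OF hypM] range_stable_proj[OF G] range_stable_proj[OF H]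
    by (simp_all add: mat_op.rep_eq)
  interpret matrix_cut_system a S1 m ?E R N C
  proof
    show "continuous_on S1 (\<lambda>l. mulop (\<lambda>n. ?a n l))"
      by (intro continuous_on_mulop_uniform bounded_of_limits[OF limA limB]
          uniform_equicontinuous[OF conta limA limB])
    show "continuous_on S1 ?E"
      unfolding cut_proj_def stable_proj_def by (intro continuous_intros contG contH)
  qed (use bounded_of_limits[OF limA limB] conta S in auto)
  have dimE: "int (dim (range (?E l))) - int (DIM(real^'d)) = int (dim (Es (aP l))) - int (dim (Es (aM l)))"
    if l: "l \<in> S1" for l
  proof -
    \<comment> \<open>E^u(-oo): the kernel of \<open>?Q l\<close> is the range of the complementary
      projection, and rank and nullity of \<open>?Q l\<close> give it dimension d - dim
      E^s(-oo).\<close>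
    let ?K = "{q \<in> UNIV. ?Q l q = 0}"
    have K: "?K = range (\<lambda>q. q - ?Q l q)"
      using stable_proj_idem[OF H[OF l]] by (auto simp: blinfun.diff_right image_iff) (metis diff_zero)
    have "range (?E l) = Es (aP l) \<times> ?K"
      unfolding K EsP[OF l] by (force simp: image_iff)
    moreover have "subspace (Es (aP l))"
      unfolding EsP[OF l] by (intro linear_subspace_image linear_blinfun_apply subspace_UNIV)
    moreover have "subspace ?K"
      by (auto simp: subspace_def blinfun.add_right blinfun.scaleR_right blinfun.zero_right)
    ultimately have "dim (range (?E l)) = dim (Es (aP l)) + dim ?K"
      by (simp only: dim_Times)
    moreover have "dim (Es (aM l)) + dim ?K = DIM(real^'d)"
      unfolding EsM[OF l] using dim_image_plus_dim_kernel[OF linear_blinfun_apply subspace_UNIV, of "?Q l"] by simp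
    ultimately show ?thesis by linarith
  qed
  have index_bundle: "is_bundle l2 l2norm S1 (preimage_bundle (Lop a) V) \<and>
      KO_diff_eq S1 (preimage_bundle (Lop a) V) (\<lambda>_. V) (\<lambda>lam. Es (aP lam)) (\<lambda>lam. Es (aM lam))"
    if V: "fin_supplement_all a V" for V
  proof -
    have fs: "fin_supplement (range_l2 (Lop a l)) V" if "l \<in> S1" for l
      using V that unfolding fin_supplement_all_def by blast
    have one: "1 \<in> S1" by simp
    \<comment> \<open>The spanning set is taken at the point 1. V is the same at every point, so
      injectivity of \<open>seq\<close> lets this one B serve for all of them.\<close>
    obtain B where B: "finite B" "V = seq ` span B" using fin_supplementD[OF one fs[OF one]] by blast
    have surj: "\<exists>x. \<exists>v\<in>span B. y = Lb l x + v" if l: "l \<in> S1" for l y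
    proof -
      obtain B' where "V = seq ` span B'" "\<And>y. \<exists>x. \<exists>v\<in>span B'. y = Lb l x + v"
        using fin_supplementD[OF l fs[OF l]] by blast
      moreover have "inj seq" by (auto simp: inj_def seq_inject)
      ultimately show ?thesis using B(2) inj_image_eq_iff by metis
    qed
    interpret V: matrix_cut_system_supplement a S1 m ?E R N C B "span B" ?P ?Q
      by unfold_locales (assumption | rule B(1) refl surj cut_proj_apply contQ stable_proj_idem[OF H])+
    show ?thesis
      unfolding B(2) using V.is_bundle_preimage V.KO_diff_eq_preimage[of "\<lambda>l. Es (aP l)" "\<lambda>l. Es (aM l)"] EsP EsM
      by blast
  qed
  show ?thesis
  proof (intro conjI ballI allI impI)
    show "\<exists>V. fin_supplement_all a V"
      using fin_supplement_range_delta unfolding fin_supplement_all_def by blast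
  qed (use fredholm_Lop fred_index_Lop dimE index_bundle in auto)
qed

end
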